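(* Let $0<\lambda\le\Lambda$ with $\omega:=\Lambda/\lambda\ge4$ and $\Gamma_\omega:=\left[\frac{2}{\sqrt\omega},\frac{\sqrt\omega}{2}\right]$. For every $\gamma\in\Gamma_\omega$ and every $a\in\mathbb R$ with $|a|<\pi$, the function $u^\omega_{\gamma,a}$ satisfies $$-\mathcal M^+_{\lambda,\Lambda}\big(D^2u^\omega_{\gamma,a}\big)\ \ge\ \frac{\lambda\pi^2}{\pi^2-a^2}\,u^\omega_{\gamma,a}\qquad\text{in }\Omega^\omega_{\gamma,a}$$ in the viscosity sense. Consequently, $$\mu_1^+(\Omega^\omega_{\gamma,a})\ \ge\ \frac{\lambda\pi^2}{\pi^2-a^2}.$$ Moreover, equality holds in this lower bound for $\mu_1^+(\Omega^\omega_{\gamma,a})$ if and only if $a=0$.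
   Context: Pucci operator: for a symmetric $n\times n$ matrix $X$ with eigenvalues $e_1,\dots,e_n$, $\mathcal M^+_{\lambda,\Lambda}(X)=\Lambda\sum_{e_i>0}e_i+\lambda\sum_{e_i<0}e_i$. For a bounded domain $\Omega$, the principal positive half-eigenvalue is $\mu_1^+(\Omega)=\sup\{\mu\in\mathbb R:\exists\,\phi>0\text{ in }\Omega,\ \mathcal M^+_{\lambda,\Lambda}(D^2\phi)+\mu\phi\le 0\text{ in }\Omega\}$, where $\phi$ is continuous and the inequality is in the viscosity sense. The domains $\Omega^\omega_\gamma\subset\mathbb R^3$. Let $\alpha=\pi/2$. In the first octant $\{x,y,z\ge0\}$ define seven closed pieces: $[\mathrm C]=\{0\le x,y,z\le\alpha\}$; $[\mathrm Z]=\{0\le x,y\le\alpha,\ \alpha\le z\le\alpha+\sqrt\omega\arcsin(\frac{\gamma}{\sqrt\omega}(\cos x+\cos y))\}$; $[\mathrm X]=\{0\le y,z\le\alpha,\ \alpha\le x\le\alpha+\sqrt\omega\arcsin(\frac{\gamma\cos y+\cos z}{\gamma\sqrt\omega})\}$; $[\mathrm Y]=\{0\le x,z\le\alpha,\ \alpha\le y\le\alpha+\sqrt\omega\arcsin(\frac{\gamma\cos x+\cos z}{\gamma\sqrt\omega})\}$; $[\mathrm{ZX}]=\{\alpha\le x\le\alpha+\sqrt\omega\arcsin(\frac1{\sqrt\omega}),\ \alpha\le z\le\alpha+\sqrt\omega\arcsin(\frac{\gamma}{\sqrt\omega}),\ 0\le\theta\le1,\ 0\le y\le\arccos\theta\}$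 with $\theta=\sqrt\omega\sin(\frac{x-\alpha}{\sqrt\omega})+\frac{\sqrt\omega}{\gamma}\sin(\frac{z-\alpha}{\sqrt\omega})$; $[\mathrm{XY}]=\{\alpha\le x,y\le\alpha+\sqrt\omega\arcsin(\frac1{\gamma\sqrt\omega}),\ 0\le\theta\le1,\ 0\le z\le\arccos\theta\}$ with $\theta=\gamma\sqrt\omega\sin(\frac{x-\alpha}{\sqrt\omega})+\gamma\sqrt\omega\sin(\frac{y-\alpha}{\sqrt\omega})$; $[\mathrm{YZ}]=\{\alpha\le y\le\alpha+\sqrt\omega\arcsin(\frac1{\sqrt\omega}),\ \alpha\le z\le\alpha+\sqrt\omega\arcsin(\frac{\gamma}{\sqrt\omega}),\ 0\le\theta\le1,\ 0\le x\le\arccos\theta\}$ with $\theta=\sqrt\omega\sin(\frac{y-\alpha}{\sqrt\omega})+\frac{\sqrt\omega}{\gamma}\sin(\frac{z-\alpha}{\sqrt\omega})$. (For $\gamma\in\Gamma_\omega$ all inverse trigonometric expressions, on principal branches, are well defined.) Let $K$ be the union of the seven pieces. $\Omega^\omega_\gamma$ is the interior of the reflected union $\{(\sigma_1x,\sigma_2y,\sigma_3z):(x,y,z)\in K,\ \sigma_i\in\{-1,1\}\}$. The function $u^{\omega,+}_\gamma$ on $K$ is defined piecewise by (using $\cos(t+\pi/2)=-\sin t$): on $[\mathrm C]$: $\gamma\cos x+\gamma\cos y+\cos z$; on $[\mathrm Z]$: $\gamma\cos x+\gamma\cos y-\sqrt\omega\sin(\frac{z-\alpha}{\sqrt\omega})$;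 on $[\mathrm X]$: $-\gamma\sqrt\omega\sin(\frac{x-\alpha}{\sqrt\omega})+\gamma\cos y+\cos z$; on $[\mathrm Y]$: $\gamma\cos x-\gamma\sqrt\omega\sin(\frac{y-\alpha}{\sqrt\omega})+\cos z$; on $[\mathrm{ZX}]$: $-\gamma\sqrt\omega\sin(\frac{x-\alpha}{\sqrt\omega})+\gamma\cos y-\sqrt\omega\sin(\frac{z-\alpha}{\sqrt\omega})$; on $[\mathrm{XY}]$: $-\gamma\sqrt\omega\sin(\frac{x-\alpha}{\sqrt\omega})-\gamma\sqrt\omega\sin(\frac{y-\alpha}{\sqrt\omega})+\cos z$; on $[\mathrm{YZ}]$: $\gamma\cos x-\gamma\sqrt\omega\sin(\frac{y-\alpha}{\sqrt\omega})-\sqrt\omega\sin(\frac{z-\alpha}{\sqrt\omega})$. The function $u^\omega_\gamma$ is its even extension: $u^\omega_\gamma(x,y,z)=u^{\omega,+}_\gamma(|x|,|y|,|z|)$ on $\overline{\Omega^\omega_\gamma}$. Shear: for $|a|<\pi$ let $s(a)=\sqrt{1-(a/\pi)^2}$ and $C_a=\begin{pmatrix}s(a)&0&0\\ a/\pi&1&0\\ 0&0&s(a)\end{pmatrix}$. Then $\Omega^\omega_{\gamma,a}:=C_a(\Omega^\omega_\gamma)$ and $u^\omega_{\gamma,a}(X):=u^\omega_\gamma(C_a^{-1}X)$ for $X\in\Omega^\omega_{\gamma,a}$. *)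

theory Defs
  imports "HOL-Analysis.Analysis" "HOL-Computational_Algebra.Polynomial"
begin

section \<open>The maximal Pucci operator\<close>

definition charpoly :: "real^'n^'n \<Rightarrow> real poly" where
  "charpoly X = det (mat [:0, 1:] - map_matrix (\<lambda>c. [:c:]) X)"

text \<open>Eigenvalues are counted with (algebraic) multiplicity. For a symmetric matrix this is a
  multiset of size \<open>CARD('n)\<close>.\<close>
definition eigenvalues :: "real^'n^'n \<Rightarrow> real multiset" where
  "eigenvalues X = proots (charpoly X)"

definition pucci :: "real \<Rightarrow> real \<Rightarrow> real^'n^'n \<Rightarrow> real" where
  "pucci lam Lam X =
     Lam * (\<Sum>e\<in>#{#e \<in># eigenvalues X. e > 0#}. e) + lam * (\<Sum>e\<in>#{#e \<in># eigenvalues X. e < 0#}. e)"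


section \<open>Viscosity inequalities and the principal half-eigenvalue\<close>

text \<open>\<open>\<phi>\<close> is of class \<open>C\<^sup>2\<close> on the open set \<open>U\<close>, with gradient \<open>g\<close> and Hessian \<open>H\<close>.
  Symmetry of \<open>H\<close> is then automatic.\<close>
definition C2_on :: "(real^'n) set \<Rightarrow> (real^'n \<Rightarrow> real) \<Rightarrow> (real^'n \<Rightarrow> real^'n) \<Rightarrow>
    (real^'n \<Rightarrow> real^'n^'n) \<Rightarrow> bool" where
  "C2_on U \<phi> g H \<longleftrightarrow> open U \<and>
     (\<forall>x\<in>U. (\<phi> has_derivative (\<lambda>h. g x \<bullet> h)) (at x) \<and> (g has_derivative (\<lambda>h. H x *v h)) (at x)) \<and>
     continuous_on U H"

text \<open>\<open>F(u, D\<^sup>2u) \<ge> 0\<close> in \<open>\<Omega>\<close> in the viscosity sense, for continuous \<open>u\<close>: whenever a \<open>C\<^sup>2\<close> function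
  \<open>\<phi>\<close> is such that \<open>u - \<phi>\<close> has a local minimum at \<open>x\<close>, then \<open>F(u(x), D\<^sup>2\<phi>(x)) \<ge> 0\<close>.\<close>
definition viscosity_supersolution ::
    "(real \<Rightarrow> real^'n^'n \<Rightarrow> real) \<Rightarrow> (real^'n) set \<Rightarrow> (real^'n \<Rightarrow> real) \<Rightarrow> bool" where
  "viscosity_supersolution F \<Omega> u \<longleftrightarrow> continuous_on \<Omega> u \<and>
     (\<forall>x U \<phi> g H. x \<in> U \<and> U \<subseteq> \<Omega> \<and> C2_on U \<phi> g H \<and> (\<forall>y\<in>U. u x - \<phi> x \<le> u y - \<phi> y)
        \<longrightarrow> F (u x) (H x) \<ge> 0)"

definition mu1_plus :: "real \<Rightarrow> real \<Rightarrow> (real^'n) set \<Rightarrow> ereal" where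
  "mu1_plus lam Lam \<Omega> = Sup {ereal \<mu> | \<mu>. \<exists>\<phi>. (\<forall>x\<in>\<Omega>. \<phi> x > 0) \<and>
     viscosity_supersolution (\<lambda>r X. - (pucci lam Lam X + \<mu> * r)) \<Omega> \<phi>}"


section \<open>The domains\<close>

abbreviation alpha :: real where "alpha \<equiv> pi / 2"

definition piece_C :: "(real^3) set" where
  "piece_C = {p. 0 \<le> p$1 \<and> p$1 \<le> alpha \<and> 0 \<le> p$2 \<and> p$2 \<le> alpha \<and> 0 \<le> p$3 \<and> p$3 \<le> alpha}"

definition piece_Z :: "real \<Rightarrow> real \<Rightarrow> (real^3) set" where
  "piece_Z w \<gamma> = {p. 0 \<le> p$1 \<and> p$1 \<le> alpha \<and> 0 \<le> p$2 \<and> p$2 \<le> alpha \<and>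
     alpha \<le> p$3 \<and> p$3 \<le> alpha + sqrt w * arcsin (\<gamma> / sqrt w * (cos (p$1) + cos (p$2)))}"

definition piece_X :: "real \<Rightarrow> real \<Rightarrow> (real^3) set" where
  "piece_X w \<gamma> = {p. 0 \<le> p$2 \<and> p$2 \<le> alpha \<and> 0 \<le> p$3 \<and> p$3 \<le> alpha \<and>
     alpha \<le> p$1 \<and> p$1 \<le> alpha + sqrt w * arcsin ((\<gamma> * cos (p$2) + cos (p$3)) / (\<gamma> * sqrt w))}"

definition piece_Y :: "real \<Rightarrow> real \<Rightarrow> (real^3) set" where
  "piece_Y w \<gamma> = {p. 0 \<le> p$1 \<and> p$1 \<le> alpha \<and> 0 \<le> p$3 \<and> p$3 \<le> alpha \<and>
     alpha \<le> p$2 \<and> p$2 \<le> alpha + sqrt w * arcsin ((\<gamma> * cos (p$1) + cos (p$3)) / (\<gamma> * sqrt w))}"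

definition piece_ZX :: "real \<Rightarrow> real \<Rightarrow> (real^3) set" where
  "piece_ZX w \<gamma> = {p.
     alpha \<le> p$1 \<and> p$1 \<le> alpha + sqrt w * arcsin (1 / sqrt w) \<and>
     alpha \<le> p$3 \<and> p$3 \<le> alpha + sqrt w * arcsin (\<gamma> / sqrt w) \<and>
     (let \<theta> = sqrt w * sin ((p$1 - alpha) / sqrt w) + sqrt w / \<gamma> * sin ((p$3 - alpha) / sqrt w)
      in 0 \<le> \<theta> \<and> \<theta> \<le> 1 \<and> 0 \<le> p$2 \<and> p$2 \<le> arccos \<theta>)}"

definition piece_XY :: "real \<Rightarrow> real \<Rightarrow> (real^3) set" where
  "piece_XY w \<gamma> = {p.
     alpha \<le> p$1 \<and> p$1 \<le> alpha + sqrt w * arcsin (1 / (\<gamma> * sqrt w)) \<and>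
     alpha \<le> p$2 \<and> p$2 \<le> alpha + sqrt w * arcsin (1 / (\<gamma> * sqrt w)) \<and>
     (let \<theta> = \<gamma> * sqrt w * sin ((p$1 - alpha) / sqrt w) + \<gamma> * sqrt w * sin ((p$2 - alpha) / sqrt w)
      in 0 \<le> \<theta> \<and> \<theta> \<le> 1 \<and> 0 \<le> p$3 \<and> p$3 \<le> arccos \<theta>)}"

definition piece_YZ :: "real \<Rightarrow> real \<Rightarrow> (real^3) set" where
  "piece_YZ w \<gamma> = {p.
     alpha \<le> p$2 \<and> p$2 \<le> alpha + sqrt w * arcsin (1 / sqrt w) \<and>
     alpha \<le> p$3 \<and> p$3 \<le> alpha + sqrt w * arcsin (\<gamma> / sqrt w) \<and>
     (let \<theta> = sqrt w * sin ((p$2 - alpha) / sqrt w) + sqrt w / \<gamma> * sin ((p$3 - alpha) / sqrt w)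
      in 0 \<le> \<theta> \<and> \<theta> \<le> 1 \<and> 0 \<le> p$1 \<and> p$1 \<le> arccos \<theta>)}"

definition octant_part :: "real \<Rightarrow> real \<Rightarrow> (real^3) set" where
  "octant_part w \<gamma> = piece_C \<union> piece_Z w \<gamma> \<union> piece_X w \<gamma> \<union> piece_Y w \<gamma> \<union>
     piece_ZX w \<gamma> \<union> piece_XY w \<gamma> \<union> piece_YZ w \<gamma>"

definition Omega :: "real \<Rightarrow> real \<Rightarrow> (real^3) set" where
  "Omega w \<gamma> = interior {vector [s1 * p$1, s2 * p$2, s3 * p$3] | s1 s2 s3 p.
     p \<in> octant_part w \<gamma> \<and> s1 \<in> {-1, 1} \<and> s2 \<in> {-1, 1} \<and> s3 \<in> {-1, 1}}"


section \<open>The functions\<close>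

definition f_C :: "real \<Rightarrow> real \<Rightarrow> real^3 \<Rightarrow> real" where
  "f_C w \<gamma> p = \<gamma> * cos (p$1) + \<gamma> * cos (p$2) + cos (p$3)"

definition f_Z :: "real \<Rightarrow> real \<Rightarrow> real^3 \<Rightarrow> real" where
  "f_Z w \<gamma> p = \<gamma> * cos (p$1) + \<gamma> * cos (p$2) - sqrt w * sin ((p$3 - alpha) / sqrt w)"

definition f_X :: "real \<Rightarrow> real \<Rightarrow> real^3 \<Rightarrow> real" where
  "f_X w \<gamma> p = - \<gamma> * sqrt w * sin ((p$1 - alpha) / sqrt w) + \<gamma> * cos (p$2) + cos (p$3)"

definition f_Y :: "real \<Rightarrow> real \<Rightarrow> real^3 \<Rightarrow> real" where
  "f_Y w \<gamma> p = \<gamma> * cos (p$1) - \<gamma> * sqrt w * sin ((p$2 - alpha) / sqrt w) + cos (p$3)"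

definition f_ZX :: "real \<Rightarrow> real \<Rightarrow> real^3 \<Rightarrow> real" where
  "f_ZX w \<gamma> p = - \<gamma> * sqrt w * sin ((p$1 - alpha) / sqrt w) + \<gamma> * cos (p$2)
     - sqrt w * sin ((p$3 - alpha) / sqrt w)"

definition f_XY :: "real \<Rightarrow> real \<Rightarrow> real^3 \<Rightarrow> real" where
  "f_XY w \<gamma> p = - \<gamma> * sqrt w * sin ((p$1 - alpha) / sqrt w)
     - \<gamma> * sqrt w * sin ((p$2 - alpha) / sqrt w) + cos (p$3)"

definition f_YZ :: "real \<Rightarrow> real \<Rightarrow> real^3 \<Rightarrow> real" where
  "f_YZ w \<gamma> p = \<gamma> * cos (p$1) - \<gamma> * sqrt w * sin ((p$2 - alpha) / sqrt w)
     - sqrt w * sin ((p$3 - alpha) / sqrt w)"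

text \<open>The pieces overlap only where their formulas agree, so the order of the case distinction is
  immaterial (lemma \<open>u_plus_on_pieces\<close> below). The value \<open>0\<close> off the pieces is never used.\<close>
definition u_plus :: "real \<Rightarrow> real \<Rightarrow> real^3 \<Rightarrow> real" where
  "u_plus w \<gamma> p =
     (if p \<in> piece_C then f_C w \<gamma> p
      else if p \<in> piece_Z w \<gamma> then f_Z w \<gamma> p
      else if p \<in> piece_X w \<gamma> then f_X w \<gamma> p
      else if p \<in> piece_Y w \<gamma> then f_Y w \<gamma> p
      else if p \<in> piece_ZX w \<gamma> then f_ZX w \<gamma> p
      else if p \<in> piece_XY w \<gamma> then f_XY w \<gamma> p
      else if p \<in> piece_YZ w \<gamma> then f_YZ w \<gamma> p
      else 0)"

definition u_fun :: "real \<Rightarrow> real \<Rightarrow> real^3 \<Rightarrow> real" where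
  "u_fun w \<gamma> p = u_plus w \<gamma> (vector [\<bar>p$1\<bar>, \<bar>p$2\<bar>, \<bar>p$3\<bar>])"


section \<open>The shear\<close>

definition shear :: "real \<Rightarrow> real^3^3" where
  "shear a = (let s = sqrt (1 - (a / pi)\<^sup>2) in
     vector [vector [s, 0, 0], vector [a / pi, 1, 0], vector [0, 0, s]])"

definition Omega_sheared :: "real \<Rightarrow> real \<Rightarrow> real \<Rightarrow> (real^3) set" where
  "Omega_sheared w \<gamma> a = (\<lambda>p. shear a *v p) ` Omega w \<gamma>"

definition u_sheared :: "real \<Rightarrow> real \<Rightarrow> real \<Rightarrow> real^3 \<Rightarrow> real" where
  "u_sheared w \<gamma> a p = u_fun w \<gamma> (matrix_inv (shear a) *v p)"


section \<open>Well-definedness of the piecewise function\<close>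

lemma u_plus_on_pieces:
  shows "p \<in> piece_C \<Longrightarrow> u_plus w \<gamma> p = f_C w \<gamma> p"
    and "p \<in> piece_Z w \<gamma> \<Longrightarrow> u_plus w \<gamma> p = f_Z w \<gamma> p"
    and "p \<in> piece_X w \<gamma> \<Longrightarrow> u_plus w \<gamma> p = f_X w \<gamma> p"
    and "p \<in> piece_Y w \<gamma> \<Longrightarrow> u_plus w \<gamma> p = f_Y w \<gamma> p"
    and "p \<in> piece_ZX w \<gamma> \<Longrightarrow> u_plus w \<gamma> p = f_ZX w \<gamma> p"
    and "p \<in> piece_XY w \<gamma> \<Longrightarrow> u_plus w \<gamma> p = f_XY w \<gamma> p"
    and "p \<in> piece_YZ w \<gamma> \<Longrightarrow> u_plus w \<gamma> p = f_YZ w \<gamma> p"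
proof -
  have arc: "y \<le> alpha" if "0 \<le> t" "t \<le> 1" "y \<le> arccos t" for t y :: real
    using arccos_le_pi2[of t] that by simp
  have C: "p$1 \<le> alpha \<and> p$2 \<le> alpha \<and> p$3 \<le> alpha" if "p \<in> piece_C"
    using that by (simp add: piece_C_def)
  have Z: "p$1 \<le> alpha \<and> p$2 \<le> alpha \<and> alpha \<le> p$3" if "p \<in> piece_Z w \<gamma>"
    using that by (simp add: piece_Z_def)
  have X: "alpha \<le> p$1 \<and> p$2 \<le> alpha \<and> p$3 \<le> alpha" if "p \<in> piece_X w \<gamma>"
    using that by (simp add: piece_X_def)
  have Y: "p$1 \<le> alpha \<and> alpha \<le> p$2 \<and> p$3 \<le> alpha" if "p \<in> piece_Y w \<gamma>"
    using that by (simp add: piece_Y_def)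
  have ZX: "alpha \<le> p$1 \<and> p$2 \<le> alpha \<and> alpha \<le> p$3" if "p \<in> piece_ZX w \<gamma>"
    using that arc unfolding piece_ZX_def Let_def by blast
  have XY: "alpha \<le> p$1 \<and> alpha \<le> p$2 \<and> p$3 \<le> alpha" if "p \<in> piece_XY w \<gamma>"
    using that arc unfolding piece_XY_def Let_def by blast
  have YZ: "p$1 \<le> alpha \<and> alpha \<le> p$2 \<and> alpha \<le> p$3" if "p \<in> piece_YZ w \<gamma>"
    using that arc unfolding piece_YZ_def Let_def by blast
  have E: "cos (p$i) = 0 \<and> sin ((p$i - alpha) / sqrt w) = 0" if "p$i \<le> alpha" "alpha \<le> p$i" for i
  proof -
    have "p$i = alpha" using that by (rule antisym)
    then show ?thesis by (simp only:) simp
  qed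
  note E' = E[of 1] E[of 2] E[of 3]
  note fs = f_C_def f_Z_def f_X_def f_Y_def f_ZX_def f_XY_def f_YZ_def
  show "p \<in> piece_C \<Longrightarrow> u_plus w \<gamma> p = f_C w \<gamma> p"
    by (simp add: u_plus_def)
  show "p \<in> piece_Z w \<gamma> \<Longrightarrow> u_plus w \<gamma> p = f_Z w \<gamma> p"
    using C Z E' by (simp add: u_plus_def fs)
  show "p \<in> piece_X w \<gamma> \<Longrightarrow> u_plus w \<gamma> p = f_X w \<gamma> p"
    using C Z X E' by (simp add: u_plus_def fs)
  show "p \<in> piece_Y w \<gamma> \<Longrightarrow> u_plus w \<gamma> p = f_Y w \<gamma> p"
    using C Z X Y E' by (simp add: u_plus_def fs)
  show "p \<in> piece_ZX w \<gamma> \<Longrightarrow> u_plus w \<gamma> p = f_ZX w \<gamma> p"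
    using C Z X Y ZX E' by (simp add: u_plus_def fs)
  show "p \<in> piece_XY w \<gamma> \<Longrightarrow> u_plus w \<gamma> p = f_XY w \<gamma> p"
    using C Z X Y ZX XY E' by (simp add: u_plus_def fs)
  show "p \<in> piece_YZ w \<gamma> \<Longrightarrow> u_plus w \<gamma> p = f_YZ w \<gamma> p"
    using C Z X Y ZX XY YZ E' by (simp add: u_plus_def fs)
qed

end

theory Submission
  imports Defs
begin

text \<open>In the coordinates of the unsheared domain, \<open>u\<close> is the restriction of a separable \<open>C\<^sup>2\<close> function
  \<open>U\<close> whose Hessian satisfies \<open>M\<^sup>+(D\<^sup>2U) = - lam * U\<close>, and the domain is \<open>{U > 0}\<close> inside a cube. The
  shear turns \<open>D\<^sup>2U\<close> into a sum of three rank-one matrices along vectors of squared norm \<open>1 / s\<^sup>2\<close>, where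
  \<open>s\<^sup>2 = 1 - (a / pi)\<^sup>2\<close>, so subadditivity of \<open>M\<^sup>+\<close> gives the supersolution property. For \<open>a = 0\<close> the
  domain is star-shaped, and a dilated copy of \<open>U\<close> touched from above by a multiple of a positive
  supersolution shows \<open>\<mu>\<^sub>1\<^sup>+ \<le> lam\<close>. For \<open>a \<noteq> 0\<close> two of the rank-one directions are not orthogonal, so
  subadditivity is strict where the corresponding second derivatives have opposite signs. A concave
  function of \<open>U\<close> and a bump function spread this local gain over the whole domain and give a
  positive supersolution for a larger \<open>\<mu>\<close>.\<close>

section \<open>The spectral theorem and the Pucci operator\<close>

text \<open>The constant \<open>lam\<close> is one-dimensional: on its concave arc the profile
  solves \<open>f'' = - f\<close>, which the operator weights by \<open>lam\<close>; on its convex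
  arc the frequency \<open>1 / sqrt w\<close> turns \<open>Lam * f''\<close> into
  \<open>- lam * f\<close> as well. For the diagonal matrix \<open>HU\<close> these equations add
  up. The obstacle to strictness is that the gain from the shear is local, while a larger
  \<open>\<mu>\<close> needs a gain of order \<open>U\<close> everywhere, even at the boundary where
  \<open>U\<close> vanishes. A concave function of \<open>U\<close> gains in proportion to the
  squared gradient, which is at least a multiple of \<open>U * (U 0 - U)\<close>: the right order at
  the boundary, but nothing at the origin. At the origin all second derivatives of \<open>U\<close>
  are negative, so the shear gives no excess there either. The bump therefore lives on a tube along
  the first axis that joins the origin to a region beyond \<open>alpha\<close>, and its critical
  points in the tube all lie in that region, where the excess pays for every loss.\<close>

lemma symmetric_matrix_inner:
  fixes A :: "real^'n^'n"
  assumes "transpose A = A"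
  shows "x \<bullet> (A *v y) = (A *v x) \<bullet> y"
  by (metis assms dot_lmul_matrix vector_transpose_matrix)

text \<open>A maximiser of the Rayleigh quotient makes \<open>\<lambda> * (z \<bullet> z) - z \<bullet> (A *v z)\<close> a positive
  semidefinite form vanishing at the maximiser, which therefore lies in its kernel.\<close>

lemma symmetric_matrix_eigenvector:
  fixes A :: "real^'n^'n"
  assumes sym: "transpose A = A" and S: "subspace S" and nz: "\<exists>x\<in>S. x \<noteq> 0"
    and inv: "\<And>x. x \<in> S \<Longrightarrow> A *v x \<in> S"
  obtains x e where "x \<in> S" "norm x = 1" "A *v x = e *\<^sub>R x"
proof -
  let ?q = "\<lambda>x. x \<bullet> (A *v x)"
  have cl: "closed S" using S by (rule closed_subspace)
  have comp: "compact (S \<inter> sphere 0 1)"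
    using cl by (simp add: closed_Int_compact)
  obtain x0 where "x0 \<in> S" "x0 \<noteq> 0" using nz by blast
  then have "x0 /\<^sub>R norm x0 \<in> S \<inter> sphere 0 1"
    using S by (simp add: subspace_scale)
  then have ne: "S \<inter> sphere 0 1 \<noteq> {}" by blast
  have "continuous_on (S \<inter> sphere 0 1) ?q"
    by (intro continuous_intros matrix_vector_mult_linear_continuous_on)
  from continuous_attains_sup[OF comp ne this]
  obtain x where x: "x \<in> S" "norm x = 1"
    and mx: "\<And>y. y \<in> S \<Longrightarrow> norm y = 1 \<Longrightarrow> ?q y \<le> ?q x"
    by auto
  define e where "e = ?q x"
  have le: "?q z \<le> e * (z \<bullet> z)" if "z \<in> S" for z
  proof (cases "z = 0")
    case True
    then show ?thesis by simp
  next
    case False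
    let ?z = "z /\<^sub>R norm z"
    have "?q ?z \<le> e"
      unfolding e_def using that False S by (intro mx) (auto simp: subspace_scale)
    moreover have "?q ?z = ?q z / (norm z)\<^sup>2"
      by (simp add: matrix_vector_mult_scaleR power2_eq_square divide_simps)
    ultimately have "?q z / (norm z)\<^sup>2 \<le> e" by simp
    then show ?thesis
      using False by (simp add: pos_divide_le_eq flip: power2_norm_eq_inner)
  qed
  define y where "y = e *\<^sub>R x - A *v x"
  have y: "y \<in> S" unfolding y_def
    using S x inv by (simp add: subspace_diff subspace_scale)
  have "y = 0"
  proof (rule ccontr)
    assume "y \<noteq> 0"
    define b where "b = e * (y \<bullet> y) - ?q y"
    have yy: "y \<bullet> y > 0" using \<open>y \<noteq> 0\<close> by simp
    have key: "0 \<le> 2 * t * (y \<bullet> y) + t\<^sup>2 * b" for t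
    proof -
      have "x + t *\<^sub>R y \<in> S" using S x y by (simp add: subspace_add subspace_scale)
      from le[OF this]
      have "0 \<le> e * ((x + t *\<^sub>R y) \<bullet> (x + t *\<^sub>R y)) - ?q (x + t *\<^sub>R y)" by simp
      also have "\<dots> = e * (x \<bullet> x) - ?q x + 2 * t * (e * (x \<bullet> y) - y \<bullet> (A *v x)) + t\<^sup>2 * b"
        using symmetric_matrix_inner[OF sym, of x y]
        by (simp add: b_def matrix_vector_right_distrib matrix_vector_mult_scaleR inner_simps
            inner_commute power2_eq_square algebra_simps)
      also have "e * (x \<bullet> x) - ?q x = 0"
        using x by (simp add: e_def flip: power2_norm_eq_inner)
      also have "e * (x \<bullet> y) - y \<bullet> (A *v x) = y \<bullet> y"
        by (subst (3) y_def) (simp add: inner_simps inner_commute)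
      finally show ?thesis by simp
    qed
    \<comment> \<open>A small negative \<open>t\<close> lets the linear term win: the divisor
      \<open>1 + \<bar>b\<bar>\<close> keeps \<open>\<bar>t * b\<bar>\<close> below
      \<open>y \<bullet> y\<close>.\<close>
    define t where "t = - (y \<bullet> y) / (1 + \<bar>b\<bar>)"
    have "t < 0" unfolding t_def by (rule divide_neg_pos) (use yy in auto)
    have "2 * t * (y \<bullet> y) + t\<^sup>2 * b = t * (2 * (y \<bullet> y) + t * b)"
      by (simp add: power2_eq_square algebra_simps)
    moreover have "t * b \<ge> - (y \<bullet> y)"
    proof -
      have "t * b \<ge> - \<bar>t * b\<bar>" by linarith
      moreover have "\<bar>t * b\<bar> = (y \<bullet> y) * (\<bar>b\<bar> / (1 + \<bar>b\<bar>))"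
        unfolding t_def by (simp add: abs_mult)
      moreover have "(y \<bullet> y) * (\<bar>b\<bar> / (1 + \<bar>b\<bar>)) \<le> (y \<bullet> y) * 1"
        by (intro mult_left_mono) (auto simp: divide_simps)
      ultimately show ?thesis by linarith
    qed
    moreover have "t * (2 * (y \<bullet> y) + t * b) < 0"
      by (rule mult_neg_pos) (use \<open>t < 0\<close> yy \<open>t * b \<ge> - (y \<bullet> y)\<close> in linarith)+
    ultimately have "2 * t * (y \<bullet> y) + t\<^sup>2 * b < 0" by (simp only:)
    with key[of t] show False by linarith
  qed
  then have "A *v x = e *\<^sub>R x" by (simp add: y_def)
  with x that show ?thesis by blast
qed

text \<open>A largest orthonormal set of eigenvectors spans the space: otherwise its orthogonal
  complement is a nonzero invariant subspace and contains one more unit eigenvector.\<close>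

theorem symmetric_matrix_eigenbasis:
  fixes A :: "real^'n^'n"
  assumes sym: "transpose A = A"
  obtains q :: "'n \<Rightarrow> real^'n" and e :: "'n \<Rightarrow> real"
  where "\<And>i j. q i \<bullet> q j = (if i = j then 1 else 0)" "\<And>i. A *v q i = e i *\<^sub>R q i"
proof -
  define OK where "OK B \<longleftrightarrow> pairwise orthogonal B \<and> (\<forall>x\<in>B. norm x = 1 \<and> (\<exists>e. A *v x = e *\<^sub>R x))"
    for B :: "(real^'n) set"
  have ind: "independent B" if "OK B" for B
    using that by (intro pairwise_orthogonal_independent) (auto simp: OK_def)
  have card: "finite B \<and> card B \<le> CARD('n)" if "OK B" for B
    using independent_bound[OF ind[OF that]] by simp
  obtain B where B: "OK B" and mx: "\<And>C. OK C \<Longrightarrow> card C \<le> card B"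
  proof -
    have "OK {}" by (simp add: OK_def)
    moreover have "\<forall>B. OK B \<longrightarrow> card B < Suc CARD('n)" using card by (simp add: less_Suc_eq_le)
    ultimately have "\<exists>B. OK B \<and> (\<forall>C. OK C \<longrightarrow> card C \<le> card B)" by (rule ex_has_greatest_nat)
    then show ?thesis using that by auto
  qed
  have "span B = UNIV"
  proof (rule ccontr)
    assume "span B \<noteq> UNIV"
    then obtain a where a: "a \<noteq> 0" "\<forall>x\<in>span B. a \<bullet> x = 0"
      using span_not_UNIV_orthogonal[of B] by auto
    let ?S = "{z. \<forall>x\<in>B. x \<bullet> z = 0}"
    have subS: "subspace ?S" by (auto simp: subspace_def inner_simps)
    have "a \<in> ?S" using a by (auto simp: inner_commute span_base)
    with a have aS: "\<exists>x\<in>?S. x \<noteq> 0" by blast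
    have invS: "A *v z \<in> ?S" if "z \<in> ?S" for z
    proof -
      have "x \<bullet> (A *v z) = 0" if "x \<in> B" for x
      proof -
        obtain c where c: "A *v x = c *\<^sub>R x" using B \<open>x \<in> B\<close> by (auto simp: OK_def)
        have "x \<bullet> (A *v z) = (A *v x) \<bullet> z" by (rule symmetric_matrix_inner[OF sym])
        also have "\<dots> = 0" using c \<open>z \<in> ?S\<close> \<open>x \<in> B\<close> by simp
        finally show ?thesis .
      qed
      then show ?thesis by simp
    qed
    obtain x e where x: "x \<in> ?S" "norm x = 1" "A *v x = e *\<^sub>R x"
      by (rule symmetric_matrix_eigenvector[OF sym subS aS invS])
    have nx: "x \<notin> B" using x by (auto simp: norm_eq_1)
    have "OK (insert x B)"
      using B x nx by (auto simp: OK_def pairwise_insert orthogonal_def inner_commute)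
    from mx[OF this] show False using card[OF B] nx by simp
  qed
  then have "card B = CARD('n)"
    using dim_span_eq_card_independent[OF ind[OF B]] by simp
  then obtain q where q: "bij_betw q (UNIV :: 'n set) B"
    using finite_same_card_bij[of "UNIV :: 'n set" B] card[OF B] by auto
  have qB: "q i \<in> B" for i using q by (auto simp: bij_betw_def)
  have "\<exists>e. \<forall>i. A *v q i = e i *\<^sub>R q i"
    using B qB by (intro choice) (auto simp: OK_def)
  then obtain e where e: "\<And>i. A *v q i = e i *\<^sub>R q i" by blast
  have "q i \<bullet> q j = (if i = j then 1 else 0)" for i j
  proof (cases "i = j")
    case True
    then show ?thesis using B qB[of j] by (auto simp: OK_def norm_eq_1)
  next
    case False
    then have "q i \<noteq> q j" using q by (auto simp: bij_betw_def inj_on_def)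
    then show ?thesis
      using B qB[of i] qB[of j] False by (auto simp: OK_def pairwise_def orthogonal_def)
  qed
  with e that show ?thesis by blast
qed

lemma orthonormal_family_matrix:
  fixes q :: "'n \<Rightarrow> real^'n"
  assumes "\<And>i j. q i \<bullet> q j = (if i = j then 1 else 0)"
  shows "orthogonal_matrix (\<chi> i j. q j $ i)"
proof -
  have "transpose (\<chi> i j. q j $ i) ** (\<chi> i j. q j $ i) = (mat 1 :: real^'n^'n)"
    using assms by (simp add: vec_eq_iff matrix_matrix_mult_def transpose_def mat_def inner_vec_def)
  then show ?thesis by (simp add: orthogonal_matrix)
qed

lemma orthonormal_family_parseval:
  fixes q :: "'n \<Rightarrow> real^'n"
  assumes "\<And>i j. q i \<bullet> q j = (if i = j then 1 else 0)"
  shows "(\<Sum>i\<in>UNIV. (q i \<bullet> z)\<^sup>2) = (norm z)\<^sup>2"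
proof -
  let ?Q = "\<chi> i j. q i $ j"
  have "?Q = transpose (\<chi> i j. q j $ i)" by (simp add: vec_eq_iff transpose_def)
  then have "orthogonal_matrix ?Q"
    using orthonormal_family_matrix[OF assms] by (simp add: orthogonal_matrix_transpose)
  then have "norm (?Q *v z) = norm z"
    by (simp add: orthogonal_transformation_matrix orthogonal_transformation_norm
        orthogonal_matrix_def orthogonal_transformation)
  moreover have "(norm (?Q *v z))\<^sup>2 = (\<Sum>i\<in>UNIV. (q i \<bullet> z)\<^sup>2)"
    unfolding power2_norm_eq_inner by (simp add: inner_vec_def matrix_vector_mult_def power2_eq_square)
  ultimately show ?thesis by simp
qed

text \<open>The matrix of eigenvectors intertwines the characteristic matrix with a diagonal one.
  The comparison is made over the polynomial ring, where the determinant is multiplicative and the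
  determinant of an orthogonal matrix can be cancelled.\<close>

lemma charpoly_eigenbasis:
  fixes A :: "real^'n^'n" and q :: "'n \<Rightarrow> real^'n"
  assumes q: "\<And>i j. q i \<bullet> q j = (if i = j then 1 else 0)" and e: "\<And>i. A *v q i = e i *\<^sub>R q i"
  shows "charpoly A = (\<Prod>i\<in>UNIV. [:- e i, 1:])"
proof -
  let ?Q = "(\<chi> i j. [:q j $ i:]) :: real poly^'n^'n"
  let ?D = "(\<chi> i j. if i = j then [:- e i, 1:] else 0) :: real poly^'n^'n"
  let ?X = "mat [:0, 1:] - map_matrix (\<lambda>c. [:c:]) A"
  have const: "(\<Sum>k\<in>I. [:f k:]) = [:\<Sum>k\<in>I. f k:]" for f :: "'n \<Rightarrow> real" and I
    by (induction I rule: infinite_finite_induct) auto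
  have Aq: "(\<Sum>k\<in>UNIV. A $ i $ k * q j $ k) = e j * q j $ i" for i j
    using arg_cong[OF e[of j], of "\<lambda>v. v $ i"] by (simp add: matrix_vector_mult_def)
  have "?X ** ?Q = ?Q ** ?D"
  proof -
    have "(\<Sum>k\<in>UNIV. (mat [:0, 1:] - map_matrix (\<lambda>c. [:c:]) A) $ i $ k * [:q j $ k:])
        = (\<Sum>k\<in>UNIV. (if i = k then [:0, q j $ k:] else 0)) - (\<Sum>k\<in>UNIV. [:A $ i $ k * q j $ k:])" for i j
      unfolding sum_subtractf[symmetric]
      by (intro sum.cong refl) (simp add: mat_def map_matrix_def algebra_simps)
    moreover have "(\<Sum>k\<in>UNIV. [:q k $ i:] * (if k = j then [:- e k, 1:] else 0)) = [:q j $ i:] * [:- e j, 1:]" for i j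
      by (simp add: if_distrib if_distribR cong: if_cong)
    ultimately show ?thesis
      by (simp add: vec_eq_iff matrix_matrix_mult_def const Aq)
  qed
  then have "det ?X * det ?Q = det ?Q * det ?D" unfolding det_mul[symmetric] by (rule arg_cong)
  moreover have "det ?Q \<noteq> 0"
  proof -
    have "transpose ?Q ** ?Q = mat 1"
      using q by (simp add: vec_eq_iff matrix_matrix_mult_def transpose_def mat_def const inner_vec_def one_pCons)
    then have "det (transpose ?Q ** ?Q) = 1" by (simp only: det_I)
    then have "det ?Q * det ?Q = 1" by (simp only: det_mul det_transpose)
    then show ?thesis by auto
  qed
  moreover have "det ?D = (\<Prod>i\<in>UNIV. [:- e i, 1:])"
    by (subst det_diagonal) auto
  ultimately show ?thesis by (simp add: charpoly_def)
qed

text \<open>The one-dimensional operator. For \<open>lam \<le> Lam\<close> it is the maximum of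
  \<open>p * d\<close> over \<open>lam \<le> p \<le> Lam\<close>, which is the source of all
  subadditivity below.\<close>

definition pucci_weight :: "real \<Rightarrow> real \<Rightarrow> real \<Rightarrow> real" where
  "pucci_weight lam Lam d = (if d > 0 then Lam * d else lam * d)"

lemma pucci_eigenbasis:
  fixes A :: "real^'n^'n" and q :: "'n \<Rightarrow> real^'n"
  assumes "\<And>i j. q i \<bullet> q j = (if i = j then 1 else 0)" and "\<And>i. A *v q i = e i *\<^sub>R q i"
  shows "pucci lam Lam A = (\<Sum>i\<in>UNIV. pucci_weight lam Lam (e i))"
proof -
  have "eigenvalues A = image_mset e (mset_set UNIV)"
    unfolding eigenvalues_def charpoly_eigenbasis[OF assms]
    by (subst proots_prod) (auto simp: sum_unfold_sum_mset)
  moreover have "Lam * (\<Sum>x\<in>#{#x \<in># M. x > 0#}. x) + lam * (\<Sum>x\<in>#{#x \<in># M. x < 0#}. x)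
      = (\<Sum>x\<in>#M. pucci_weight lam Lam x)" for M
    by (induction M) (auto simp: pucci_weight_def algebra_simps)
  ultimately show ?thesis
    by (simp add: pucci_def sum_unfold_sum_mset multiset.map_comp comp_def)
qed

section \<open>Upper bounds for the Pucci operator by weighted squares of linear forms\<close>

text \<open>A certificate for an upper bound on the Pucci operator. Unlike the operator itself, it can be
  added up term by term without knowing any eigenvalues.\<close>

definition pucci_form_le :: "real \<Rightarrow> real \<Rightarrow> (real^'n \<Rightarrow> real) \<Rightarrow> real \<Rightarrow> bool" where
  "pucci_form_le lam Lam Q b \<longleftrightarrow> (\<exists>xs :: (real \<times> (real^'n)) list.
     (\<forall>z. Q z \<le> (\<Sum>(c, v)\<leftarrow>xs. c * (v \<bullet> z)\<^sup>2)) \<and>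
     (\<Sum>(c, v)\<leftarrow>xs. pucci_weight lam Lam c * (norm v)\<^sup>2) \<le> b)"

text \<open>For each eigenvector \<open>q i\<close> the slope \<open>p\<close> that realises the
  weight of \<open>e i\<close> is applied to the whole sum of squares; term by term
  \<open>p * c\<close> is at most the weight of \<open>c\<close>. Summing over the eigenbasis,
  Parseval turns the squares into norms. The inequality between \<open>A\<close> and
  \<open>Q\<close> builds in monotonicity of the operator.\<close>

theorem pucci_le:
  fixes A :: "real^'n^'n"
  assumes lam: "0 < lam" "lam \<le> Lam" and sym: "transpose A = A"
    and Q: "pucci_form_le lam Lam Q b" "\<And>z. z \<bullet> (A *v z) \<le> Q z"
  shows "pucci lam Lam A \<le> b"
proof -
  obtain q :: "'n \<Rightarrow> real^'n" and e where q: "\<And>i j. q i \<bullet> q j = (if i = j then 1 else 0)"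
    and e: "\<And>i. A *v q i = e i *\<^sub>R q i"
    using symmetric_matrix_eigenbasis[OF sym] by blast
  obtain xs :: "(real \<times> (real^'n)) list"
    where xs: "\<And>z. Q z \<le> (\<Sum>(c, v)\<leftarrow>xs. c * (v \<bullet> z)\<^sup>2)"
      and b: "(\<Sum>(c, v)\<leftarrow>xs. pucci_weight lam Lam c * (norm v)\<^sup>2) \<le> b"
    using Q unfolding pucci_form_le_def by blast
  have pw: "pucci_weight lam Lam (e i) \<le> (\<Sum>(c, v)\<leftarrow>xs. pucci_weight lam Lam c * (v \<bullet> q i)\<^sup>2)" for i
  proof -
    define p where "p = (if e i > 0 then Lam else lam)"
    have p: "lam \<le> p" "p \<le> Lam" "0 \<le> p" using lam by (auto simp: p_def)
    have "e i = q i \<bullet> (A *v q i)" using e q by simp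
    also have "\<dots> \<le> (\<Sum>(c, v)\<leftarrow>xs. c * (v \<bullet> q i)\<^sup>2)" using Q(2) xs order_trans by blast
    finally have "p * e i \<le> p * (\<Sum>(c, v)\<leftarrow>xs. c * (v \<bullet> q i)\<^sup>2)" using p by (intro mult_left_mono)
    also have "\<dots> = (\<Sum>(c, v)\<leftarrow>xs. (p * c) * (v \<bullet> q i)\<^sup>2)"
      by (simp add: sum_list_const_mult[symmetric] case_prod_unfold mult.assoc)
    also have "\<dots> \<le> (\<Sum>(c, v)\<leftarrow>xs. pucci_weight lam Lam c * (v \<bullet> q i)\<^sup>2)"
    proof (rule sum_list_mono, clarify)
      fix c v
      have "p * c \<le> pucci_weight lam Lam c"
        using p by (auto simp: pucci_weight_def mult_right_mono mult_right_mono_neg)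
      then show "(p * c) * (v \<bullet> q i)\<^sup>2 \<le> pucci_weight lam Lam c * (v \<bullet> q i)\<^sup>2"
        by (rule mult_right_mono) simp
    qed
    finally show ?thesis
      by (cases "e i > 0") (simp_all add: p_def pucci_weight_def[of _ _ "e i"])
  qed
  have "pucci lam Lam A \<le> (\<Sum>i\<in>UNIV. \<Sum>(c, v)\<leftarrow>xs. pucci_weight lam Lam c * (v \<bullet> q i)\<^sup>2)"
    unfolding pucci_eigenbasis[OF q e] by (intro sum_mono pw)
  also have "\<dots> = (\<Sum>(c, v)\<leftarrow>xs. pucci_weight lam Lam c * (norm v)\<^sup>2)"
  proof (induction xs)
    case (Cons x xs)
    have "(\<Sum>i\<in>UNIV. pucci_weight lam Lam (fst x) * (snd x \<bullet> q i)\<^sup>2)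
        = pucci_weight lam Lam (fst x) * (norm (snd x))\<^sup>2"
      using orthonormal_family_parseval[OF q, of "snd x"]
      by (simp add: inner_commute[of "snd x"] flip: sum_distrib_left)
    with Cons show ?case by (simp add: sum.distrib case_prod_unfold)
  qed simp
  finally show ?thesis using b by simp
qed

lemma pucci_form_le_square: "pucci_form_le lam Lam (\<lambda>z. c * (v \<bullet> z)\<^sup>2) (pucci_weight lam Lam c * (norm v)\<^sup>2)"
  unfolding pucci_form_le_def by (intro exI[of _ "[(c, v)]"]) simp

lemma pucci_form_le_add:
  assumes "pucci_form_le lam Lam Q b" "pucci_form_le lam Lam Q' b'"
  shows "pucci_form_le lam Lam (\<lambda>z. Q z + Q' z) (b + b')"
proof -
  obtain xs ys where "\<forall>z. Q z \<le> (\<Sum>(c, v)\<leftarrow>xs. c * (v \<bullet> z)\<^sup>2)"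
    "(\<Sum>(c, v)\<leftarrow>xs. pucci_weight lam Lam c * (norm v)\<^sup>2) \<le> b"
    "\<forall>z. Q' z \<le> (\<Sum>(c, v)\<leftarrow>ys. c * (v \<bullet> z)\<^sup>2)"
    "(\<Sum>(c, v)\<leftarrow>ys. pucci_weight lam Lam c * (norm v)\<^sup>2) \<le> b'"
    using assms unfolding pucci_form_le_def by blast
  then show ?thesis
    unfolding pucci_form_le_def by (intro exI[of _ "xs @ ys"]) (auto intro!: add_mono)
qed

lemma pucci_form_le_mono:
  assumes "pucci_form_le lam Lam Q b" "\<And>z. Q' z \<le> Q z" "b \<le> b'"
  shows "pucci_form_le lam Lam Q' b'"
  using assms unfolding pucci_form_le_def by (meson order_trans)

lemma pucci_weight_mult: "0 \<le> t \<Longrightarrow> pucci_weight lam Lam (t * c) = t * pucci_weight lam Lam c"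
  by (auto simp: pucci_weight_def zero_less_mult_iff)

lemma pucci_form_le_scale:
  assumes "pucci_form_le lam Lam Q b" "0 \<le> t"
  shows "pucci_form_le lam Lam (\<lambda>z. t * Q z) (t * b)"
proof -
  obtain xs where xs: "\<And>z. Q z \<le> (\<Sum>(c, v)\<leftarrow>xs. c * (v \<bullet> z)\<^sup>2)"
    "(\<Sum>(c, v)\<leftarrow>xs. pucci_weight lam Lam c * (norm v)\<^sup>2) \<le> b"
    using assms unfolding pucci_form_le_def by blast
  have "t * Q z \<le> (\<Sum>(c, v)\<leftarrow>map (\<lambda>(c, v). (t * c, v)) xs. c * (v \<bullet> z)\<^sup>2)" for z
    using mult_left_mono[OF xs(1)[of z] assms(2)]
    by (simp add: sum_list_const_mult[symmetric] case_prod_unfold mult.assoc comp_def)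
  moreover have "(\<Sum>(c, v)\<leftarrow>map (\<lambda>(c, v). (t * c, v)) xs. pucci_weight lam Lam c * (norm v)\<^sup>2) \<le> t * b"
    using mult_left_mono[OF xs(2) assms(2)] assms(2)
    by (simp add: sum_list_const_mult[symmetric] case_prod_unfold mult.assoc comp_def pucci_weight_mult)
  ultimately show ?thesis unfolding pucci_form_le_def by blast
qed

section \<open>Classical supersolutions are viscosity supersolutions\<close>

lemma has_derivative_line:
  assumes "(f has_derivative f') (at (y + s *\<^sub>R h))"
  shows "((\<lambda>s. f (y + s *\<^sub>R h)) has_derivative (\<lambda>t. f' (t *\<^sub>R h))) (at s)"
  by (rule has_derivative_compose[of "\<lambda>s. y + s *\<^sub>R h", OF _ assms])
    (auto intro!: derivative_eq_intros)

lemma C2_on_line: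
  assumes "C2_on U \<phi> g H" "y + s *\<^sub>R h \<in> U"
  shows "((\<lambda>s. \<phi> (y + s *\<^sub>R h)) has_real_derivative g (y + s *\<^sub>R h) \<bullet> h) (at s)"
    and "((\<lambda>s. g (y + s *\<^sub>R h) \<bullet> k) has_real_derivative k \<bullet> (H (y + s *\<^sub>R h) *v h)) (at s)"
proof -
  have d: "(\<phi> has_derivative (\<lambda>v. g (y + s *\<^sub>R h) \<bullet> v)) (at (y + s *\<^sub>R h))"
    "(g has_derivative (\<lambda>v. H (y + s *\<^sub>R h) *v v)) (at (y + s *\<^sub>R h))"
    using assms unfolding C2_on_def by blast+
  show "((\<lambda>s. \<phi> (y + s *\<^sub>R h)) has_real_derivative g (y + s *\<^sub>R h) \<bullet> h) (at s)"
    using has_derivative_line[OF d(1)]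
    by (simp add: has_field_derivative_def mult.commute[of _ "_ \<bullet> _"])
  have "((\<lambda>s. g (y + s *\<^sub>R h) \<bullet> k) has_derivative (\<lambda>t. (H (y + s *\<^sub>R h) *v (t *\<^sub>R h)) \<bullet> k)) (at s)"
    by (intro has_derivative_inner_left has_derivative_line d)
  then show "((\<lambda>s. g (y + s *\<^sub>R h) \<bullet> k) has_real_derivative k \<bullet> (H (y + s *\<^sub>R h) *v h)) (at s)"
    by (simp add: has_field_derivative_def matrix_vector_mult_scaleR mult.commute[of _ "_ \<bullet> _"]
        inner_commute)
qed

text \<open>One use of the mean value theorem in direction \<open>h\<close>, then differentiability
  of \<open>g\<close> at the single point \<open>x\<close>. The quotient is symmetric in
  \<open>h\<close> and \<open>k\<close>, so this limit forces the Hessian to be symmetric, which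
  \<open>pucci_le\<close> requires of test functions.\<close>

lemma C2_on_second_difference:
  assumes C2: "C2_on U \<phi> g H" and x: "x \<in> U"
  shows "((\<lambda>t. (\<phi> (x + t *\<^sub>R h + t *\<^sub>R k) - \<phi> (x + t *\<^sub>R h) - \<phi> (x + t *\<^sub>R k) + \<phi> x) / t\<^sup>2)
    \<longlongrightarrow> h \<bullet> (H x *v k)) (at_right 0)"
proof (rule tendstoI)
  let ?F = "\<lambda>t. \<phi> (x + t *\<^sub>R h + t *\<^sub>R k) - \<phi> (x + t *\<^sub>R h) - \<phi> (x + t *\<^sub>R k) + \<phi> x"
  fix e :: real assume e: "e > 0"
  define n where "n = norm h + norm k + 1"
  have n: "norm h \<le> n" "norm k \<le> n" "norm h + norm k \<le> n" "n > 0"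
    unfolding n_def using norm_ge_zero[of h] norm_ge_zero[of k] by linarith+
  \<comment> \<open>The two remainders together contribute \<open>2 * d * n * n\<close>, which is
    \<open>e / 2\<close>.\<close>
  define d where "d = e / (4 * n * n)"
  have d: "d > 0" using e n by (simp add: d_def)
  obtain r where r: "r > 0" "ball x r \<subseteq> U"
    using C2 x unfolding C2_on_def open_contains_ball by blast
  have "(g has_derivative (\<lambda>h. H x *v h)) (at x)" using C2 x unfolding C2_on_def by blast
  then obtain q where q: "q > 0"
    and gd: "\<And>v. norm v < q \<Longrightarrow> norm (g (x + v) - g x - H x *v v) \<le> d * norm v"
    using d unfolding has_derivative_at_alt by (metis add_diff_cancel_left')
  have main: "dist (?F t / t\<^sup>2) (h \<bullet> (H x *v k)) < e" if t: "0 < t" "t < min r q / n" for t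
  proof -
    have tn: "t * n < r" "t * n < q" using t n by (simp_all add: pos_less_divide_eq)
    have small: "norm (s *\<^sub>R h + s' *\<^sub>R k) \<le> t * n" if "0 \<le> s" "s \<le> t" "0 \<le> s'" "s' \<le> t" for s s'
    proof -
      have "norm (s *\<^sub>R h + s' *\<^sub>R k) \<le> s * norm h + s' * norm k"
        using norm_triangle_ineq[of "s *\<^sub>R h" "s' *\<^sub>R k"] that by simp
      also have "\<dots> \<le> t * norm h + t * norm k" using that by (intro add_mono mult_right_mono) auto
      also have "\<dots> \<le> t * n" using n t by (simp flip: distrib_left)
      finally show ?thesis .
    qed
    have inU: "x + (s *\<^sub>R h + s' *\<^sub>R k) \<in> U" if "0 \<le> s" "s \<le> t" "0 \<le> s'" "s' \<le> t" for s s'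
      by (rule subsetD[OF r(2)]) (use small[OF that] tn in \<open>simp add: dist_norm norm_minus_commute add.commute\<close>)
    let ?p = "\<lambda>s. \<phi> ((x + t *\<^sub>R k) + s *\<^sub>R h) - \<phi> (x + s *\<^sub>R h)"
    let ?p' = "\<lambda>s. g ((x + t *\<^sub>R k) + s *\<^sub>R h) \<bullet> h - g (x + s *\<^sub>R h) \<bullet> h"
    have "\<exists>s>0. s < t \<and> ?p t - ?p 0 = (t - 0) * ?p' s"
    proof (intro MVT2 DERIV_diff C2_on_line(1)[OF C2] t)
      fix s assume "0 \<le> s" "s \<le> t"
      then show "x + t *\<^sub>R k + s *\<^sub>R h \<in> U" "x + s *\<^sub>R h \<in> U"
        using inU[of s t] inU[of s 0] t by (auto simp: algebra_simps)
    qed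
    then obtain s where s: "0 < s" "s < t" and "?p t - ?p 0 = t * ?p' s" by auto
    then have Fs: "?F t = t * ((g (x + (s *\<^sub>R h + t *\<^sub>R k)) - g (x + s *\<^sub>R h)) \<bullet> h)"
      by (simp add: algebra_simps inner_simps)
    let ?R = "\<lambda>v. g (x + v) - g x - H x *v v"
    have "norm (?R (s *\<^sub>R h + t *\<^sub>R k)) \<le> d * (t * n)" "norm (?R (s *\<^sub>R h)) \<le> d * (t * n)"
      using small[of s t] small[of s 0] gd[of "s *\<^sub>R h + t *\<^sub>R k"] gd[of "s *\<^sub>R h"] tn s t d
      by (auto intro: order_trans mult_left_mono)
    then have nR: "norm (?R (s *\<^sub>R h + t *\<^sub>R k) - ?R (s *\<^sub>R h)) \<le> 2 * d * (t * n)"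
      using norm_triangle_ineq4[of "?R (s *\<^sub>R h + t *\<^sub>R k)" "?R (s *\<^sub>R h)"] by linarith
    have "g (x + (s *\<^sub>R h + t *\<^sub>R k)) - g (x + s *\<^sub>R h)
        = t *\<^sub>R (H x *v k) + (?R (s *\<^sub>R h + t *\<^sub>R k) - ?R (s *\<^sub>R h))"
      by (simp add: matrix_vector_right_distrib matrix_vector_mult_scaleR algebra_simps)
    then have "?F t / t\<^sup>2 - h \<bullet> (H x *v k) = (?R (s *\<^sub>R h + t *\<^sub>R k) - ?R (s *\<^sub>R h)) \<bullet> h / t"
      unfolding Fs using t by (simp add: inner_simps inner_commute power2_eq_square field_simps)
    also have "\<bar>\<dots>\<bar> \<le> (2 * d * (t * n) * n) / t"
    proof -
      have "\<bar>(?R (s *\<^sub>R h + t *\<^sub>R k) - ?R (s *\<^sub>R h)) \<bullet> h\<bar> \<le> 2 * d * (t * n) * n"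
        by (rule order_trans[OF Cauchy_Schwarz_ineq2 mult_mono[OF nR n(1)]]) (use t d n in auto)
      from divide_right_mono[OF this, of t] show ?thesis
        using t by (simp only: abs_divide abs_of_pos less_imp_le)
    qed
    also have "\<dots> = 2 * d * n * n" using t by simp
    also have "\<dots> < e" using n e by (simp add: d_def field_simps)
    finally show ?thesis by (simp add: dist_real_def)
  qed
  show "\<forall>\<^sub>F t in at_right 0. dist (?F t / t\<^sup>2) (h \<bullet> (H x *v k)) < e"
    unfolding eventually_at_right_field using main r q n
    by (intro exI[of _ "min r q / n"]) (auto simp: divide_simps)
qed

theorem C2_on_hessian_symmetric:
  assumes "C2_on U \<phi> g H" "x \<in> U"
  shows "transpose (H x) = H x"
proof -
  have "h \<bullet> (H x *v k) = k \<bullet> (H x *v h)" for h k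
  proof (rule tendsto_unique[OF _ C2_on_second_difference[OF assms, of h k]])
    show "((\<lambda>t. (\<phi> (x + t *\<^sub>R h + t *\<^sub>R k) - \<phi> (x + t *\<^sub>R h) - \<phi> (x + t *\<^sub>R k) + \<phi> x) / t\<^sup>2)
        \<longlongrightarrow> k \<bullet> (H x *v h)) (at_right 0)"
      using C2_on_second_difference[OF assms, of k h] by (simp add: algebra_simps)
  qed simp
  from this[of "axis i 1" "axis j 1" for i j] show ?thesis
    by (simp add: vec_eq_iff transpose_def inner_axis' matrix_vector_mult_basis column_def)
qed

lemma local_min_second_derivative:
  fixes f f' :: "real \<Rightarrow> real"
  assumes d: "d > 0" and f: "\<And>s. \<bar>s\<bar> < d \<Longrightarrow> DERIV f s :> f' s"
    and f': "DERIV f' 0 :> l" and mn: "\<And>s. \<bar>s\<bar> < d \<Longrightarrow> f 0 \<le> f s"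
  shows "0 \<le> l"
proof (rule ccontr)
  assume "\<not> 0 \<le> l"
  then have l: "l < 0" by simp
  have "f' 0 = 0" using DERIV_local_min[OF f[of 0] d] d mn by simp
  with DERIV_neg_dec_right[OF f' l]
  obtain r where r: "r > 0" "\<And>h. 0 < h \<Longrightarrow> h < r \<Longrightarrow> f' h < 0" by auto
  define t where "t = min d r / 2"
  have t: "0 < t" "t < d" "t < r" using d r by (auto simp: t_def)
  have "\<exists>z>0. z < t \<and> f t - f 0 = (t - 0) * f' z"
    using t by (intro MVT2 f) auto
  then obtain z where "0 < z" "z < t" "f t - f 0 = t * f' z" by auto
  then have "f t < f 0" using r(2)[of z] t by (smt (verit) mult_pos_neg)
  then show False using mn[of t] t by simp
qed

lemma C2_on_touching:
  assumes \<phi>: "C2_on U \<phi> g H" and \<psi>: "C2_on U \<psi> g' H'" and x: "x \<in> U"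
    and mn: "\<And>y. y \<in> U \<Longrightarrow> \<psi> x - \<phi> x \<le> \<psi> y - \<phi> y"
  shows "z \<bullet> (H x *v z) \<le> z \<bullet> (H' x *v z)"
proof -
  have "open ((\<lambda>s. x + s *\<^sub>R z) -` U)"
    using \<phi> by (intro open_vimage) (auto simp: C2_on_def intro!: continuous_intros)
  moreover have "(0::real) \<in> (\<lambda>s. x + s *\<^sub>R z) -` U" using x by simp
  ultimately obtain d where d: "d > 0" "\<And>s. \<bar>s\<bar> < d \<Longrightarrow> x + s *\<^sub>R z \<in> U"
  proof -
    assume "open ((\<lambda>s. x + s *\<^sub>R z) -` U)" "(0::real) \<in> (\<lambda>s. x + s *\<^sub>R z) -` U"
    then obtain d where "d > 0" "ball 0 d \<subseteq> (\<lambda>s. x + s *\<^sub>R z) -` U"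
      by (rule openE)
    then show ?thesis by (intro that[of d]) (auto simp: subset_iff)
  qed
  have "0 \<le> z \<bullet> (H' (x + 0 *\<^sub>R z) *v z) - z \<bullet> (H (x + 0 *\<^sub>R z) *v z)"
  proof (rule local_min_second_derivative[OF d(1)])
    show "((\<lambda>s. g' (x + s *\<^sub>R z) \<bullet> z - g (x + s *\<^sub>R z) \<bullet> z) has_real_derivative
        z \<bullet> (H' (x + 0 *\<^sub>R z) *v z) - z \<bullet> (H (x + 0 *\<^sub>R z) *v z)) (at 0)"
      using x by (intro DERIV_diff C2_on_line(2)[OF \<phi>] C2_on_line(2)[OF \<psi>]) auto
    fix s :: real assume s: "\<bar>s\<bar> < d"
    show "((\<lambda>s. \<psi> (x + s *\<^sub>R z) - \<phi> (x + s *\<^sub>R z)) has_real_derivative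
        g' (x + s *\<^sub>R z) \<bullet> z - g (x + s *\<^sub>R z) \<bullet> z) (at s)"
      using d(2)[OF s] by (intro DERIV_diff C2_on_line(1)[OF \<phi>] C2_on_line(1)[OF \<psi>])
    show "\<psi> (x + 0 *\<^sub>R z) - \<phi> (x + 0 *\<^sub>R z) \<le> \<psi> (x + s *\<^sub>R z) - \<phi> (x + s *\<^sub>R z)"
      using mn[OF d(2)[OF s]] by simp
  qed
  then show ?thesis by simp
qed

lemma C2_on_subset: "C2_on U \<phi> g H \<Longrightarrow> open V \<Longrightarrow> V \<subseteq> U \<Longrightarrow> C2_on V \<phi> g H"
  unfolding C2_on_def by (blast intro: continuous_on_subset)

lemma C2_on_imp_continuous_on: "C2_on U \<phi> g H \<Longrightarrow> continuous_on U \<phi> \<and> continuous_on U g"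
  unfolding C2_on_def continuous_on_eq_continuous_at[OF conjunct1]
  by (metis continuous_at_imp_continuous_on has_derivative_continuous)

text \<open>At a touching point the Hessian of the test function lies below \<open>H x\<close> as a
  quadratic form, so a certificate for \<open>H x\<close> also bounds the operator at the test
  Hessian.\<close>

theorem classical_imp_viscosity_supersolution:
  assumes lam: "0 < lam" "lam \<le> Lam" and \<psi>: "C2_on \<Omega> \<psi> g H"
    and u: "\<And>x. x \<in> \<Omega> \<Longrightarrow> u x = \<psi> x"
    and le: "\<And>x. x \<in> \<Omega> \<Longrightarrow> pucci_form_le lam Lam (\<lambda>z. z \<bullet> (H x *v z)) (- \<mu> * \<psi> x)"
  shows "viscosity_supersolution (\<lambda>r X. - (pucci lam Lam X + \<mu> * r)) \<Omega> u"
  unfolding viscosity_supersolution_def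
proof (intro conjI allI impI)
  show "continuous_on \<Omega> u"
    using C2_on_imp_continuous_on[OF \<psi>] u continuous_on_cong by metis
  fix x U \<phi> g' H'
  assume asm: "x \<in> U \<and> U \<subseteq> \<Omega> \<and> C2_on U \<phi> g' H' \<and> (\<forall>y\<in>U. u x - \<phi> x \<le> u y - \<phi> y)"
  then have "open U" "x \<in> \<Omega>" by (auto simp: C2_on_def)
  then have \<psi>U: "C2_on U \<psi> g H" using C2_on_subset[OF \<psi>] asm by blast
  have "pucci lam Lam (H' x) \<le> - \<mu> * \<psi> x"
  proof (rule pucci_le[OF lam _ le[OF \<open>x \<in> \<Omega>\<close>]])
    show "transpose (H' x) = H' x" using C2_on_hessian_symmetric asm by blast
    show "z \<bullet> (H' x *v z) \<le> z \<bullet> (H x *v z)" for z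
    proof (rule C2_on_touching[OF _ \<psi>U])
      show "\<psi> x - \<phi> x \<le> \<psi> y - \<phi> y" if "y \<in> U" for y
        using asm u that by (metis subsetD)
    qed (use asm in auto)
  qed
  then show "- (pucci lam Lam (H' x) + \<mu> * u x) \<ge> 0"
    using u[OF \<open>x \<in> \<Omega>\<close>] by simp
qed

section \<open>Calculus of \<open>C\<^sup>2\<close> functions: sums, compositions, separable
  functions, linear substitutions\<close>

lemma C2_on_add:
  assumes "C2_on U \<phi> g H" "C2_on U \<psi> g' H'"
  shows "C2_on U (\<lambda>x. \<phi> x + \<psi> x) (\<lambda>x. g x + g' x) (\<lambda>x. H x + H' x)"
  using assms unfolding C2_on_def
  by (auto simp: inner_simps matrix_vector_mult_add_rdistrib intro!: derivative_eq_intros continuous_intros)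

lemma C2_on_cmult:
  assumes "C2_on U \<phi> g H"
  shows "C2_on U (\<lambda>x. c * \<phi> x) (\<lambda>x. c *\<^sub>R g x) (\<lambda>x. c *\<^sub>R H x)"
  using assms unfolding C2_on_def
  by (auto simp: inner_simps scaleR_matrix_vector_assoc intro!: derivative_eq_intros continuous_intros)

lemma C2_on_compose_real:
  assumes \<phi>: "C2_on U \<phi> g H" and F: "\<And>t. DERIV F t :> F' t" "\<And>t. DERIV F' t :> F'' t"
    and F'': "continuous_on UNIV F''"
  shows "C2_on U (\<lambda>x. F (\<phi> x)) (\<lambda>x. F' (\<phi> x) *\<^sub>R g x)
    (\<lambda>x. \<chi> i j. F'' (\<phi> x) * (g x $ i * g x $ j) + F' (\<phi> x) * H x $ i $ j)"
proof -
  have cF': "continuous_on UNIV F'"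
    using F(2) by (meson DERIV_continuous continuous_at_imp_continuous_on)
  have c\<phi>: "continuous_on U \<phi>" "continuous_on U g" "continuous_on U H"
    using C2_on_imp_continuous_on[OF \<phi>] \<phi> by (auto simp: C2_on_def)
  have d: "((\<lambda>x. F (\<phi> x)) has_derivative (\<lambda>h. (F' (\<phi> x) *\<^sub>R g x) \<bullet> h)) (at x) \<and>
     ((\<lambda>x. F' (\<phi> x) *\<^sub>R g x) has_derivative
       (\<lambda>h. (\<chi> i j. F'' (\<phi> x) * (g x $ i * g x $ j) + F' (\<phi> x) * H x $ i $ j) *v h)) (at x)"
    if "x \<in> U" for x
  proof
    have \<phi>': "(\<phi> has_derivative (\<lambda>h. g x \<bullet> h)) (at x)" "(g has_derivative (\<lambda>h. H x *v h)) (at x)"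
      using \<phi> that by (auto simp: C2_on_def)
    show "((\<lambda>x. F (\<phi> x)) has_derivative (\<lambda>h. (F' (\<phi> x) *\<^sub>R g x) \<bullet> h)) (at x)"
      using has_derivative_compose[OF \<phi>'(1) F(1)[unfolded has_field_derivative_def]] by simp
    have "((\<lambda>x. F' (\<phi> x) *\<^sub>R g x) has_derivative
        (\<lambda>h. F' (\<phi> x) *\<^sub>R (H x *v h) + (F'' (\<phi> x) * (g x \<bullet> h)) *\<^sub>R g x)) (at x)"
      by (intro has_derivative_scaleR \<phi>' has_derivative_compose[OF \<phi>'(1) F(2)[unfolded has_field_derivative_def]])
    moreover have "F' (\<phi> x) *\<^sub>R (H x *v h) + (F'' (\<phi> x) * (g x \<bullet> h)) *\<^sub>R g x
        = (\<chi> i j. F'' (\<phi> x) * (g x $ i * g x $ j) + F' (\<phi> x) * H x $ i $ j) *v h" for h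
      by (simp add: vec_eq_iff matrix_vector_mult_def inner_vec_def sum.distrib sum_distrib_left
          sum_distrib_right algebra_simps)
    ultimately show "((\<lambda>x. F' (\<phi> x) *\<^sub>R g x) has_derivative
       (\<lambda>h. (\<chi> i j. F'' (\<phi> x) * (g x $ i * g x $ j) + F' (\<phi> x) * H x $ i $ j) *v h)) (at x)"
      by simp
  qed
  have "continuous_on U (\<lambda>x. \<chi> i j. F'' (\<phi> x) * (g x $ i * g x $ j) + F' (\<phi> x) * H x $ i $ j)"
    by (intro continuous_on_vec_lambda continuous_intros c\<phi>
        continuous_on_compose2[OF F'' c\<phi>(1)] continuous_on_compose2[OF cF' c\<phi>(1)]) auto
  with d \<phi> show ?thesis by (simp add: C2_on_def)
qed

lemma quadratic_form_compose_real:
  fixes v z :: "real^'n"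
  shows "z \<bullet> ((\<chi> i j. a * (v $ i * v $ j) + b * M $ i $ j) *v z) = a * (v \<bullet> z)\<^sup>2 + b * (z \<bullet> (M *v z))"
proof -
  have "(\<chi> i j. a * (v $ i * v $ j) + b * M $ i $ j) *v z = (a * (v \<bullet> z)) *\<^sub>R v + b *\<^sub>R (M *v z)"
    by (simp add: vec_eq_iff matrix_vector_mult_def inner_vec_def sum.distrib sum_distrib_left
          sum_distrib_right algebra_simps)
  then show ?thesis by (simp add: inner_simps power2_eq_square inner_commute)
qed

lemma C2_on_separable:
  fixes f :: "'n::finite \<Rightarrow> real \<Rightarrow> real"
  assumes f: "\<And>i t. DERIV (f i) t :> f' i t" "\<And>i t. DERIV (f' i) t :> f'' i t"
    and f'': "\<And>i. continuous_on UNIV (f'' i)"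
  shows "C2_on UNIV (\<lambda>x. \<Sum>i\<in>UNIV. f i (x $ i)) (\<lambda>x. \<chi> i. f' i (x $ i))
    (\<lambda>x. \<chi> i j. if i = j then f'' i (x $ i) else 0)"
  unfolding C2_on_def
proof (intro conjI ballI)
  fix x :: "real^'n"
  have pr: "((\<lambda>x. x $ i) has_derivative (\<lambda>h. h $ i)) (at x)" for i
    by (rule bounded_linear_imp_has_derivative) (rule bounded_linear_vec_nth)
  have "((\<lambda>x. \<Sum>i\<in>UNIV. f i (x $ i)) has_derivative (\<lambda>h. \<Sum>i\<in>UNIV. f' i (x $ i) * h $ i)) (at x)"
    by (intro has_derivative_sum has_derivative_compose[OF pr f(1)[unfolded has_field_derivative_def]])
  then show "((\<lambda>x. \<Sum>i\<in>UNIV. f i (x $ i)) has_derivative (\<lambda>h. (\<chi> i. f' i (x $ i)) \<bullet> h)) (at x)"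
    by (simp add: inner_vec_def)
  have "((\<lambda>x. \<chi> i. f' i (x $ i)) has_derivative (\<lambda>h. \<chi> i. f'' i (x $ i) * h $ i)) (at x)"
    unfolding has_derivative_componentwise_within[of "\<lambda>x. \<chi> i. f' i (x $ i)"]
    by (auto simp: Basis_vec_def inner_axis
        intro!: has_derivative_compose[OF pr f(2)[unfolded has_field_derivative_def]])
  then show "((\<lambda>x. \<chi> i. f' i (x $ i)) has_derivative
      (\<lambda>h. (\<chi> i j. if i = j then f'' i (x $ i) else 0) *v h)) (at x)"
    by (simp add: matrix_vector_mult_def if_distrib if_distribR cong: if_cong)
  show "continuous_on UNIV (\<lambda>x. \<chi> i j. if i = j then f'' i (x $ i) else 0)"
  proof (intro continuous_on_vec_lambda)
    show "continuous_on UNIV (\<lambda>x. if i = j then f'' i (x $ i) else 0)" for i j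
      by (cases "i = j") (auto intro!: continuous_on_compose2[OF f''] continuous_intros)
  qed
qed simp

lemma quadratic_form_diagonal:
  fixes z :: "real^'n"
  shows "z \<bullet> ((\<chi> i j. if i = j then d i else 0) *v z) = (\<Sum>i\<in>UNIV. d i * (z $ i)\<^sup>2)"
  by (simp add: inner_vec_def matrix_vector_mult_def if_distrib if_distribR power2_eq_square algebra_simps
      cong: if_cong)

lemma C2_on_linear:
  fixes A :: "real^'n^'m"
  assumes \<phi>: "C2_on U \<phi> g H"
  shows "C2_on ((\<lambda>x. A *v x) -` U) (\<lambda>x. \<phi> (A *v x)) (\<lambda>x. transpose A *v g (A *v x))
    (\<lambda>x. transpose A ** H (A *v x) ** A)"
  unfolding C2_on_def
proof (intro conjI ballI)
  let ?V = "(\<lambda>x. A *v x) -` U"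
  have lin: "((\<lambda>x. A *v x) has_derivative (\<lambda>h. A *v h)) (at x)" for x
    by (rule bounded_linear_imp_has_derivative) (rule matrix_vector_mul_bounded_linear)
  have cA: "continuous_on S (\<lambda>x. A *v x)" for S
    by (rule matrix_vector_mult_linear_continuous_on)
  show "open ?V" using \<phi> cA[of UNIV] by (intro open_vimage) (auto simp: C2_on_def)
  have "continuous_on ?V (\<lambda>x. H (A *v x))"
    using \<phi> by (intro continuous_on_compose2[OF _ cA]) (auto simp: C2_on_def)
  then show "continuous_on ?V (\<lambda>x. transpose A ** H (A *v x) ** A)"
    unfolding matrix_matrix_mult_def
    by (auto intro!: continuous_on_vec_lambda continuous_intros)
  fix x assume "x \<in> ?V"
  then have d: "(\<phi> has_derivative (\<lambda>h. g (A *v x) \<bullet> h)) (at (A *v x))"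
    "(g has_derivative (\<lambda>h. H (A *v x) *v h)) (at (A *v x))" using \<phi> by (auto simp: C2_on_def)
  show "((\<lambda>x. \<phi> (A *v x)) has_derivative (\<lambda>h. (transpose A *v g (A *v x)) \<bullet> h)) (at x)"
    using has_derivative_compose[OF lin d(1)]
    by (simp add: dot_lmul_matrix)
  have "((\<lambda>x. transpose A *v g (A *v x)) has_derivative (\<lambda>h. transpose A *v (H (A *v x) *v (A *v h)))) (at x)"
    by (intro bounded_linear.has_derivative[OF matrix_vector_mul_bounded_linear]
        has_derivative_compose[OF lin d(2)])
  then show "((\<lambda>x. transpose A *v g (A *v x)) has_derivative
      (\<lambda>h. (transpose A ** H (A *v x) ** A) *v h)) (at x)"
    by (simp add: matrix_vector_mul_assoc matrix_mul_assoc)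
qed

lemma quadratic_form_linear:
  fixes A :: "real^'n^'m"
  shows "z \<bullet> ((transpose A ** M ** A) *v z) = (A *v z) \<bullet> (M *v (A *v z))"
  by (metis (no_types) dot_lmul_matrix inner_commute matrix_vector_mul_assoc matrix_mul_assoc vector_transpose_matrix
      transpose_matrix_vector)

section \<open>The profile and the domain\<close>

text \<open>Extension by zero to the left. It commutes with differentiation when \<open>f\<close>
  and its derivative vanish at \<open>0\<close>, so it patches formulas and cuts off functions
  without losing regularity.\<close>

definition glue :: "(real \<Rightarrow> real) \<Rightarrow> real \<Rightarrow> real" where
  "glue f t = (if 0 \<le> t then f t else 0)"

text \<open>At \<open>0\<close> the difference quotient of \<open>glue f\<close> is dominated by
  that of \<open>f\<close>, which tends to \<open>f' 0 = 0\<close>.\<close>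

lemma DERIV_glue:
  assumes f: "\<And>t. DERIV f t :> f' t" and "f 0 = 0" "f' 0 = 0"
  shows "DERIV (glue f) t :> glue f' t"
proof -
  consider "t > 0" | "t < 0" | "t = 0" by linarith
  then show ?thesis
  proof cases
    case 1
    have "\<forall>\<^sub>F x in nhds t. glue f x = f x"
      using eventually_nhds_in_open[of "{0<..}" t] 1
      by (auto elim!: eventually_mono simp: glue_def)
    then show ?thesis
      using f[of t] 1 DERIV_cong_ev[OF refl, of "glue f" f t "glue f' t" "f' t"] by (simp add: glue_def)
  next
    case 2
    have "\<forall>\<^sub>F x in nhds t. glue f x = 0"
      using eventually_nhds_in_open[of "{..<0}" t] 2
      by (auto elim!: eventually_mono simp: glue_def)
    then show ?thesis
      using 2 DERIV_cong_ev[OF refl, of "glue f" "\<lambda>_. 0" t "glue f' t" 0] by (simp add: glue_def)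
  next
    case 3
    have "((\<lambda>h. (f (0 + h) - f 0) / h) \<longlongrightarrow> 0) (at 0)"
      using f[of 0] assms by (simp add: DERIV_def)
    then have "((\<lambda>h. (glue f (0 + h) - glue f 0) / h) \<longlongrightarrow> 0) (at 0)"
    proof (rule Lim_null_comparison[rotated, OF tendsto_rabs_zero])
      show "\<forall>\<^sub>F h in at 0. norm ((glue f (0 + h) - glue f 0) / h) \<le> \<bar>(f (0 + h) - f 0) / h\<bar>"
        by (intro always_eventually) (auto simp: glue_def assms simp del: abs_divide)
    qed
    then show ?thesis using 3 assms by (simp add: DERIV_def glue_def)
  qed
qed

lemma continuous_on_glue:
  assumes "continuous_on UNIV f" "f 0 = 0"
  shows "continuous_on UNIV (glue f)"
proof -
  have "continuous_on ({0..} \<union> {..0}) (\<lambda>t. if 0 \<le> t then f t else 0)"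
    using assms by (intro continuous_on_If) (auto intro: continuous_on_subset)
  moreover have "{0..} \<union> {..0} = (UNIV :: real set)" by auto
  ultimately show ?thesis unfolding glue_def[abs_def] by simp
qed

lemma glue_shift_DERIV:
  assumes "\<And>t. DERIV f t :> f' t" "f 0 = 0" "f' 0 = 0"
  shows "DERIV (\<lambda>t. glue f (t - a)) t :> glue f' (t - a)"
    and "DERIV (\<lambda>t. glue f (- t - a)) t :> - glue f' (- t - a)"
proof -
  have "DERIV (\<lambda>t. t - a) t :> 1" "DERIV (\<lambda>t. - t - a) t :> - 1"
    by (auto intro!: derivative_eq_intros)
  from DERIV_chain2[OF DERIV_glue[OF assms] this(1)] DERIV_chain2[OF DERIV_glue[OF assms] this(2)]
  show "DERIV (\<lambda>t. glue f (t - a)) t :> glue f' (t - a)"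
    and "DERIV (\<lambda>t. glue f (- t - a)) t :> - glue f' (- t - a)" by simp_all
qed

text \<open>The even profile equal to \<open>cos t\<close> for \<open>\<bar>t\<bar> \<le> alpha\<close> and to
  \<open>- sqrt w * sin ((\<bar>t\<bar> - alpha) / sqrt w)\<close> beyond. The correction terms vanish to second order
  at \<open>\<plusminus> alpha\<close>, so the profile is twice continuously differentiable.\<close>

definition prof :: "real \<Rightarrow> real \<Rightarrow> real" where
  "prof w t = cos t + glue (\<lambda>x. sin x - sqrt w * sin (x / sqrt w)) (t - alpha)
     + glue (\<lambda>x. sin x - sqrt w * sin (x / sqrt w)) (- t - alpha)"

definition prof' :: "real \<Rightarrow> real \<Rightarrow> real" where
  "prof' w t = - sin t + glue (\<lambda>x. cos x - cos (x / sqrt w)) (t - alpha)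
     - glue (\<lambda>x. cos x - cos (x / sqrt w)) (- t - alpha)"

definition prof'' :: "real \<Rightarrow> real \<Rightarrow> real" where
  "prof'' w t = - cos t + glue (\<lambda>x. - sin x + sin (x / sqrt w) / sqrt w) (t - alpha)
     + glue (\<lambda>x. - sin x + sin (x / sqrt w) / sqrt w) (- t - alpha)"

lemma DERIV_prof:
  assumes "w > 0"
  shows "DERIV (prof w) t :> prof' w t" and "DERIV (prof' w) t :> prof'' w t"
proof -
  have D: "DERIV (\<lambda>x. x / sqrt w) x :> 1 / sqrt w" for x
    by (rule DERIV_cdivide) (rule DERIV_ident)
  note S = DERIV_chain2[OF DERIV_sin D] and C = DERIV_chain2[OF DERIV_cos D]
  have 1: "DERIV (\<lambda>x. sin x - sqrt w * sin (x / sqrt w)) x :> cos x - cos (x / sqrt w)" for x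
    using DERIV_diff[OF DERIV_sin DERIV_cmult[OF S, of "sqrt w"]] assms by simp
  have 2: "DERIV (\<lambda>x. cos x - cos (x / sqrt w)) x :> - sin x + sin (x / sqrt w) / sqrt w" for x
    using DERIV_diff[OF DERIV_cos C] by simp
  show "DERIV (prof w) t :> prof' w t"
    using DERIV_add[OF DERIV_add[OF DERIV_cos glue_shift_DERIV(1)[OF 1]] glue_shift_DERIV(2)[OF 1]]
    unfolding prof_def[abs_def] prof'_def by simp
  show "DERIV (prof' w) t :> prof'' w t"
    using DERIV_diff[OF DERIV_add[OF DERIV_minus[OF DERIV_sin] glue_shift_DERIV(1)[OF 2]]
        glue_shift_DERIV(2)[OF 2]]
    unfolding prof'_def[abs_def] prof''_def by simp
qed

lemma continuous_on_prof'': "continuous_on UNIV (prof'' w)"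
proof -
  have c: "continuous_on UNIV (glue (\<lambda>x. - sin x + sin (x / sqrt w) / sqrt w))"
    unfolding divide_inverse by (intro continuous_on_glue continuous_intros) simp
  have g: "continuous_on UNIV (\<lambda>t. glue (\<lambda>x. - sin x + sin (x / sqrt w) / sqrt w) (h t))"
    if "continuous_on UNIV h" for h :: "real \<Rightarrow> real"
    by (rule continuous_on_compose2[OF c that]) simp
  show ?thesis unfolding prof''_def[abs_def] by (intro continuous_intros g)
qed

lemma prof_inner:
  assumes "\<bar>t\<bar> \<le> alpha"
  shows "prof w t = cos t" "prof' w t = - sin t" "prof'' w t = - cos t"
proof -
  have z: "glue f (t - alpha) = 0" "glue f (- t - alpha) = 0" if "f 0 = 0" for f
  proof -
    have "t - alpha \<le> 0" "- t - alpha \<le> 0" using assms by linarith+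
    then show "glue f (t - alpha) = 0" "glue f (- t - alpha) = 0"
      using that unfolding glue_def by (metis antisym)+
  qed
  show "prof w t = cos t" "prof' w t = - sin t" "prof'' w t = - cos t"
    unfolding prof_def prof'_def prof''_def
    by (simp_all only: z sin_zero cos_zero div_0 mult_zero_right diff_self diff_0_right add_0_right minus_zero)
qed

lemma prof_minus [simp]: "prof w (- t) = prof w t" "prof' w (- t) = - prof' w t" "prof'' w (- t) = prof'' w t"
  unfolding prof_def prof'_def prof''_def by simp_all

lemma prof_abs [simp]: "prof w \<bar>t\<bar> = prof w t" "prof'' w \<bar>t\<bar> = prof'' w t"
  by (simp_all add: abs_if)

lemma prof_outer:
  assumes "alpha \<le> t"
  shows "prof w t = - sqrt w * sin ((t - alpha) / sqrt w)" "prof' w t = - cos ((t - alpha) / sqrt w)"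
    "prof'' w t = sin ((t - alpha) / sqrt w) / sqrt w"
proof -
  have "0 \<le> t - alpha" "\<not> 0 \<le> - t - alpha" using assms pi_gt_zero by linarith+
  moreover have "sin (t - alpha) = - cos t" "cos (t - alpha) = sin t"
    by (simp_all add: sin_diff cos_diff)
  ultimately show "prof w t = - sqrt w * sin ((t - alpha) / sqrt w)" "prof' w t = - cos ((t - alpha) / sqrt w)"
    "prof'' w t = sin ((t - alpha) / sqrt w) / sqrt w"
    by (simp_all add: prof_def prof'_def prof''_def glue_def)
qed

section \<open>The profile equation and the domain as a superlevel set\<close>

locale pucci_domain =
  fixes lam Lam w \<gamma> :: real
  assumes lam: "0 < lam" "lam \<le> Lam" and w_eq: "w = Lam / lam" and w: "4 \<le> w"
    and \<gamma>: "2 / sqrt w \<le> \<gamma>" "\<gamma> \<le> sqrt w / 2"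
begin

text \<open>The point where the outer arc of the profile reaches its minimum
  \<open>- sqrt w\<close>. The profile rises again beyond it, so the cube of this half-width
  isolates the wanted part of \<open>{U > 0}\<close>.\<close>

definition L :: real where "L = alpha + sqrt w * alpha"

definition wt :: "3 \<Rightarrow> real" where "wt i = (if i = 3 then 1 else \<gamma>)"

definition U :: "real^3 \<Rightarrow> real" where "U p = (\<Sum>i\<in>UNIV. wt i * prof w (p $ i))"

definition DU :: "real^3 \<Rightarrow> real^3" where "DU p = (\<chi> i. wt i * prof' w (p $ i))"

definition HU :: "real^3 \<Rightarrow> real^3^3" where
  "HU p = (\<chi> i j. if i = j then wt i * prof'' w (p $ i) else 0)"

text \<open>The reflected union of the seven pieces before the interior is taken, as
  \<open>Omega_eq_Om\<close> proves.\<close>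

definition cell :: "(real^3) set" where "cell = {p. (\<forall>i. \<bar>p $ i\<bar> \<le> L) \<and> 0 \<le> U p}"

lemma sqrt_w: "2 \<le> sqrt w" "sqrt w > 0" "sqrt w * sqrt w = w"
  using w real_le_rsqrt[of 2 w] by (auto simp: real_sqrt_mult_self)

lemma Lam: "Lam = w * lam" using lam w_eq by simp

lemma \<gamma>_pos: "\<gamma> > 0" using \<gamma>(1) sqrt_w(2) less_le_trans[of 0 "2 / sqrt w" \<gamma>] by simp

text \<open>The last two bounds say that \<open>U \<le> 0\<close> on the faces of the cube: with one
  coordinate at \<open>L\<close> and the other profiles at most \<open>1\<close>, \<open>U\<close>
  is at most \<open>2 * \<gamma> - sqrt w\<close> or
  \<open>\<gamma> + 1 - \<gamma> * sqrt w\<close>. Hence \<open>{U > 0}\<close> stays off the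
  faces.\<close>

lemma \<gamma>_bounds: "2 \<le> \<gamma> * sqrt w" "2 * \<gamma> \<le> sqrt w" "\<gamma> + 1 \<le> \<gamma> * sqrt w"
proof -
  show a: "2 \<le> \<gamma> * sqrt w" using \<gamma> sqrt_w by (simp add: pos_divide_le_eq)
  show "2 * \<gamma> \<le> sqrt w" using \<gamma> by simp
  have "2 * \<gamma> \<le> \<gamma> * sqrt w" using sqrt_w \<gamma>_pos by (simp add: mult.commute)
  with a show "\<gamma> + 1 \<le> \<gamma> * sqrt w" by linarith
qed

lemma wt_pos: "wt i > 0" using \<gamma>_pos by (simp add: wt_def)

lemma L: "alpha < L" "0 < L" "alpha + 2 \<le> L" "alpha \<le> L"
proof -
  have "2 * 1 \<le> sqrt w * alpha" using sqrt_w pi_gt3 by (intro mult_mono) auto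
  then show "alpha < L" "0 < L" "alpha + 2 \<le> L" "alpha \<le> L"
    unfolding L_def using pi_gt_zero by linarith+
qed

lemma U_expand: "U p = \<gamma> * prof w (p $ 1) + \<gamma> * prof w (p $ 2) + prof w (p $ 3)"
  by (simp add: U_def wt_def sum_3)

lemma C2_U: "C2_on UNIV U DU HU"
proof -
  have "C2_on UNIV (\<lambda>p. \<Sum>i\<in>UNIV. (\<lambda>t. wt i * prof w t) (p $ i)) (\<lambda>p. \<chi> i. (\<lambda>t. wt i * prof' w t) (p $ i))
     (\<lambda>p. \<chi> i j. if i = j then (\<lambda>t. wt i * prof'' w t) (p $ i) else 0)"
    using w by (intro C2_on_separable DERIV_cmult DERIV_prof continuous_on_mult continuous_on_prof'') auto
  then show ?thesis by (simp add: U_def[abs_def] DU_def[abs_def] HU_def[abs_def])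
qed

lemma outer_angle:
  assumes "alpha \<le> t" "t \<le> L"
  shows "0 \<le> (t - alpha) / sqrt w" "(t - alpha) / sqrt w \<le> alpha" "(t - alpha) / sqrt w \<le> pi"
proof -
  show "0 \<le> (t - alpha) / sqrt w" using assms sqrt_w by (intro divide_nonneg_pos) auto
  have "t - alpha \<le> alpha * sqrt w" using assms by (simp add: L_def mult.commute)
  then show le: "(t - alpha) / sqrt w \<le> alpha" using sqrt_w by (subst pos_divide_le_eq)
  show "(t - alpha) / sqrt w \<le> pi" using le pi_gt_zero by linarith
qed

lemma outer_angle_strict:
  assumes "alpha < t" "t < L"
  shows "0 < (t - alpha) / sqrt w" "(t - alpha) / sqrt w < alpha"
proof -
  show "0 < (t - alpha) / sqrt w" using assms sqrt_w by (intro divide_pos_pos) auto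
  have "t - alpha < alpha * sqrt w" using assms by (simp add: L_def mult.commute)
  then show "(t - alpha) / sqrt w < alpha" using sqrt_w by (subst pos_divide_less_eq)
qed

lemma prof_cases:
  obtains "\<bar>t\<bar> \<le> alpha" "prof w t = cos t" "prof'' w t = - cos t"
  | "alpha < \<bar>t\<bar>" "prof w t = - sqrt w * sin ((\<bar>t\<bar> - alpha) / sqrt w)"
    "prof'' w t = sin ((\<bar>t\<bar> - alpha) / sqrt w) / sqrt w"
proof (cases "\<bar>t\<bar> \<le> alpha")
  case True
  then show ?thesis using prof_inner[OF True] that(1) by blast
next
  case False
  then have "alpha \<le> \<bar>t\<bar>" by linarith
  from prof_outer[OF this, of w] False show ?thesis
    by (intro that(2)) (simp_all only: prof_abs not_le)
qed

text \<open>On the inner arc \<open>prof''\<close> is \<open>- cos\<close> and receives the weight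
  \<open>lam\<close>. On the outer arc it is nonnegative and receives \<open>Lam\<close>, but it
  equals \<open>- prof / w\<close>, and \<open>Lam / w\<close> is \<open>lam\<close>.\<close>

lemma pucci_weight_prof'':
  assumes "\<bar>t\<bar> \<le> L"
  shows "pucci_weight lam Lam (prof'' w t) = - lam * prof w t"
proof (cases t rule: prof_cases)
  case 1
  then have "cos t \<ge> 0" by (intro cos_ge_zero) linarith+
  then show ?thesis using 1 by (simp add: pucci_weight_def)
next
  case 2
  then have "sin ((\<bar>t\<bar> - alpha) / sqrt w) \<ge> 0"
    using outer_angle[of "\<bar>t\<bar>"] assms by (intro sin_ge_zero) simp_all
  moreover have "Lam * (s / sqrt w) = lam * (sqrt w * s)" for s
    using sqrt_w by (simp add: Lam field_simps)
  ultimately show ?thesis using 2 sqrt_w by (auto simp: pucci_weight_def zero_less_divide_iff)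
qed

lemma pucci_weight_HU:
  assumes "p \<in> cell"
  shows "(\<Sum>i\<in>UNIV. pucci_weight lam Lam (wt i * prof'' w (p $ i))) = - lam * U p"
proof -
  have "pucci_weight lam Lam (wt i * prof'' w (p $ i)) = - lam * (wt i * prof w (p $ i))" for i
    using assms wt_pos[of i] by (simp add: pucci_weight_mult pucci_weight_prof'' cell_def)
  then show ?thesis by (simp add: U_def sum_distrib_left)
qed

lemma prof'_neg:
  assumes "0 < t" "t < L"
  shows "prof' w t < 0"
proof (cases "t \<le> alpha")
  case True
  then show ?thesis using assms prof_inner[of t w] by (simp add: sin_gt_zero2 sin_gt_zero)
next
  case False
  then have t: "alpha < t" by simp
  have "- alpha < (t - alpha) / sqrt w"
    using outer_angle_strict(1)[OF t assms(2)] pi_gt_zero by linarith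
  then have "cos ((t - alpha) / sqrt w) > 0"
    by (rule cos_gt_zero_pi) (rule outer_angle_strict(2)[OF t assms(2)])
  then show ?thesis using t prof_outer[of t w] by simp
qed

lemma prof_strict_decreasing:
  assumes "\<bar>s\<bar> < \<bar>t\<bar>" "\<bar>t\<bar> \<le> L"
  shows "prof w t < prof w s"
proof -
  have D: "DERIV (prof w) x :> prof' w x" for x using w by (intro DERIV_prof) simp
  have "prof w \<bar>t\<bar> < prof w \<bar>s\<bar>"
  proof (rule DERIV_neg_imp_decreasing_open[OF assms(1)])
    fix x assume "\<bar>s\<bar> < x" "x < \<bar>t\<bar>"
    then have "prof' w x < 0" using assms by (intro prof'_neg) linarith+
    with D show "\<exists>y. DERIV (prof w) x :> y \<and> y < 0" by blast
  next
    show "continuous_on {\<bar>s\<bar>..\<bar>t\<bar>} (prof w)"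
      by (intro continuous_at_imp_continuous_on ballI DERIV_isCont[OF D])
  qed
  then show ?thesis by simp
qed

lemma prof_decreasing:
  assumes "\<bar>s\<bar> \<le> \<bar>t\<bar>" "\<bar>t\<bar> \<le> L"
  shows "prof w t \<le> prof w s"
proof (cases "\<bar>s\<bar> = \<bar>t\<bar>")
  case True
  then show ?thesis using prof_abs(1)[of w s] prof_abs(1)[of w t] by simp
next
  case False
  with assms have "\<bar>s\<bar> < \<bar>t\<bar>" by linarith
  from prof_strict_decreasing[OF this assms(2)] show ?thesis by (rule less_imp_le)
qed

lemma prof_0: "prof w 0 = 1" using prof_inner[of 0 w] by simp

lemma prof_L: "prof w L = - sqrt w"
proof -
  have "(L - alpha) / sqrt w = alpha" using sqrt_w by (simp add: L_def)
  then show ?thesis using prof_outer(1)[OF L(4), of w] by (simp only: sin_pi_half mult_1_right)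
qed

lemma prof_bounds:
  assumes "\<bar>t\<bar> \<le> L"
  shows "prof w t \<le> 1" "- sqrt w \<le> prof w t"
proof -
  have "prof w t \<le> prof w 0" "prof w L \<le> prof w t"
    by (rule prof_decreasing; use assms L(2) in linarith)+
  then show "prof w t \<le> 1" "- sqrt w \<le> prof w t" by (simp_all only: prof_0 prof_L)
qed

lemma U_0: "U 0 = 2 * \<gamma> + 1" by (simp add: U_expand prof_0)

lemma cell_less_L:
  assumes "p \<in> cell" "0 < U p"
  shows "\<bar>p $ i\<bar> < L"
proof (rule ccontr)
  assume "\<not> \<bar>p $ i\<bar> < L"
  with assms have "\<bar>p $ i\<bar> = L" by (simp add: cell_def not_less antisym)
  then have "prof w (p $ i) = - sqrt w" using prof_L prof_abs(1)[of w "p $ i"] by simp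
  moreover have "\<gamma> * prof w (p $ j) \<le> \<gamma>" "prof w (p $ j) \<le> 1" for j
    using prof_bounds(1)[of "p $ j"] assms(1) \<gamma>_pos by (simp_all add: cell_def)
  note this[of 1] this[of 2] this[of 3]
  ultimately show False
    using assms(2) \<gamma>_bounds exhaust_3[of i] unfolding U_expand by (elim disjE) simp_all
qed

definition Om :: "(real^3) set" where "Om = {p. (\<forall>i. \<bar>p $ i\<bar> < L) \<and> 0 < U p}"

lemma Om_iff: "p \<in> Om \<longleftrightarrow> p \<in> cell \<and> 0 < U p"
proof
  assume "p \<in> Om"
  then show "p \<in> cell \<and> 0 < U p" by (simp add: Om_def cell_def less_imp_le)
next
  assume "p \<in> cell \<and> 0 < U p"
  then show "p \<in> Om" using cell_less_L[of p] by (simp add: Om_def)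
qed

lemma continuous_on_U [continuous_intros]: "continuous_on S U"
  by (rule continuous_on_subset[OF conjunct1[OF C2_on_imp_continuous_on[OF C2_U]]]) simp

text \<open>The profile strictly decreases in \<open>\<bar>t\<bar>\<close>, so shrinking a nonzero
  point raises \<open>U\<close> strictly. Star-shapedness yields both the interior of
  \<open>cell\<close> and the dilation argument for the upper bound.\<close>

lemma cell_star:
  assumes p: "p \<in> cell" and t: "0 \<le> t" "t < 1"
  shows "t *\<^sub>R p \<in> Om"
proof -
  have abs: "\<bar>t * x\<bar> \<le> \<bar>x\<bar>" for x :: real
    using t mult_right_mono[of t 1 "\<bar>x\<bar>"] by (simp add: abs_mult)
  have le: "prof w (p $ i) \<le> prof w (t * p $ i)" for i
    using p by (intro prof_decreasing abs) (simp add: cell_def)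
  have "0 < U (t *\<^sub>R p)"
  proof (cases "p = 0")
    case True
    then show ?thesis using U_0 \<gamma>_pos by simp
  next
    case False
    then obtain j where j: "p $ j \<noteq> 0" by (auto simp: vec_eq_iff)
    have "U p < U (t *\<^sub>R p)"
      unfolding U_def
    proof (rule sum_strict_mono_ex1)
      have "prof w (p $ j) < prof w (t * p $ j)"
      proof (rule prof_strict_decreasing)
        show "\<bar>t * p $ j\<bar> < \<bar>p $ j\<bar>"
          using t j mult_strict_right_mono[of t 1 "\<bar>p $ j\<bar>"] by (simp add: abs_mult)
      qed (use p in \<open>auto simp: cell_def\<close>)
      then show "\<exists>i\<in>UNIV. wt i * prof w (p $ i) < wt i * prof w ((t *\<^sub>R p) $ i)"
        using wt_pos[of j] by (intro bexI[of _ j]) auto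
      show "\<forall>i\<in>UNIV. wt i * prof w (p $ i) \<le> wt i * prof w ((t *\<^sub>R p) $ i)"
        using le wt_pos by (auto intro!: mult_left_mono less_imp_le)
    qed simp
    then show ?thesis using p by (simp add: cell_def)
  qed
  moreover have "\<bar>t * p $ i\<bar> \<le> L" for i
    using abs[of "p $ i"] p by (auto simp: cell_def intro: order_trans)
  ultimately show ?thesis by (simp add: Om_iff cell_def)
qed

lemma open_Om: "open Om"
proof -
  have "Om = (\<Inter>i. {p. \<bar>p $ i\<bar> < L}) \<inter> {p. 0 < U p}" by (auto simp: Om_def)
  then show ?thesis
    by (auto intro!: open_INT open_Int open_Collect_less continuous_intros)
qed

lemma closed_cell: "closed cell"
proof -
  have "cell = (\<Inter>i. {p. \<bar>p $ i\<bar> \<le> L}) \<inter> {p. 0 \<le> U p}" by (auto simp: cell_def)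
  then show ?thesis
    by (auto intro!: closed_Int closed_Collect_le continuous_intros)
qed

lemma compact_cell: "compact cell"
proof -
  have "cell \<subseteq> cbox (\<chi> i. - L) (\<chi> i. L)"
    by (auto simp: cell_def mem_box_cart abs_le_iff minus_le_iff)
  then show ?thesis
    using closed_cell bounded_subset[OF bounded_cbox] by (auto simp: compact_eq_bounded_closed)
qed

text \<open>An interior point can be pushed slightly outward and stay in \<open>cell\<close>;
  shrinking it back lands in \<open>Om\<close> by \<open>cell_star\<close>.\<close>

lemma interior_cell: "interior cell = Om"
proof
  show "Om \<subseteq> interior cell" by (rule interior_maximal[OF _ open_Om]) (auto simp: Om_iff)
  show "interior cell \<subseteq> Om"
  proof
    fix p assume "p \<in> interior cell"
    have "((\<lambda>s. (1 + s) *\<^sub>R p) \<longlongrightarrow> (1 + 0) *\<^sub>R p) (at_right (0::real))"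
      by (intro tendsto_intros)
    then have "\<forall>\<^sub>F s in at_right 0. (1 + s) *\<^sub>R p \<in> interior cell"
      by (rule topological_tendstoD) (use \<open>p \<in> interior cell\<close> in auto)
    then have "\<forall>\<^sub>F s in at_right (0::real). (1 + s) *\<^sub>R p \<in> interior cell \<and> 0 < s"
      using eventually_at_right_less by (rule eventually_conj)
    then obtain s :: real where "(1 + s) *\<^sub>R p \<in> interior cell \<and> 0 < s"
      using eventually_happens'[OF trivial_limit_at_right_real] by blast
    then have s: "s > 0" "(1 + s) *\<^sub>R p \<in> cell" using interior_subset by auto
    have "(1 / (1 + s)) *\<^sub>R ((1 + s) *\<^sub>R p) \<in> Om"
      by (rule cell_star[OF s(2)]) (use s in auto)
    then show "p \<in> Om" using s by simp
  qed
qed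

end

section \<open>The pieces of the domain\<close>

context pucci_domain
begin

abbreviation S :: "real \<Rightarrow> real" where "S t \<equiv> sin ((t - alpha) / sqrt w)"

lemma S_nonneg: "alpha \<le> t \<Longrightarrow> t \<le> L \<Longrightarrow> 0 \<le> S t"
  using outer_angle[of t] by (intro sin_ge_zero)

lemma S_pos: "alpha < t \<Longrightarrow> t \<le> L \<Longrightarrow> 0 < S t"
  using outer_angle(2)[of t] sqrt_w pi_gt_zero by (intro sin_gt_zero divide_pos_pos) linarith+

text \<open>Inverting \<open>arcsin\<close> needs the angle to stay at most \<open>pi / 2\<close>,
  which is exactly what \<open>t \<le> L\<close> expresses.\<close>

lemma le_arcsin_iff:
  assumes t: "alpha \<le> t" and c: "0 \<le> c" "c \<le> 1"
  shows "t \<le> alpha + sqrt w * arcsin c \<longleftrightarrow> t \<le> L \<and> S t \<le> c"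
proof -
  let ?x = "(t - alpha) / sqrt w"
  have x: "- (pi / 2) \<le> ?x" using t sqrt_w pi_gt_zero
    by (intro order_trans[OF _ divide_nonneg_pos]) auto
  have "t \<le> alpha + sqrt w * arcsin c \<longleftrightarrow> ?x \<le> arcsin c" "t \<le> L \<longleftrightarrow> ?x \<le> pi / 2"
    unfolding L_def pos_divide_le_eq[OF sqrt_w(2)] by (simp_all add: mult.commute) linarith+
  moreover have "?x \<le> arcsin c \<longleftrightarrow> ?x \<le> pi / 2 \<and> S t \<le> c"
  proof
    assume *: "?x \<le> arcsin c"
    have "arcsin c \<le> pi / 2" using arcsin_bounded[of c] c by simp
    moreover have "S t \<le> sin (arcsin c)"
      using x * \<open>arcsin c \<le> pi / 2\<close> by (intro sin_monotone_2pi_le)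
    ultimately show "?x \<le> pi / 2 \<and> S t \<le> c"
      using * c sin_arcsin[of c] by (intro conjI) linarith+
  next
    assume *: "?x \<le> pi / 2 \<and> S t \<le> c"
    then have "arcsin (S t) \<le> arcsin c" using c by (intro arcsin_le_arcsin) auto
    then show "?x \<le> arcsin c" using arcsin_sin[OF x conjunct1[OF *]] by (simp only:)
  qed
  ultimately show ?thesis by blast
qed

lemma le_arccos_iff:
  assumes "0 \<le> \<theta>" "\<theta> \<le> 1" "0 \<le> y"
  shows "y \<le> arccos \<theta> \<longleftrightarrow> y \<le> alpha \<and> \<theta> \<le> cos y"
proof
  assume *: "y \<le> arccos \<theta>"
  have "cos (arccos \<theta>) \<le> cos y"
    using assms * arccos_bounded[of \<theta>] by (intro cos_monotone_0_pi_le) auto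
  then show "y \<le> alpha \<and> \<theta> \<le> cos y" using assms * arccos_le_pi2[of \<theta>] by auto
next
  assume *: "y \<le> alpha \<and> \<theta> \<le> cos y"
  then have "arccos (cos y) \<le> arccos \<theta>" using assms by (intro arccos_le_arccos) auto
  then show "y \<le> arccos \<theta>" using arccos_cos[of y] assms * pi_gt_zero by simp
qed

abbreviation inner_range :: "real \<Rightarrow> bool" where "inner_range t \<equiv> 0 \<le> t \<and> t \<le> alpha"
abbreviation outer_range :: "real \<Rightarrow> bool" where "outer_range t \<equiv> alpha \<le> t \<and> t \<le> L"

lemma prof_inner_range: "inner_range t \<Longrightarrow> prof w t = cos t"
  by (rule prof_inner) simp

lemma prof_outer_range: "outer_range t \<Longrightarrow> prof w t = - sqrt w * S t"
  by (rule prof_outer) simp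

lemma cos_inner_range: "inner_range t \<Longrightarrow> 0 \<le> cos t"
  using pi_gt_zero by (intro cos_ge_zero) linarith+

lemma piece_C_iff: "p \<in> piece_C \<longleftrightarrow> inner_range (p$1) \<and> inner_range (p$2) \<and> inner_range (p$3)"
  by (auto simp: piece_C_def)

lemma outer_piece_iff:
  assumes t: "alpha \<le> t" and c: "0 \<le> c" "c \<le> sqrt w"
  shows "t \<le> alpha + sqrt w * arcsin (c / sqrt w) \<longleftrightarrow> t \<le> L \<and> sqrt w * S t \<le> c"
  using le_arcsin_iff[OF t, of "c / sqrt w"] c sqrt_w
  by (simp add: pos_le_divide_eq pos_divide_le_eq mult.commute)

text \<open>The planes where a coordinate equals \<open>alpha\<close> cut the octant into boxes, and
  each piece is the part of \<open>{U \<ge> 0}\<close> in one box. The \<open>arcsin\<close> bound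
  is \<open>U \<ge> 0\<close> solved for the outer coordinate.\<close>

lemma piece_Z_iff:
  "p \<in> piece_Z w \<gamma> \<longleftrightarrow> inner_range (p$1) \<and> inner_range (p$2) \<and> outer_range (p$3) \<and> 0 \<le> U p"
proof (cases "inner_range (p$1) \<and> inner_range (p$2) \<and> alpha \<le> p$3")
  case True
  have "0 \<le> cos (p$1)" "0 \<le> cos (p$2)" using True cos_inner_range by auto
  moreover have "\<gamma> * (cos (p$1) + cos (p$2)) \<le> \<gamma> * 2"
    using \<gamma>_pos cos_le_one[of "p$1"] cos_le_one[of "p$2"] by (intro mult_left_mono) linarith+
  ultimately have c: "0 \<le> \<gamma> * (cos (p$1) + cos (p$2))" "\<gamma> * (cos (p$1) + cos (p$2)) \<le> sqrt w"
    using \<gamma>_pos \<gamma>_bounds(2) by (simp, linarith)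
  have "\<gamma> / sqrt w * (cos (p$1) + cos (p$2)) = \<gamma> * (cos (p$1) + cos (p$2)) / sqrt w" by simp
  with outer_piece_iff[OF _ c, of "p$3"] True have "p$3 \<le> alpha + sqrt w * arcsin (\<gamma> / sqrt w * (cos (p$1) + cos (p$2)))
      \<longleftrightarrow> p$3 \<le> L \<and> sqrt w * S (p$3) \<le> \<gamma> * (cos (p$1) + cos (p$2))"
    by (simp only:)
  then show ?thesis
    using True prof_inner_range prof_outer_range[of "p$3"]
    by (auto simp: piece_Z_def U_expand distrib_left)
qed (auto simp: piece_Z_def)

lemma piece_side_iff:
  assumes "inner_range y" "inner_range z" "alpha \<le> t"
  shows "t \<le> alpha + sqrt w * arcsin ((\<gamma> * cos y + cos z) / (\<gamma> * sqrt w))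
    \<longleftrightarrow> t \<le> L \<and> \<gamma> * (sqrt w * S t) \<le> \<gamma> * cos y + cos z"
proof -
  have "0 \<le> cos y" "0 \<le> cos z" using assms cos_inner_range by auto
  moreover have "\<gamma> * cos y + cos z \<le> \<gamma> * sqrt w"
    using \<gamma>_pos \<gamma>_bounds mult_left_mono[of "cos y" 1 \<gamma>] cos_le_one[of y] cos_le_one[of z] by linarith
  ultimately have c: "0 \<le> (\<gamma> * cos y + cos z) / \<gamma>" "(\<gamma> * cos y + cos z) / \<gamma> \<le> sqrt w"
    using \<gamma>_pos by (auto simp: pos_divide_le_eq mult.commute intro!: divide_nonneg_pos add_nonneg_nonneg)
  have "t \<le> alpha + sqrt w * arcsin ((\<gamma> * cos y + cos z) / \<gamma> / sqrt w)
    \<longleftrightarrow> t \<le> L \<and> sqrt w * S t \<le> (\<gamma> * cos y + cos z) / \<gamma>"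
    by (rule outer_piece_iff[OF assms(3) c])
  then show ?thesis using \<gamma>_pos by (simp add: pos_le_divide_eq mult.commute)
qed

lemma piece_X_iff:
  "p \<in> piece_X w \<gamma> \<longleftrightarrow> outer_range (p$1) \<and> inner_range (p$2) \<and> inner_range (p$3) \<and> 0 \<le> U p"
proof (cases "inner_range (p$2) \<and> inner_range (p$3) \<and> alpha \<le> p$1")
  case True
  then show ?thesis
    using piece_side_iff[of "p$2" "p$3" "p$1"] prof_inner_range prof_outer_range[of "p$1"]
    by (auto simp: piece_X_def U_expand)
qed (auto simp: piece_X_def)

lemma piece_Y_iff:
  "p \<in> piece_Y w \<gamma> \<longleftrightarrow> inner_range (p$1) \<and> outer_range (p$2) \<and> inner_range (p$3) \<and> 0 \<le> U p"
proof (cases "inner_range (p$1) \<and> inner_range (p$3) \<and> alpha \<le> p$2")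
  case True
  then show ?thesis
    using piece_side_iff[of "p$1" "p$3" "p$2"] prof_inner_range prof_outer_range[of "p$2"]
    by (auto simp: piece_Y_def U_expand)
qed (auto simp: piece_Y_def)

text \<open>Both summands of \<open>\<theta>\<close> are nonnegative, so
  \<open>\<theta> \<le> cos y \<le> 1\<close> already implies the separate \<open>arcsin\<close>
  bounds. The weights are those of \<open>U\<close> divided by the weight of the inner coordinate:
  \<open>1\<close> and \<open>1 / \<gamma>\<close> for two of the edge pieces,
  \<open>\<gamma>\<close> and \<open>\<gamma>\<close> for the third.\<close>

lemma edge_piece_iff:
  assumes c: "0 < c" "1 \<le> c * sqrt w" and d: "0 < d" "1 \<le> d * sqrt w"
    and x: "alpha \<le> x" and z: "alpha \<le> z" and y: "0 \<le> y"
  defines "\<theta> \<equiv> c * sqrt w * S x + d * sqrt w * S z"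
  shows "x \<le> alpha + sqrt w * arcsin (1 / (c * sqrt w)) \<and> z \<le> alpha + sqrt w * arcsin (1 / (d * sqrt w)) \<and>
      0 \<le> \<theta> \<and> \<theta> \<le> 1 \<and> y \<le> arccos \<theta>
    \<longleftrightarrow> x \<le> L \<and> z \<le> L \<and> y \<le> alpha \<and> \<theta> \<le> cos y"
proof -
  have arc: "x \<le> alpha + sqrt w * arcsin (1 / (e * sqrt w)) \<longleftrightarrow> x \<le> L \<and> e * sqrt w * S x \<le> 1"
    if e: "0 < e" "1 \<le> e * sqrt w" and x: "alpha \<le> x" for e x
  proof -
    have "0 < e * sqrt w" using e by linarith
    then show ?thesis using le_arcsin_iff[OF x, of "1 / (e * sqrt w)"] e
      by (simp add: pos_le_divide_eq mult.commute mult.left_commute)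
  qed
  have nonneg: "0 \<le> e * sqrt w * S x" if "0 < e" "alpha \<le> x" "x \<le> L" for e x
    using S_nonneg[OF that(2,3)] that sqrt_w by simp
  have le1: "cos y \<le> 1" by simp
  show ?thesis
  proof (cases "x \<le> L \<and> z \<le> L")
    case True
    then have "0 \<le> c * sqrt w * S x" "0 \<le> d * sqrt w * S z" using nonneg c d x z by blast+
    then have "0 \<le> \<theta>" "c * sqrt w * S x \<le> \<theta>" "d * sqrt w * S z \<le> \<theta>" by (simp_all add: \<theta>_def)
    note facts = this True arc[OF c x] arc[OF d z] le_arccos_iff[of \<theta> y] y
    show ?thesis
    proof (intro iffI, goal_cases)
      case 1
      then show ?case using facts by blast
    next
      case 2
      then have "\<theta> \<le> 1" using le1 by linarith
      moreover from this have "c * sqrt w * S x \<le> 1" "d * sqrt w * S z \<le> 1" using facts(2,3) by linarith+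
      ultimately show ?case using facts 2 by blast
    qed
  qed (use arc[OF c x] arc[OF d z] in blast)
qed

lemma edge_weights: "0 < 1 / \<gamma>" "1 \<le> 1 / \<gamma> * sqrt w" "1 \<le> \<gamma> * sqrt w" "1 \<le> 1 * sqrt w"
  using \<gamma>_pos \<gamma>_bounds sqrt_w w by (simp_all add: pos_le_divide_eq)

lemma piece_ZX_iff:
  "p \<in> piece_ZX w \<gamma> \<longleftrightarrow> outer_range (p$1) \<and> inner_range (p$2) \<and> outer_range (p$3) \<and> 0 \<le> U p"
proof (cases "alpha \<le> p$1 \<and> alpha \<le> p$3 \<and> 0 \<le> p$2")
  case True
  have "p \<in> piece_ZX w \<gamma> \<longleftrightarrow> p$1 \<le> L \<and> p$3 \<le> L \<and> p$2 \<le> alpha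
      \<and> 1 * sqrt w * S (p$1) + 1 / \<gamma> * sqrt w * S (p$3) \<le> cos (p$2)"
    using edge_piece_iff[of 1 "1 / \<gamma>" "p$1" "p$3" "p$2"] edge_weights True
    by (auto simp: piece_ZX_def Let_def)
  also have "1 * sqrt w * S (p$1) + 1 / \<gamma> * sqrt w * S (p$3) \<le> cos (p$2)
      \<longleftrightarrow> \<gamma> * (sqrt w * S (p$1)) + sqrt w * S (p$3) \<le> \<gamma> * cos (p$2)"
    using \<gamma>_pos mult_le_cancel_left_pos[of \<gamma> "1 * sqrt w * S (p$1) + 1 / \<gamma> * sqrt w * S (p$3)" "cos (p$2)"]
    by (simp add: distrib_left)
  finally show ?thesis
    using True prof_inner_range[of "p$2"] prof_outer_range[of "p$1"] prof_outer_range[of "p$3"]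
    by (auto simp: U_expand)
qed (auto simp: piece_ZX_def Let_def)

lemma piece_YZ_iff:
  "p \<in> piece_YZ w \<gamma> \<longleftrightarrow> inner_range (p$1) \<and> outer_range (p$2) \<and> outer_range (p$3) \<and> 0 \<le> U p"
proof (cases "alpha \<le> p$2 \<and> alpha \<le> p$3 \<and> 0 \<le> p$1")
  case True
  have "p \<in> piece_YZ w \<gamma> \<longleftrightarrow> p$2 \<le> L \<and> p$3 \<le> L \<and> p$1 \<le> alpha
      \<and> 1 * sqrt w * S (p$2) + 1 / \<gamma> * sqrt w * S (p$3) \<le> cos (p$1)"
    using edge_piece_iff[of 1 "1 / \<gamma>" "p$2" "p$3" "p$1"] edge_weights True
    by (auto simp: piece_YZ_def Let_def)
  also have "1 * sqrt w * S (p$2) + 1 / \<gamma> * sqrt w * S (p$3) \<le> cos (p$1)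
      \<longleftrightarrow> \<gamma> * (sqrt w * S (p$2)) + sqrt w * S (p$3) \<le> \<gamma> * cos (p$1)"
    using \<gamma>_pos mult_le_cancel_left_pos[of \<gamma> "1 * sqrt w * S (p$2) + 1 / \<gamma> * sqrt w * S (p$3)" "cos (p$1)"]
    by (simp add: distrib_left)
  finally show ?thesis
    using True prof_inner_range[of "p$1"] prof_outer_range[of "p$2"] prof_outer_range[of "p$3"]
    by (auto simp: U_expand)
qed (auto simp: piece_YZ_def Let_def)

lemma piece_XY_iff:
  "p \<in> piece_XY w \<gamma> \<longleftrightarrow> outer_range (p$1) \<and> outer_range (p$2) \<and> inner_range (p$3) \<and> 0 \<le> U p"
proof (cases "alpha \<le> p$1 \<and> alpha \<le> p$2 \<and> 0 \<le> p$3")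
  case True
  have "p \<in> piece_XY w \<gamma> \<longleftrightarrow> p$1 \<le> L \<and> p$2 \<le> L \<and> p$3 \<le> alpha
      \<and> \<gamma> * sqrt w * S (p$1) + \<gamma> * sqrt w * S (p$2) \<le> cos (p$3)"
    using edge_piece_iff[of \<gamma> \<gamma> "p$1" "p$2" "p$3"] edge_weights \<gamma>_pos True
    by (auto simp: piece_XY_def Let_def)
  then show ?thesis
    using True prof_inner_range[of "p$3"] prof_outer_range[of "p$1"] prof_outer_range[of "p$2"]
    by (auto simp: U_expand)
qed (auto simp: piece_XY_def Let_def)

lemmas piece_iffs = piece_C_iff piece_Z_iff piece_X_iff piece_Y_iff piece_ZX_iff piece_XY_iff piece_YZ_iff

text \<open>Seven of the eight boxes carry a piece. In the eighth, where all coordinates exceed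
  \<open>alpha\<close>, every profile is negative, so \<open>U \<ge> 0\<close> fails.\<close>

lemma octant_part_iff: "p \<in> octant_part w \<gamma> \<longleftrightarrow> (\<forall>i. 0 \<le> p $ i) \<and> p \<in> cell"
proof
  assume "p \<in> octant_part w \<gamma>"
  moreover have "0 \<le> U p" if "p \<in> piece_C"
    using that \<gamma>_pos cos_inner_range prof_inner_range unfolding piece_C_iff U_expand by simp
  moreover have "0 < alpha" by simp
  ultimately have "0 \<le> U p \<and> (\<forall>i. 0 \<le> p $ i \<and> p $ i \<le> L)"
    using L(4) unfolding octant_part_def Un_iff piece_iffs forall_3 by (elim disjE conjE) linarith+
  then show "(\<forall>i. 0 \<le> p $ i) \<and> p \<in> cell" by (simp add: cell_def)
next
  assume "(\<forall>i. 0 \<le> p $ i) \<and> p \<in> cell"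
  then have p: "0 \<le> U p" "\<And>i. 0 \<le> p $ i" "\<And>i. p $ i \<le> L" by (auto simp: cell_def)
  have r: "inner_range (p $ i) \<or> outer_range (p $ i)" for i using p(2,3)[of i] by linarith
  have "p $ 1 \<le> alpha \<or> p $ 2 \<le> alpha \<or> p $ 3 \<le> alpha"
  proof (rule ccontr)
    assume "\<not> ?thesis"
    then have a: "alpha < p $ 1" "alpha < p $ 2" "alpha < p $ 3" by auto
    have "prof w (p $ i) < 0" if "alpha < p $ i" for i
      using prof_outer_range[of "p $ i"] S_pos[of "p $ i"] that p(3)[of i] sqrt_w by simp
    from this[OF a(1)] this[OF a(2)] this[OF a(3)] \<gamma>_pos
    have "\<gamma> * prof w (p $ 1) < 0" "\<gamma> * prof w (p $ 2) < 0" "prof w (p $ 3) < 0"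
      by (simp_all add: mult_pos_neg)
    then show False using p(1) unfolding U_expand by linarith
  qed
  then have "inner_range (p $ 1) \<or> inner_range (p $ 2) \<or> inner_range (p $ 3)" using p(2) by blast
  then show "p \<in> octant_part w \<gamma>"
    using r[of 1] r[of 2] r[of 3] p(1) unfolding octant_part_def Un_iff piece_iffs
    by (elim disjE) simp_all
qed

lemma u_plus_eq_U: "p \<in> octant_part w \<gamma> \<Longrightarrow> u_plus w \<gamma> p = U p"
proof -
  have C: "p \<in> piece_C \<Longrightarrow> f_C w \<gamma> p = U p"
    using prof_inner_range unfolding piece_iffs by (simp add: U_expand f_C_def)
  have Z: "p \<in> piece_Z w \<gamma> \<Longrightarrow> f_Z w \<gamma> p = U p"
    using prof_inner_range prof_outer_range unfolding piece_iffs by (simp add: U_expand f_Z_def)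
  have X: "p \<in> piece_X w \<gamma> \<Longrightarrow> f_X w \<gamma> p = U p"
    using prof_inner_range prof_outer_range unfolding piece_iffs by (simp add: U_expand f_X_def)
  have Y: "p \<in> piece_Y w \<gamma> \<Longrightarrow> f_Y w \<gamma> p = U p"
    using prof_inner_range prof_outer_range unfolding piece_iffs by (simp add: U_expand f_Y_def)
  have ZX: "p \<in> piece_ZX w \<gamma> \<Longrightarrow> f_ZX w \<gamma> p = U p"
    using prof_inner_range prof_outer_range unfolding piece_iffs by (simp add: U_expand f_ZX_def)
  have XY: "p \<in> piece_XY w \<gamma> \<Longrightarrow> f_XY w \<gamma> p = U p"
    using prof_inner_range prof_outer_range unfolding piece_iffs by (simp add: U_expand f_XY_def)
  have YZ: "p \<in> piece_YZ w \<gamma> \<Longrightarrow> f_YZ w \<gamma> p = U p"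
    using prof_inner_range prof_outer_range unfolding piece_iffs by (simp add: U_expand f_YZ_def)
  assume "p \<in> octant_part w \<gamma>"
  then show ?thesis
    unfolding octant_part_def Un_iff
    using u_plus_on_pieces[of p w \<gamma>] C Z X Y ZX XY YZ by (elim disjE) simp_all
qed

lemma abs_mem_octant_part:
  assumes "p \<in> cell"
  shows "vector [\<bar>p$1\<bar>, \<bar>p$2\<bar>, \<bar>p$3\<bar>] \<in> octant_part w \<gamma>"
    and "U (vector [\<bar>p$1\<bar>, \<bar>p$2\<bar>, \<bar>p$3\<bar>]) = U p"
proof -
  show "U (vector [\<bar>p$1\<bar>, \<bar>p$2\<bar>, \<bar>p$3\<bar>]) = U p" by (simp add: U_expand)
  with assms show "vector [\<bar>p$1\<bar>, \<bar>p$2\<bar>, \<bar>p$3\<bar>] \<in> octant_part w \<gamma>"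
    unfolding octant_part_iff by (simp add: cell_def forall_3)
qed

lemma u_fun_eq_U: "p \<in> cell \<Longrightarrow> u_fun w \<gamma> p = U p"
  unfolding u_fun_def by (simp add: u_plus_eq_U abs_mem_octant_part)

lemma Omega_eq_Om: "Omega w \<gamma> = Om"
proof -
  have "{vector [s1 * p$1, s2 * p$2, s3 * p$3] | s1 s2 s3 p.
     p \<in> octant_part w \<gamma> \<and> s1 \<in> {-1, 1} \<and> s2 \<in> {-1, 1} \<and> s3 \<in> {-1, 1}} = cell" (is "?R = _")
  proof (intro equalityI subsetI)
    fix x assume "x \<in> ?R"
    then obtain s1 s2 s3 and p :: "real^3" where x: "x = vector [s1 * p$1, s2 * p$2, s3 * p$3]"
      and p: "p \<in> cell" and s: "s1 \<in> {-1, 1}" "s2 \<in> {-1, 1}" "s3 \<in> {-1, 1}"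
      unfolding octant_part_iff by blast
    have "prof w (s * t) = prof w t \<and> \<bar>s * t\<bar> = \<bar>t\<bar>" if "s \<in> {-1, 1}" for s t using that by auto
    with s have "U x = U p" "\<bar>x$1\<bar> = \<bar>p$1\<bar>" "\<bar>x$2\<bar> = \<bar>p$2\<bar>" "\<bar>x$3\<bar> = \<bar>p$3\<bar>"
      unfolding x U_expand by simp_all
    with p show "x \<in> cell" by (simp add: cell_def forall_3)
  next
    fix x assume "x \<in> cell"
    let ?s = "\<lambda>i. if 0 \<le> x $ i then 1 else - 1 :: real"
    let ?p = "vector [\<bar>x$1\<bar>, \<bar>x$2\<bar>, \<bar>x$3\<bar>] :: real^3"
    have "x = vector [?s 1 * ?p$1, ?s 2 * ?p$2, ?s 3 * ?p$3]" by (simp add: vec_eq_iff forall_3)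
    moreover have "?p \<in> octant_part w \<gamma>" by (rule abs_mem_octant_part) fact
    moreover have "?s i \<in> {-1, 1}" for i by simp
    ultimately show "x \<in> ?R" by blast
  qed
  then show ?thesis unfolding Omega_def by (simp add: interior_cell)
qed

end

section \<open>The unsheared domain and the shear\<close>

lemma pucci_diagonal:
  fixes d :: "'n::finite \<Rightarrow> real"
  shows "pucci lam Lam (\<chi> i j. if i = j then d i else 0) = (\<Sum>i\<in>UNIV. pucci_weight lam Lam (d i))"
proof (rule pucci_eigenbasis)
  show "(axis i 1 :: real^'n) \<bullet> axis j 1 = (if i = j then 1 else 0)" for i j
    by (simp add: inner_axis_axis)
  show "(\<chi> i j. if i = j then d i else 0) *v axis i 1 = d i *\<^sub>R axis i 1" for i
    unfolding matrix_vector_mult_basis by (simp add: vec_eq_iff column_def axis_def)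
qed

lemma matrix_inv_eq:
  fixes A B :: "'a::semiring_1^'n^'n"
  assumes "A ** B = mat 1" "B ** A = mat 1"
  shows "matrix_inv A = B"
proof -
  have "A ** matrix_inv A = mat 1 \<and> matrix_inv A ** A = mat 1"
    unfolding matrix_inv_def by (rule someI[of _ B]) (use assms in simp)
  then have "(matrix_inv A ** A) ** B = B" by simp
  moreover have "(matrix_inv A ** A) ** B = matrix_inv A"
    using assms by (simp flip: matrix_mul_assoc)
  ultimately show ?thesis by simp
qed

context pucci_domain
begin

text \<open>Since \<open>Om\<close> is star-shaped, a dilated copy of \<open>U\<close> by a factor \<open>t < 1\<close> lives on a compact subset
  of \<open>Om\<close> and touches any positive supersolution from below after scaling.\<close>

theorem mu1_plus_Om_le: "mu1_plus lam Lam Om \<le> ereal lam"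
  unfolding mu1_plus_def
proof (rule Sup_least, clarsimp, rule ccontr)
  fix \<mu> \<phi>
  assume pos: "\<forall>x\<in>Om. 0 < \<phi> x"
    and vis: "viscosity_supersolution (\<lambda>r X. - (pucci lam Lam X) - \<mu> * r) Om \<phi>"
    and "\<not> \<mu> \<le> lam"
  then have \<mu>: "lam < \<mu>" by simp
  \<comment> \<open>\<open>t\<^sup>2\<close> is the midpoint of \<open>lam / \<mu>\<close> and
    \<open>1\<close>: the dilation is a genuine contraction, and the dilated eigenvalue
    \<open>lam / t\<^sup>2\<close> is still below \<open>\<mu>\<close>.\<close>
  define t where "t = sqrt ((1 + lam / \<mu>) / 2)"
  have "lam / \<mu> < 1" "0 < lam / \<mu>" using \<mu> lam by simp_all
  then have t2: "t\<^sup>2 = (1 + lam / \<mu>) / 2" "t < 1" "0 < t"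
    by (simp_all add: t_def real_less_lsqrt)
  have "lam / t\<^sup>2 < \<mu>"
  proof -
    have "lam / \<mu> < t\<^sup>2" using t2 \<open>lam / \<mu> < 1\<close> by simp
    then show ?thesis using \<mu> lam t2(3) by (simp add: pos_divide_less_eq mult.commute)
  qed
  define T where "T = (\<lambda>p. t *\<^sub>R p) ` cell"
  have T: "T \<subseteq> Om" unfolding T_def using cell_star t2 by auto
  have T_iff: "p \<in> T \<longleftrightarrow> (1 / t) *\<^sub>R p \<in> cell" for p
  proof
    assume "(1 / t) *\<^sub>R p \<in> cell"
    then have "t *\<^sub>R ((1 / t) *\<^sub>R p) \<in> T" unfolding T_def by (rule imageI)
    then show "p \<in> T" using t2 by simp
  qed (use t2 in \<open>auto simp: T_def\<close>)
  define v where "v p = U ((1 / t) *\<^sub>R p)" for p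
  have "compact T" unfolding T_def
    by (intro compact_continuous_image continuous_intros compact_cell)
  moreover have 0: "0 \<in> T" using U_0 \<gamma>_pos L by (simp add: T_iff cell_def)
  moreover have "continuous_on T (\<lambda>p. v p / \<phi> p)"
  proof (intro continuous_on_divide)
    show "continuous_on T \<phi>"
      using vis T continuous_on_subset unfolding viscosity_supersolution_def by blast
    show "continuous_on T v" unfolding v_def
      by (rule continuous_on_compose2[OF continuous_on_U[of UNIV]]) (auto intro!: continuous_intros)
    show "\<forall>x\<in>T. \<phi> x \<noteq> 0" using pos T by fastforce
  qed
  ultimately obtain x where x: "x \<in> T" and mx: "\<And>y. y \<in> T \<Longrightarrow> v y / \<phi> y \<le> v x / \<phi> x"
    using continuous_attains_sup[of T "\<lambda>p. v p / \<phi> p"] by blast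
  define \<tau> where "\<tau> = v x / \<phi> x"
  have \<phi>x: "\<phi> x > 0" using x T pos by blast
  have "0 < v 0 / \<phi> 0" using 0 T pos U_0 \<gamma>_pos by (auto simp: v_def)
  also have "\<dots> \<le> \<tau>" unfolding \<tau>_def by (rule mx[OF 0])
  finally have \<tau>: "\<tau> > 0" .
  have vx: "v x = \<tau> * \<phi> x" using \<phi>x by (simp add: \<tau>_def)
  then have "v x > 0" using \<tau> \<phi>x by simp
  \<comment> \<open>Since \<open>v\<close> is positive at the maximiser, the contact point is
    interior to \<open>T\<close>, and a neighbourhood is available for the test function.\<close>
  then have qOm: "(1 / t) *\<^sub>R x \<in> Om" using x unfolding T_iff Om_iff v_def by simp
  define N where "N = (\<lambda>p. (1 / t) *\<^sub>R p) -` Om"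
  have N: "open N" "N \<subseteq> T" "x \<in> N"
    unfolding N_def using qOm T_iff Om_iff
    by (auto intro!: open_vimage open_Om continuous_intros)
  \<comment> \<open>Dividing by the maximal ratio \<open>\<tau>\<close> makes
    \<open>v / \<tau>\<close> touch \<open>\<phi>\<close> from below at \<open>x\<close>. It is
    written as a separable sum so that its Hessian is visibly diagonal.\<close>
  define c where "c i = wt i / \<tau>" for i
  define \<psi> where "\<psi> p = (\<Sum>i\<in>UNIV. c i * prof w (p $ i / t))" for p :: "real^3"
  define g where "g p = (\<chi> i. c i * (prof' w (p $ i / t) * (1 / t)))" for p :: "real^3"
  define H where "H p = (\<chi> i j. if i = j then c i * (prof'' w (p $ i / t) * (1 / t) * (1 / t)) else 0)" for p :: "real^3"
  have C2: "C2_on N \<psi> g H"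
  proof (rule C2_on_subset[OF _ N(1) subset_UNIV])
    have d: "DERIV (\<lambda>s. s / t) s :> 1 / t" for s by (rule DERIV_cdivide) (rule DERIV_ident)
    have cont: "continuous_on UNIV (\<lambda>s. prof'' w (s / t))"
      by (rule continuous_on_compose2[OF continuous_on_prof'']) (use t2(3) in \<open>auto intro!: continuous_intros\<close>)
    have w0: "w > 0" using w by simp
    show "C2_on UNIV \<psi> g H"
      unfolding \<psi>_def[abs_def] g_def[abs_def] H_def[abs_def]
      by (intro C2_on_separable DERIV_cmult DERIV_cmult_right DERIV_chain2[OF DERIV_prof(1)[OF w0] d]
          DERIV_chain2[OF DERIV_prof(2)[OF w0] d] continuous_intros cont)
  qed
  have \<psi>v: "\<psi> p = v p / \<tau>" for p
    by (simp add: \<psi>_def v_def U_def c_def sum_divide_distrib)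
  have "- pucci lam Lam (H x) - \<mu> * \<phi> x \<ge> 0"
  proof -
    have "\<phi> x - \<psi> x \<le> \<phi> y - \<psi> y" if "y \<in> N" for y
    proof -
      have y: "y \<in> T" using that N by blast
      then have "\<phi> y > 0" using T pos by blast
      moreover have "v y / \<phi> y \<le> \<tau>" unfolding \<tau>_def by (rule mx[OF y])
      ultimately have "v y / \<tau> \<le> \<phi> y" using \<tau> by (simp add: pos_divide_le_eq mult.commute)
      then show ?thesis using vx \<tau> by (simp add: \<psi>v)
    qed
    then show ?thesis
      using vis C2 N T unfolding viscosity_supersolution_def by blast
  qed
  moreover have "pucci lam Lam (H x) = - (lam / t\<^sup>2) * \<phi> x"
  proof -
    have "pucci lam Lam (H x) = (\<Sum>i\<in>UNIV. pucci_weight lam Lam ((1 / (\<tau> * t\<^sup>2)) * (wt i * prof'' w (((1 / t) *\<^sub>R x) $ i))))"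
      unfolding H_def pucci_diagonal by (simp add: c_def power2_eq_square mult_ac)
    also have "\<dots> = (1 / (\<tau> * t\<^sup>2)) * (- lam * v x)"
      using \<tau> t2 x pucci_weight_HU[of "(1 / t) *\<^sub>R x"] unfolding T_iff v_def
      by (subst pucci_weight_mult) (simp_all flip: sum_divide_distrib)
    also have "\<dots> = - (lam / t\<^sup>2) * \<phi> x" using \<tau> t2(3) by (simp add: vx field_simps)
    finally show ?thesis .
  qed
  ultimately have "0 \<le> (lam / t\<^sup>2 - \<mu>) * \<phi> x" by (simp add: algebra_simps)
  moreover have "(lam / t\<^sup>2 - \<mu>) * \<phi> x < 0"
    using \<open>lam / t\<^sup>2 < \<mu>\<close> \<phi>x by (simp add: mult_neg_pos)
  ultimately show False by simp
qed

end

section \<open>The sheared problem in the coordinates of the unsheared domain\<close>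

locale sheared_domain = pucci_domain +
  fixes a :: real
  assumes a: "\<bar>a\<bar> < pi"
begin

definition b :: real where "b = a / pi"

definition s :: real where "s = sqrt (1 - b\<^sup>2)"

definition A :: "real^3^3" where
  "A = vector [vector [1 / s, 0, 0], vector [- b / s, 1, 0], vector [0, 0, 1 / s]]"

lemma b_less: "\<bar>b\<bar> < 1" using a by (simp add: b_def abs_divide)

lemma s: "s > 0" "s\<^sup>2 = 1 - b\<^sup>2"
proof -
  have "b\<^sup>2 < 1" using b_less by (simp add: abs_square_less_1)
  then show "s > 0" "s\<^sup>2 = 1 - b\<^sup>2" by (simp_all add: s_def)
qed

lemma eigenvalue_eq: "lam * pi\<^sup>2 / (pi\<^sup>2 - a\<^sup>2) = lam / s\<^sup>2"
proof -
  have "a\<^sup>2 < pi\<^sup>2" using power_strict_mono[OF a, of 2] by simp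
  then show ?thesis unfolding s(2) b_def by (simp add: field_simps)
qed

lemma shear_eq: "shear a = vector [vector [s, 0, 0], vector [b, 1, 0], vector [0, 0, s]]"
  by (simp add: shear_def s_def b_def Let_def)

lemma shear_inv: "shear a ** A = mat 1" "A ** shear a = mat 1"
  using s(1) unfolding shear_eq A_def
  by (simp_all add: vec_eq_iff forall_3 matrix_matrix_mult_def sum_3 mat_def)

lemma matrix_inv_shear: "matrix_inv (shear a) = A"
  by (rule matrix_inv_eq[OF shear_inv])

lemma Omega_sheared_iff: "x \<in> Omega_sheared w \<gamma> a \<longleftrightarrow> A *v x \<in> Om"
proof -
  have inv: "shear a *v (A *v x) = x" "A *v (shear a *v y) = y" for x y
    by (simp_all add: matrix_vector_mul_assoc shear_inv)
  show ?thesis unfolding Omega_sheared_def Omega_eq_Om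
  proof
    assume "A *v x \<in> Om"
    then have "shear a *v (A *v x) \<in> (\<lambda>p. shear a *v p) ` Om" by (rule imageI)
    then show "x \<in> (\<lambda>p. shear a *v p) ` Om" by (simp only: inv)
  qed (auto simp: inv)
qed

lemma A_nth: "(A *v z) $ i = A $ i \<bullet> z"
  by (simp add: matrix_vector_mult_def inner_vec_def)

text \<open>The scaling of the shear makes the three rows of its inverse equally long. This is why
  every one-dimensional contribution, and so the eigenvalue bound, is multiplied by the same
  \<open>1 / s\<^sup>2\<close>.\<close>

lemma norm_row: "(norm (A $ i))\<^sup>2 = 1 / s\<^sup>2"
proof -
  have "1 / s\<^sup>2 = b\<^sup>2 / s\<^sup>2 + 1" using s by (simp add: field_simps)
  then show ?thesis
    using exhaust_3[of i] unfolding power2_norm_eq_inner A_def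
    by (auto simp: inner_vec_def sum_3 power2_eq_square)
qed

lemma row_inner: "A $ 1 \<bullet> A $ 2 = - b / s\<^sup>2"
  unfolding A_def by (simp add: inner_vec_def sum_3 power2_eq_square)

lemma norm_transpose_A:
  "(norm (transpose A *v v))\<^sup>2 = ((v$1 - b * v$2)\<^sup>2 + s\<^sup>2 * (v$2)\<^sup>2 + (v$3)\<^sup>2) / s\<^sup>2"
  using s(1) unfolding power2_norm_eq_inner A_def
  by (simp add: inner_vec_def sum_3 transpose_def matrix_vector_mult_def power2_eq_square field_simps del: transpose_matrix_vector)

text \<open>The eigenvalues of \<open>A ** transpose A\<close> are \<open>1 / (1 - b)\<close>,
  \<open>1 / (1 + b)\<close> and \<open>1 / s\<^sup>2\<close>, all at least \<open>1 / 2\<close>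
  because \<open>\<bar>b\<bar> < 1\<close>. The proof displays the difference as a sum of
  squares.\<close>

lemma norm_transpose_A_ge: "(norm v)\<^sup>2 / 2 \<le> (norm (transpose A *v v))\<^sup>2"
proof -
  have "s\<^sup>2 * ((v$1)\<^sup>2 + (v$2)\<^sup>2 + (v$3)\<^sup>2) \<le> 2 * ((v$1 - b * v$2)\<^sup>2 + s\<^sup>2 * (v$2)\<^sup>2 + (v$3)\<^sup>2)"
  proof -
    have "2 * ((v$1 - b * v$2)\<^sup>2 + (1 - b\<^sup>2) * (v$2)\<^sup>2 + (v$3)\<^sup>2) - (1 - b\<^sup>2) * ((v$1)\<^sup>2 + (v$2)\<^sup>2 + (v$3)\<^sup>2)
       = (1 - b)\<^sup>2 * (v$1 + v$2)\<^sup>2 / 2 + (1 + b)\<^sup>2 * (v$1 - v$2)\<^sup>2 / 2 + (1 + b\<^sup>2) * (v$3)\<^sup>2"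
      by (simp add: power2_eq_square field_simps)
    also have "0 \<le> \<dots>" by simp
    finally show ?thesis unfolding s(2) by simp
  qed
  moreover have "(norm v)\<^sup>2 = (v$1)\<^sup>2 + (v$2)\<^sup>2 + (v$3)\<^sup>2"
    unfolding power2_norm_eq_inner by (simp add: inner_vec_def sum_3 power2_eq_square)
  ultimately show ?thesis
    unfolding norm_transpose_A using s(1) by (simp add: pos_le_divide_eq mult.commute)
qed

lemma pucci_form_le_diagonal:
  "pucci_form_le lam Lam (\<lambda>z. \<Sum>i\<in>UNIV. d i * ((A *v z) $ i)\<^sup>2) ((\<Sum>i\<in>UNIV. pucci_weight lam Lam (d i)) / s\<^sup>2)"
proof -
  have "pucci_form_le lam Lam (\<lambda>z. d i * (A $ i \<bullet> z)\<^sup>2) (pucci_weight lam Lam (d i) / s\<^sup>2)" for i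
    using pucci_form_le_square[of lam Lam "d i" "A $ i"] by (simp add: norm_row)
  from pucci_form_le_add[OF pucci_form_le_add[OF this[of 1] this[of 2]] this[of 3]]
  show ?thesis by (simp add: sum_3 A_nth add_divide_distrib)
qed

lemma pucci_form_le_gradient:
  "pucci_form_le lam Lam (\<lambda>z. c * (v \<bullet> (A *v z))\<^sup>2) (pucci_weight lam Lam c * (norm (transpose A *v v))\<^sup>2)"
proof -
  have "v \<bullet> (A *v z) = (transpose A *v v) \<bullet> z" for z by (simp add: dot_lmul_matrix)
  then show ?thesis using pucci_form_le_square[of lam Lam c "transpose A *v v"] by simp
qed

lemma sheared_supersolution:
  assumes \<Phi>: "C2_on V \<Phi> g H" "Om \<subseteq> V"
    and u: "\<And>x. A *v x \<in> Om \<Longrightarrow> u x = \<Phi> (A *v x)"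
    and le: "\<And>y. y \<in> Om \<Longrightarrow> pucci_form_le lam Lam (\<lambda>z. (A *v z) \<bullet> (H y *v (A *v z))) (- \<mu> * \<Phi> y)"
  shows "viscosity_supersolution (\<lambda>r X. - (pucci lam Lam X + \<mu> * r)) (Omega_sheared w \<gamma> a) u"
proof (rule classical_imp_viscosity_supersolution[OF lam])
  have "Omega_sheared w \<gamma> a = (\<lambda>x. A *v x) -` Om" using Omega_sheared_iff by blast
  then show "C2_on (Omega_sheared w \<gamma> a) (\<lambda>x. \<Phi> (A *v x)) (\<lambda>x. transpose A *v g (A *v x))
      (\<lambda>x. transpose A ** H (A *v x) ** A)"
    using C2_on_linear[OF C2_on_subset[OF \<Phi>(1) open_Om \<Phi>(2)], of A] by simp
qed (use u le in \<open>simp_all add: Omega_sheared_iff quadratic_form_linear\<close>)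

lemma quadratic_form_HU: "z \<bullet> (HU p *v z) = (\<Sum>i\<in>UNIV. wt i * prof'' w (p $ i) * (z $ i)\<^sup>2)"
  unfolding HU_def by (rule quadratic_form_diagonal)

lemma pucci_form_le_HU:
  assumes "p \<in> cell"
  shows "pucci_form_le lam Lam (\<lambda>z. (A *v z) \<bullet> (HU p *v (A *v z))) (- (lam / s\<^sup>2) * U p)"
  using pucci_form_le_diagonal[of "\<lambda>i. wt i * prof'' w (p $ i)"]
  by (simp add: quadratic_form_HU pucci_weight_HU[OF assms])

lemma u_sheared_eq: "A *v x \<in> Om \<Longrightarrow> u_sheared w \<gamma> a x = U (A *v x)"
  unfolding u_sheared_def matrix_inv_shear by (rule u_fun_eq_U) (simp add: Om_iff)

theorem u_sheared_supersolution:
  "viscosity_supersolution (\<lambda>r X. - (pucci lam Lam X + lam / s\<^sup>2 * r)) (Omega_sheared w \<gamma> a) (u_sheared w \<gamma> a)"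
  by (rule sheared_supersolution[OF C2_U subset_UNIV]) (simp_all add: u_sheared_eq pucci_form_le_HU[simplified] Om_iff)

lemma mu1_plus_ge:
  assumes "viscosity_supersolution (\<lambda>r X. - (pucci lam Lam X + \<mu> * r)) (Omega_sheared w \<gamma> a) u"
    and "\<And>x. A *v x \<in> Om \<Longrightarrow> 0 < u x"
  shows "ereal \<mu> \<le> mu1_plus lam Lam (Omega_sheared w \<gamma> a)"
  unfolding mu1_plus_def using assms Omega_sheared_iff by (intro Sup_upper) blast

theorem mu1_plus_sheared_ge: "ereal (lam / s\<^sup>2) \<le> mu1_plus lam Lam (Omega_sheared w \<gamma> a)"
  by (rule mu1_plus_ge[OF u_sheared_supersolution]) (simp add: u_sheared_eq Om_iff)

end

section \<open>Excess from the shear and gradient bounds\<close>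

text \<open>A hyperbolic rotation of the pair \<open>(p, q)\<close> leaves the form unchanged but shortens both
  vectors unless they are orthogonal.\<close>

lemma pucci_form_le_hyperbolic:
  fixes p q :: "real^'n"
  assumes lam: "0 < lam" "lam \<le> Lam" and p: "p \<noteq> 0"
  shows "pucci_form_le lam Lam (\<lambda>z. (p \<bullet> z)\<^sup>2 - (q \<bullet> z)\<^sup>2)
    (Lam * (norm p)\<^sup>2 - lam * (norm q)\<^sup>2 - (Lam - lam) * ((p \<bullet> q)\<^sup>2 / ((norm p)\<^sup>2 + (norm q)\<^sup>2)))"
proof -
  define N where "N = (norm p)\<^sup>2 + (norm q)\<^sup>2"
  define c where "c = p \<bullet> q"
  \<comment> \<open>To second order in \<open>t\<close>, the rescaled square
    \<open>(norm ?v)\<^sup>2 / (1 - t\<^sup>2)\<close> is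
    \<open>(norm p)\<^sup>2 + 2 * t * c + t\<^sup>2 * N\<close>; this \<open>t\<close> minimises it,
    with gain \<open>c\<^sup>2 / N\<close>.\<close>
  define t where "t = - c / N"
  define k where "k = 1 / (1 - t\<^sup>2)"
  have N: "N > 0" using p by (simp add: N_def add_pos_nonneg)
  have "0 \<le> (norm p - norm q)\<^sup>2" by simp
  then have "norm p * norm q \<le> N / 2" by (simp add: N_def power2_diff)
  then have "\<bar>c\<bar> \<le> N / 2" unfolding c_def using Cauchy_Schwarz_ineq2[of p q] by linarith
  then have "\<bar>t\<bar> \<le> 1 / 2" using N by (simp add: t_def abs_divide divide_simps)
  then have "t\<^sup>2 \<le> (1 / 2)\<^sup>2" by (simp add: abs_le_square_iff[symmetric])
  then have t2: "t\<^sup>2 < 1" by (simp add: power2_eq_square)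
  then have k: "k > 0" by (simp add: k_def)
  let ?v = "p + t *\<^sub>R q" and ?u = "q + t *\<^sub>R p"
  have nv: "(norm ?v)\<^sup>2 = (norm p)\<^sup>2 + 2 * t * c + t\<^sup>2 * (norm q)\<^sup>2"
    and nu: "(norm ?u)\<^sup>2 = (norm q)\<^sup>2 + 2 * t * c + t\<^sup>2 * (norm p)\<^sup>2"
    unfolding power2_norm_eq_inner c_def by (simp_all add: inner_simps inner_commute power2_eq_square)
  have form: "k * (?v \<bullet> z)\<^sup>2 + (- k) * (?u \<bullet> z)\<^sup>2 = (p \<bullet> z)\<^sup>2 - (q \<bullet> z)\<^sup>2" for z
  proof -
    have "(?v \<bullet> z)\<^sup>2 - (?u \<bullet> z)\<^sup>2 = (1 - t\<^sup>2) * ((p \<bullet> z)\<^sup>2 - (q \<bullet> z)\<^sup>2)"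
      by (simp add: inner_simps power2_eq_square algebra_simps)
    then have "k * ((?v \<bullet> z)\<^sup>2 - (?u \<bullet> z)\<^sup>2) = (p \<bullet> z)\<^sup>2 - (q \<bullet> z)\<^sup>2"
      using t2 by (simp add: k_def)
    then show ?thesis by (simp add: algebra_simps)
  qed
  \<comment> \<open>The rotation shortens both vectors by the same squared amount, so the bound
    improves by \<open>Lam - lam\<close> times that amount.\<close>
  have diff: "k * (norm ?v)\<^sup>2 - k * (norm ?u)\<^sup>2 = (norm p)\<^sup>2 - (norm q)\<^sup>2"
  proof -
    have "(norm ?v)\<^sup>2 - (norm ?u)\<^sup>2 = (1 - t\<^sup>2) * ((norm p)\<^sup>2 - (norm q)\<^sup>2)"
      unfolding nv nu by (simp add: algebra_simps)
    then have "k * ((norm ?v)\<^sup>2 - (norm ?u)\<^sup>2) = (norm p)\<^sup>2 - (norm q)\<^sup>2" using t2 by (simp add: k_def)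
    then show ?thesis by (simp add: algebra_simps)
  qed
  have "k * (norm ?v)\<^sup>2 \<le> (norm p)\<^sup>2 - c\<^sup>2 / N"
  proof -
    have "(norm ?v)\<^sup>2 = (1 - t\<^sup>2) * ((norm p)\<^sup>2 - c\<^sup>2 / N) - (c\<^sup>2)\<^sup>2 / N ^ 3"
    proof -
      have q: "(norm q)\<^sup>2 = N - (norm p)\<^sup>2" by (simp add: N_def)
      show ?thesis unfolding nv unfolding q t_def using N
        by (simp add: field_simps power2_eq_square power3_eq_cube)
    qed
    also have "\<dots> \<le> (1 - t\<^sup>2) * ((norm p)\<^sup>2 - c\<^sup>2 / N)" using N by simp
    finally show ?thesis using t2 by (simp add: k_def pos_divide_le_eq mult.commute)
  qed
  then have "(Lam - lam) * (k * (norm ?v)\<^sup>2) \<le> (Lam - lam) * ((norm p)\<^sup>2 - c\<^sup>2 / N)"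
    using lam by (intro mult_left_mono) simp_all
  moreover have "pucci_weight lam Lam k * (norm ?v)\<^sup>2 + pucci_weight lam Lam (- k) * (norm ?u)\<^sup>2
      = (Lam - lam) * (k * (norm ?v)\<^sup>2) + lam * (k * (norm ?v)\<^sup>2 - k * (norm ?u)\<^sup>2)"
    using k by (simp add: pucci_weight_def algebra_simps)
  ultimately have bd: "pucci_weight lam Lam k * (norm ?v)\<^sup>2 + pucci_weight lam Lam (- k) * (norm ?u)\<^sup>2
     \<le> Lam * (norm p)\<^sup>2 - lam * (norm q)\<^sup>2 - (Lam - lam) * (c\<^sup>2 / N)"
    unfolding diff by (simp add: algebra_simps)
  show ?thesis
    by (rule pucci_form_le_mono[OF pucci_form_le_add[OF pucci_form_le_square pucci_form_le_square]
          _ bd[unfolded c_def N_def]]) (simp only: form)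
qed

lemma pucci_weight_le: "0 \<le> lam \<Longrightarrow> lam \<le> Lam \<Longrightarrow> pucci_weight lam Lam c \<le> Lam * \<bar>c\<bar>"
  by (auto simp: pucci_weight_def mult_nonneg_nonpos order_trans[of _ 0] mult_nonneg_nonneg)

context sheared_domain
begin

lemma lam_less_Lam: "lam < Lam"
  using lam w mult_strict_right_mono[of 1 w lam] by (simp add: Lam)

text \<open>The hyperbolic rotation acts on the first two rows scaled by \<open>sqrt d1\<close> and
  \<open>sqrt d2\<close>, whose inner product is nonzero when \<open>b \<noteq> 0\<close>; the third
  row is estimated alone. Since \<open>d1 * d2 / (d1 + d2)\<close> increases in both arguments, the
  lower bounds \<open>\<delta>\<close> and \<open>\<delta>'\<close> suffice.\<close>

lemma pucci_form_le_HU_mixed: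
  assumes p: "p \<in> cell" and d: "0 < \<delta>" "\<delta> \<le> \<gamma> * prof'' w (p $ 1)" "0 < \<delta>'" "\<delta>' \<le> - (\<gamma> * prof'' w (p $ 2))"
  shows "pucci_form_le lam Lam (\<lambda>z. (A *v z) \<bullet> (HU p *v (A *v z)))
    (- (lam / s\<^sup>2) * U p - (Lam - lam) * b\<^sup>2 / s\<^sup>2 * (\<delta> * \<delta>' / (\<delta> + \<delta>')))"
proof -
  define d1 where "d1 = \<gamma> * prof'' w (p $ 1)"
  define d2 where "d2 = - (\<gamma> * prof'' w (p $ 2))"
  have pos: "0 < d1" "0 < d2" "\<delta> \<le> d1" "\<delta>' \<le> d2" using d by (auto simp: d1_def d2_def)
  let ?p = "sqrt d1 *\<^sub>R A $ 1" and ?q = "sqrt d2 *\<^sub>R A $ 2"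
  have n: "(norm ?p)\<^sup>2 = d1 / s\<^sup>2" "(norm ?q)\<^sup>2 = d2 / s\<^sup>2"
    using pos by (simp_all add: power_mult_distrib norm_row)
  have "(?p \<bullet> ?q)\<^sup>2 = d1 * d2 * (b\<^sup>2 / (s\<^sup>2)\<^sup>2)"
    using pos by (simp add: row_inner power_mult_distrib power_divide)
  then have c: "(?p \<bullet> ?q)\<^sup>2 / (d1 / s\<^sup>2 + d2 / s\<^sup>2) = b\<^sup>2 / s\<^sup>2 * (d1 * d2 / (d1 + d2))"
  proof -
    have "d1 * d2 * (B / S\<^sup>2) / (d1 / S + d2 / S) = B / S * (d1 * d2 / (d1 + d2))" if "S > 0" for S B
      using that pos unfolding add_divide_distrib[symmetric] by (simp add: power2_eq_square)
    from this[of "s\<^sup>2" "b\<^sup>2"] show ?thesis unfolding \<open>(?p \<bullet> ?q)\<^sup>2 = _\<close> using s(1) by simp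
  qed
  have "?p \<noteq> 0" using n(1) pos s(1) by auto
  from pucci_form_le_hyperbolic[OF lam this, of ?q, unfolded n c]
  have 12: "pucci_form_le lam Lam (\<lambda>z. (?p \<bullet> z)\<^sup>2 - (?q \<bullet> z)\<^sup>2)
    (Lam * (d1 / s\<^sup>2) - lam * (d2 / s\<^sup>2) - (Lam - lam) * (b\<^sup>2 / s\<^sup>2 * (d1 * d2 / (d1 + d2))))" .
  have 3: "pucci_form_le lam Lam (\<lambda>z. prof'' w (p $ 3) * (A $ 3 \<bullet> z)\<^sup>2) (pucci_weight lam Lam (prof'' w (p $ 3)) / s\<^sup>2)"
    using pucci_form_le_square[of lam Lam "prof'' w (p $ 3)" "A $ 3"] by (simp add: norm_row)
  have "\<delta> * \<delta>' / (\<delta> + \<delta>') \<le> d1 * d2 / (d1 + d2)"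
  proof -
    have "\<delta>' * (\<delta> * d1) \<le> d2 * (\<delta> * d1)" "\<delta> * (\<delta>' * d2) \<le> d1 * (\<delta>' * d2)"
      using pos d by (auto intro!: mult_right_mono)
    then have "\<delta> * \<delta>' * (d1 + d2) \<le> d1 * d2 * (\<delta> + \<delta>')" by (simp add: algebra_simps)
    moreover have "0 < \<delta> + \<delta>'" "0 < d1 + d2" using pos d by auto
    ultimately show ?thesis by (simp add: pos_divide_le_eq pos_le_divide_eq mult.commute)
  qed
  then have E: "(Lam - lam) * b\<^sup>2 / s\<^sup>2 * (\<delta> * \<delta>' / (\<delta> + \<delta>'))
      \<le> (Lam - lam) * (b\<^sup>2 / s\<^sup>2 * (d1 * d2 / (d1 + d2)))"
    using lam mult_left_mono[of "\<delta> * \<delta>' / (\<delta> + \<delta>')" "d1 * d2 / (d1 + d2)" "(Lam - lam) * b\<^sup>2 / s\<^sup>2"]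
    by simp
  have "(\<Sum>i\<in>UNIV. pucci_weight lam Lam (wt i * prof'' w (p $ i)))
      = Lam * d1 - lam * d2 + pucci_weight lam Lam (prof'' w (p $ 3))"
    using pos unfolding sum_3 d1_def d2_def by (simp add: wt_def pucci_weight_def)
  then have U: "- (lam / s\<^sup>2) * U p = (Lam * d1 - lam * d2 + pucci_weight lam Lam (prof'' w (p $ 3))) / s\<^sup>2"
    unfolding pucci_weight_HU[OF p] by (metis mult_minus_left times_divide_eq_left minus_divide_left)
  show ?thesis
  proof (rule pucci_form_le_mono[OF pucci_form_le_add[OF 12 3]])
    fix z
    have "(?p \<bullet> z)\<^sup>2 = d1 * (A $ 1 \<bullet> z)\<^sup>2" "(?q \<bullet> z)\<^sup>2 = d2 * (A $ 2 \<bullet> z)\<^sup>2"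
      using pos by (simp_all add: power_mult_distrib)
    then show "(A *v z) \<bullet> (HU p *v (A *v z)) \<le> ((?p \<bullet> z)\<^sup>2 - (?q \<bullet> z)\<^sup>2) + prof'' w (p $ 3) * (A $ 3 \<bullet> z)\<^sup>2"
      unfolding quadratic_form_HU sum_3 A_nth by (simp add: wt_def d1_def d2_def)
  next
    show "Lam * (d1 / s\<^sup>2) - lam * (d2 / s\<^sup>2) - (Lam - lam) * (b\<^sup>2 / s\<^sup>2 * (d1 * d2 / (d1 + d2)))
        + pucci_weight lam Lam (prof'' w (p $ 3)) / s\<^sup>2
      \<le> - (lam / s\<^sup>2) * U p - (Lam - lam) * b\<^sup>2 / s\<^sup>2 * (\<delta> * \<delta>' / (\<delta> + \<delta>'))"
      using E unfolding U by (simp add: add_divide_distrib diff_divide_distrib)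
  qed
qed

end

section \<open>Level sets of \<open>U\<close> near its maximum and a lower bound for its
  gradient\<close>

context pucci_domain
begin

lemma U_less_U_0:
  assumes "p \<in> cell" "p \<noteq> 0"
  shows "U p < U 0"
proof -
  obtain j where j: "p $ j \<noteq> 0" using assms(2) by (auto simp: vec_eq_iff)
  show ?thesis unfolding U_def
  proof (rule sum_strict_mono_ex1)
    have "prof w (p $ j) < prof w 0"
      using assms j by (intro prof_strict_decreasing) (auto simp: cell_def)
    then show "\<exists>i\<in>UNIV. wt i * prof w (p $ i) < wt i * prof w (0 $ i)"
      using wt_pos[of j] by (intro bexI[of _ j]) auto
    have "prof w (p $ i) \<le> prof w 0" for i
      using assms by (intro prof_decreasing) (auto simp: cell_def)
    then show "\<forall>i\<in>UNIV. wt i * prof w (p $ i) \<le> wt i * prof w (0 $ i)"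
      using wt_pos by (auto intro!: mult_left_mono less_imp_le)
  qed simp
qed

lemma U_le_U_0: "p \<in> cell \<Longrightarrow> U p \<le> U 0"
  using U_less_U_0[of p] by (cases "p = 0") auto

text \<open>By compactness, \<open>U\<close> stays a fixed amount below its maximum outside any ball
  around the origin. The level \<open>u1\<close> later separates the region served by the bump from
  the one served by the gradient.\<close>

lemma U_gap:
  assumes "r > 0"
  obtains u1 where "u1 < U 0" "\<And>p. p \<in> cell \<Longrightarrow> u1 < U p \<Longrightarrow> norm p < r"
proof (cases "cell - ball 0 r = {}")
  case True
  show ?thesis
  proof (rule that[of "U 0 - 1"])
    show "norm p < r" if "p \<in> cell" for p using True that by (auto simp: dist_norm)
  qed simp
next
  case False
  have "compact (cell - ball 0 r)" using compact_cell by (intro compact_diff) auto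
  from continuous_attains_sup[OF this False continuous_on_U]
  obtain q where q: "q \<in> cell - ball 0 r" "\<And>p. p \<in> cell - ball 0 r \<Longrightarrow> U p \<le> U q" by blast
  show ?thesis
  proof (rule that[of "U q"])
    show "U q < U 0" using q(1) assms by (intro U_less_U_0) auto
    show "norm p < r" if "p \<in> cell" "U q < U p" for p
      using q(2)[of p] that by (force simp: dist_norm)
  qed
qed

lemma prof'_sq:
  "\<bar>t\<bar> \<le> alpha \<Longrightarrow> (prof' w t)\<^sup>2 = 1 - (prof w t)\<^sup>2"
  "alpha \<le> \<bar>t\<bar> \<Longrightarrow> (prof' w t)\<^sup>2 = 1 - (prof w t / sqrt w)\<^sup>2"
proof -
  show "(prof' w t)\<^sup>2 = 1 - (prof w t)\<^sup>2" if "\<bar>t\<bar> \<le> alpha"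
    using prof_inner[OF that, of w] by (simp add: sin_squared_eq)
  show "(prof' w t)\<^sup>2 = 1 - (prof w t / sqrt w)\<^sup>2" if "alpha \<le> \<bar>t\<bar>"
  proof -
    have "(prof' w \<bar>t\<bar>)\<^sup>2 = 1 - (prof w \<bar>t\<bar> / sqrt w)\<^sup>2"
      using prof_outer[OF that, of w] sqrt_w by (simp add: cos_squared_eq)
    then show ?thesis by (simp add: abs_if split: if_splits)
  qed
qed

text \<open>Beyond \<open>alpha\<close> the profile exceeds \<open>- sqrt w\<close> by at least the value of \<open>U\<close>, up to the weight.
  This keeps the bound valid near the tips of the domain, where \<open>DU\<close> may vanish on the boundary.\<close>

lemma DU_bound:
  obtains c where "c > 0" "\<And>p. p \<in> Om \<Longrightarrow> c * (U p * (U 0 - U p)) \<le> (norm (DU p))\<^sup>2"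
proof
  define m where "m = min \<gamma> 1"
  \<comment> \<open>With this constant the left side is at most \<open>m * U p / sqrt w\<close> and
    also at most \<open>m * (U 0 - U p)\<close>. The first is shown below the squared gradient when
    some coordinate is outer, the second when all are inner.\<close>
  define c where "c = m / (sqrt w * U 0)"
  have m: "0 < m" "m \<le> wt i" for i using \<gamma>_pos by (auto simp: m_def wt_def)
  have U0: "0 < U 0" using U_0 \<gamma>_pos by simp
  show c: "c > 0" unfolding c_def using m U0 sqrt_w by simp
  fix p assume "p \<in> Om"
  then have p: "p \<in> cell" and Up: "0 < U p" by (auto simp: Om_iff)
  have UU: "U p \<le> U 0" by (rule U_le_U_0[OF p])
  have pL: "\<bar>p $ i\<bar> \<le> L" for i using p by (simp add: cell_def)
  have DU: "(norm (DU p))\<^sup>2 = (\<Sum>i\<in>UNIV. (wt i * prof' w (p $ i))\<^sup>2)"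
    unfolding power2_norm_eq_inner DU_def by (simp add: inner_vec_def power2_eq_square)
  show "c * (U p * (U 0 - U p)) \<le> (norm (DU p))\<^sup>2"
  proof (cases "\<exists>i. alpha < \<bar>p $ i\<bar>")
    case True
    then obtain i where i: "alpha < \<bar>p $ i\<bar>" by blast
    define g where "g = - prof w (p $ i)"
    have "prof w \<bar>p $ i\<bar> \<le> 0" using prof_outer_range[of "\<bar>p $ i\<bar>"] S_pos[OF i pL] sqrt_w i pL[of i] by simp
    then have g: "0 \<le> g" "g \<le> sqrt w" using prof_bounds(2)[OF pL[of i]] by (simp_all add: g_def)
    have "\<gamma> * prof w (p $ j) \<le> \<gamma>" "prof w (p $ j) \<le> 1" for j
      using prof_bounds(1)[OF pL[of j]] \<gamma>_pos by simp_all
    note bd = this[of 1] this[of 2] this[of 3]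
    \<comment> \<open>By \<open>\<gamma>_bounds\<close> the other two coordinates contribute at most
      \<open>wt i * sqrt w\<close>.\<close>
    have "U p \<le> wt i * (sqrt w - g)"
      using bd \<gamma>_bounds exhaust_3[of i] unfolding U_expand wt_def g_def
      by (elim disjE) (simp_all add: algebra_simps)
    then have "m * U p / sqrt w \<le> wt i * (wt i * (sqrt w - g)) / sqrt w"
      using m(2)[of i] m(1) Up sqrt_w by (intro divide_right_mono mult_mono) auto
    also have "\<dots> = (wt i)\<^sup>2 * (1 - g / sqrt w)"
      using sqrt_w by (simp add: power2_eq_square field_simps)
    also have "\<dots> \<le> (wt i)\<^sup>2 * (1 - (g / sqrt w)\<^sup>2)"
    proof (intro mult_left_mono diff_left_mono)
      have "0 \<le> g / sqrt w" "g / sqrt w \<le> 1" using g sqrt_w by (simp_all add: pos_divide_le_eq)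
      then show "(g / sqrt w)\<^sup>2 \<le> g / sqrt w"
        using mult_left_le[of "g / sqrt w" "g / sqrt w"] by (simp only: power2_eq_square)
    qed simp
    also have "\<dots> = (wt i * prof' w (p $ i))\<^sup>2"
      using prof'_sq(2)[of "p $ i"] i by (simp add: power_mult_distrib g_def)
    also have "\<dots> \<le> (norm (DU p))\<^sup>2" unfolding DU by (rule member_le_sum) auto
    finally have "m * U p / sqrt w \<le> (norm (DU p))\<^sup>2" .
    moreover have "c * (U p * (U 0 - U p)) \<le> m * U p / sqrt w"
    proof -
      have "c * (U p * (U 0 - U p)) \<le> c * (U p * U 0)"
        using c Up by (intro mult_left_mono) auto
      also have "\<dots> = m * U p / sqrt w" using U0 by (simp add: c_def)
      finally show ?thesis .
    qed
    ultimately show ?thesis by linarith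
  next
    case False
    then have inn: "\<bar>p $ i\<bar> \<le> alpha" for i by (simp add: not_less)
    have "m * (U 0 - U p) = (\<Sum>i\<in>UNIV. m * (wt i * (1 - prof w (p $ i))))"
      by (simp add: U_def prof_0 sum_distrib_left algebra_simps flip: sum_subtractf)
    also have "\<dots> \<le> (\<Sum>i\<in>UNIV. (wt i * prof' w (p $ i))\<^sup>2)"
    proof (rule sum_mono)
      fix i
      define g where "g = prof w (p $ i)"
      have g: "0 \<le> g" "g \<le> 1"
        using inn[of i] prof_inner[OF inn[of i], of w] cos_ge_zero[of "p $ i"] by (auto simp: g_def abs_le_iff)
      have "m * (wt i * (1 - g)) \<le> wt i * (wt i * (1 - g))"
        using m(2)[of i] m(1) wt_pos[of i] g by (intro mult_right_mono) auto
      also have "\<dots> = (wt i)\<^sup>2 * (1 - g)" by (simp add: power2_eq_square)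
      also have "\<dots> \<le> (wt i)\<^sup>2 * (1 - g\<^sup>2)"
        using g by (intro mult_left_mono diff_left_mono) (auto simp: power2_eq_square mult_left_le)
      also have "\<dots> = (wt i * prof' w (p $ i))\<^sup>2"
        using prof'_sq(1)[OF inn[of i]] by (simp add: power_mult_distrib g_def)
      finally show "m * (wt i * (1 - prof w (p $ i))) \<le> (wt i * prof' w (p $ i))\<^sup>2" by (simp add: g_def)
    qed
    finally have "m * (U 0 - U p) \<le> (norm (DU p))\<^sup>2" by (simp add: DU)
    moreover have "c * (U p * (U 0 - U p)) \<le> m * (U 0 - U p)"
    proof -
      have "c * U p \<le> m"
      proof -
        have "c * U p \<le> c * U 0" using c UU by (intro mult_left_mono) auto
        also have "\<dots> = m / sqrt w" using U0 by (simp add: c_def)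
        also have "\<dots> \<le> m" using m sqrt_w w by (simp add: pos_divide_le_eq)
        finally show ?thesis .
      qed
      then show ?thesis using mult_right_mono[of "c * U p" m "U 0 - U p"] UU by (simp add: mult.assoc)
    qed
    ultimately show ?thesis by linarith
  qed
qed

end

section \<open>The bump function\<close>

definition xmax :: real where "xmax = alpha + 1"

text \<open>A parabola in the variable \<open>exp (2 * t)\<close>, positive exactly between
  \<open>- 1\<close> and \<open>xmax\<close>. A parabola in \<open>t\<close> would peak at
  \<open>alpha / 2\<close>; the exponential moves the peak to within about \<open>ln 2 / 2\<close>
  of \<open>xmax\<close>, hence beyond \<open>alpha + 1 / 2\<close>, into the region of
  excess.\<close>

definition bump :: "real \<Rightarrow> real" where
  "bump t = (exp (2 * t) - exp (- 2)) * (exp (2 * xmax) - exp (2 * t))"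

definition bump' :: "real \<Rightarrow> real" where
  "bump' t = 2 * exp (2 * t) * (exp (2 * xmax) + exp (- 2) - 2 * exp (2 * t))"

definition bump'' :: "real \<Rightarrow> real" where
  "bump'' t = 4 * exp (2 * t) * (exp (2 * xmax) + exp (- 2) - 4 * exp (2 * t))"

definition bump_max :: real where "bump_max = exp (2 * xmax) * exp (2 * xmax)"

lemma DERIV_bump: "DERIV bump t :> bump' t" "DERIV bump' t :> bump'' t"
proof -
  have e: "DERIV (\<lambda>t. exp (2 * t)) t :> 2 * exp (2 * t)" for t :: real
    by (auto intro!: derivative_eq_intros)
  show "DERIV bump t :> bump' t" unfolding bump_def[abs_def] bump'_def
    by (auto intro!: derivative_eq_intros e simp: algebra_simps)
  show "DERIV bump' t :> bump'' t" unfolding bump'_def[abs_def] bump''_def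
    by (auto intro!: derivative_eq_intros e simp: algebra_simps)
qed

lemma continuous_on_bump'': "continuous_on UNIV bump''"
  unfolding bump''_def[abs_def] by (intro continuous_intros)

lemma bump_pos_range: "0 < bump t \<Longrightarrow> - 1 < t \<and> t < xmax"
proof -
  assume "0 < bump t"
  then have "(0 < exp (2 * t) - exp (- 2) \<and> 0 < exp (2 * xmax) - exp (2 * t)) \<or>
      (exp (2 * t) - exp (- 2) < 0 \<and> exp (2 * xmax) - exp (2 * t) < 0)"
    unfolding bump_def by (rule zero_less_mult_iff[THEN iffD1])
  moreover have "- 1 < xmax" unfolding xmax_def using pi_gt_zero by linarith
  ultimately show ?thesis by auto
qed

lemma bump_le:
  assumes "t \<le> xmax"
  shows "bump t \<le> bump_max"
proof -
  have "exp (2 * t) \<le> exp (2 * xmax)" using assms by simp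
  then show ?thesis
    using exp_gt_zero[of "2 * t"] exp_gt_zero[of "- 2"] unfolding bump_def bump_max_def
    by (intro mult_mono) linarith+
qed

lemma bump_0: "0 < bump 0"
  unfolding bump_def xmax_def by (intro mult_pos_pos) (simp_all add: add_pos_pos)

lemma bump'_ge:
  assumes "- 1 \<le> t" "t \<le> alpha + 1 / 2"
  shows "2 * exp (- 4) \<le> bump' t"
proof -
  \<comment> \<open>Bounding \<open>2\<close> by \<open>exp 1\<close> shifts the exponent by
    \<open>1\<close>, so the peak is not reached as long as \<open>1 + 2 * t \<le> 2 * xmax\<close>,
    that is, \<open>t \<le> alpha + 1 / 2\<close>.\<close>
  have "2 * exp (2 * t) \<le> exp 1 * exp (2 * t)"
    using exp_ge_add_one_self[of 1] by (intro mult_right_mono) auto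
  also have "\<dots> = exp (1 + 2 * t)" by (simp add: exp_add)
  also have "\<dots> \<le> exp (2 * xmax)" using assms by (simp add: xmax_def)
  finally have 1: "exp (- 2) \<le> exp (2 * xmax) + exp (- 2) - 2 * exp (2 * t)" by simp
  have "exp (- 4) = exp (- 2) * exp (- 2 :: real)" by (simp flip: exp_add)
  also have "\<dots> \<le> exp (2 * t) * (exp (2 * xmax) + exp (- 2) - 2 * exp (2 * t))"
    using 1 assms by (intro mult_mono) auto
  finally show ?thesis by (simp add: bump'_def)
qed

lemma abs_bump''_le:
  assumes "t \<le> xmax"
  shows "\<bar>bump'' t\<bar> \<le> 24 * bump_max"
proof -
  have e: "exp (2 * t) \<le> exp (2 * xmax)" using assms by simp
  have "exp (- 2) \<le> exp (2 * xmax)" unfolding xmax_def using pi_gt_zero by simp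
  then have "\<bar>exp (2 * xmax) + exp (- 2) - 4 * exp (2 * t)\<bar> \<le> 6 * exp (2 * xmax)"
    using e exp_gt_zero[of "2 * t"] exp_gt_zero[of "- 2"] exp_gt_zero[of "2 * xmax"] by linarith
  then have "(4 * exp (2 * t)) * \<bar>exp (2 * xmax) + exp (- 2) - 4 * exp (2 * t)\<bar>
      \<le> (4 * exp (2 * xmax)) * (6 * exp (2 * xmax))"
    using e by (intro mult_mono) auto
  then show ?thesis by (simp add: bump''_def bump_max_def abs_mult)
qed

lemma bump_max_pos: "0 < bump_max" by (simp add: bump_max_def)

lemma DERIV_glue_power: "DERIV (glue (\<lambda>x. c * x ^ Suc (Suc n))) t :> glue (\<lambda>x. c * real (Suc (Suc n)) * x ^ Suc n) t"
proof (rule DERIV_glue)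
  show "DERIV (\<lambda>x. c * x ^ Suc (Suc n)) t :> c * real (Suc (Suc n)) * t ^ Suc n" for t
    using DERIV_cmult[OF DERIV_pow[of "Suc (Suc n)" t], of c] by (simp add: mult.assoc)
qed simp_all

lemma cos_ge_quadratic: "1 - x\<^sup>2 / 2 \<le> cos (x::real)"
proof -
  have "(sin (x / 2))\<^sup>2 \<le> (x / 2)\<^sup>2" using abs_sin_x_le_abs_x[of "x / 2"] by (simp only: abs_le_square_iff)
  then show ?thesis using cos_double_sin[of "x / 2"] by (simp add: power_divide)
qed

context sheared_domain
begin

text \<open>Tube radius chosen so that the quadratic loss
  \<open>(1 + \<gamma>) * \<rho>\<^sup>2 / 2\<close> of the two transverse profiles is
  \<open>\<rho> / 2\<close>, at most \<open>1 / 2\<close>.\<close>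

definition \<rho> :: real where "\<rho> = 1 / (1 + \<gamma>)"

text \<open>Steep enough that \<open>\<psi>\<close> cannot be positive at transverse distance beyond
  \<open>\<rho>\<close>.\<close>

definition K :: real where "K = bump_max / \<rho>\<^sup>2"

lemma \<rho>: "0 < \<rho>" "\<rho> \<le> 1" "(1 + \<gamma>) * \<rho> = 1"
  using \<gamma>_pos by (simp_all add: \<rho>_def)

lemma K_pos: "0 < K" using \<rho> bump_max_pos by (simp add: K_def)

definition \<psi> :: "real^3 \<Rightarrow> real" where
  "\<psi> p = (\<Sum>i\<in>UNIV. (if i = 1 then bump (p $ i) else - K * (p $ i)\<^sup>2))"

definition D\<psi> :: "real^3 \<Rightarrow> real^3" where
  "D\<psi> p = (\<chi> i. if i = 1 then bump' (p $ i) else - K * (2 * p $ i))"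

definition H\<psi> :: "real^3 \<Rightarrow> real^3^3" where
  "H\<psi> p = (\<chi> i j. if i = j then (if i = 1 then bump'' (p $ i) else - K * 2) else 0)"

lemma \<psi>_expand: "\<psi> p = bump (p $ 1) - K * (p $ 2)\<^sup>2 - K * (p $ 3)\<^sup>2"
  by (simp add: \<psi>_def sum_3)

lemma C2_\<psi>: "C2_on UNIV \<psi> D\<psi> H\<psi>"
proof -
  have d: "DERIV (\<lambda>t. if i = 1 then bump t else - K * t\<^sup>2) t :> (if i = 1 then bump' t else - K * (2 * t))"
    "DERIV (\<lambda>t. if i = 1 then bump' t else - K * (2 * t)) t :> (if i = 1 then bump'' t else - K * 2)"
    "continuous_on UNIV (\<lambda>t. if i = 1 then bump'' t else - K * 2)" for i :: 3 and t
    by (cases "i = 1"; auto intro!: derivative_eq_intros DERIV_bump continuous_on_bump'')+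
  show ?thesis
    unfolding \<psi>_def[abs_def] D\<psi>_def[abs_def] H\<psi>_def[abs_def]
    by (rule C2_on_separable[OF d])
qed

lemma \<psi>_pos:
  assumes "0 < \<psi> p"
  shows "- 1 < p $ 1" "p $ 1 < xmax" "\<bar>p $ 2\<bar> \<le> \<rho>" "\<bar>p $ 3\<bar> \<le> \<rho>" "\<psi> p \<le> bump_max"
proof -
  have n: "0 \<le> K * (p $ 2)\<^sup>2" "0 \<le> K * (p $ 3)\<^sup>2" using K_pos by simp_all
  then have b: "0 < bump (p $ 1)" using assms unfolding \<psi>_expand by linarith
  from bump_pos_range[OF this] show r: "- 1 < p $ 1" "p $ 1 < xmax" by auto
  have m: "bump (p $ 1) \<le> bump_max" using r by (intro bump_le) simp
  then show "\<psi> p \<le> bump_max" using n unfolding \<psi>_expand by linarith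
  have "K * (p $ 2)\<^sup>2 \<le> bump_max" "K * (p $ 3)\<^sup>2 \<le> bump_max"
    using n m assms unfolding \<psi>_expand by linarith+
  then have "(p $ 2)\<^sup>2 \<le> \<rho>\<^sup>2" "(p $ 3)\<^sup>2 \<le> \<rho>\<^sup>2"
    using bump_max_pos \<rho> by (simp_all add: K_def divide_simps)
  then show "\<bar>p $ 2\<bar> \<le> \<rho>" "\<bar>p $ 3\<bar> \<le> \<rho>" using \<rho> by (auto intro: power2_le_imp_le)
qed

lemma \<psi>_0: "0 < \<psi> 0" using bump_0 by (simp add: \<psi>_expand)

text \<open>On the tube the first profile is at least \<open>- 1\<close>, because
  \<open>sqrt w * sin (1 / sqrt w) \<le> 1\<close>, and the other two are cosines of small angles.
  The bound lets a small multiple of the bump be subtracted while the supersolution stays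
  positive.\<close>

lemma U_ge_half:
  assumes "0 < \<psi> p"
  shows "1 / 2 \<le> U p"
proof -
  note p = \<psi>_pos[OF assms]
  have x: "0 < xmax" "alpha \<le> xmax" "xmax \<le> L"
    using L pi_gt_zero unfolding xmax_def by linarith+
  have "1 < xmax" unfolding xmax_def using pi_gt_zero by linarith
  then have "\<bar>p $ 1\<bar> \<le> \<bar>xmax\<bar>" using p by linarith
  then have "prof w xmax \<le> prof w (p $ 1)" using x by (intro prof_decreasing) auto
  moreover have "- 1 \<le> prof w xmax"
  proof -
    have "sin (1 / sqrt w) \<le> 1 / sqrt w" using sqrt_w by (intro sin_x_le_x) simp
    then have "sqrt w * sin (1 / sqrt w) \<le> 1" using sqrt_w by (simp add: pos_le_divide_eq mult.commute)
    then show ?thesis using prof_outer(1)[OF x(2), of w] by (simp add: xmax_def)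
  qed
  ultimately have 1: "- 1 \<le> prof w (p $ 1)" by linarith
  have in_range: "\<bar>t\<bar> \<le> alpha" if "\<bar>t\<bar> \<le> \<rho>" for t using that \<rho>(2) pi_gt3 by linarith
  have cs: "1 - \<rho>\<^sup>2 / 2 \<le> prof w t" if "\<bar>t\<bar> \<le> \<rho>" for t
  proof -
    have "t\<^sup>2 \<le> \<rho>\<^sup>2" using that \<rho> by (simp add: abs_le_square_iff[symmetric])
    then show ?thesis using cos_ge_quadratic[of t] prof_inner(1)[OF in_range[OF that], of w] by simp
  qed
  have "\<gamma> * (- 1) \<le> \<gamma> * prof w (p $ 1)" "\<gamma> * (1 - \<rho>\<^sup>2 / 2) \<le> \<gamma> * prof w (p $ 2)"
    using mult_left_mono[OF 1, of \<gamma>] mult_left_mono[OF cs[OF p(3)], of \<gamma>] \<gamma>_pos by simp_all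
  then have "\<gamma> * (- 1) + \<gamma> * (1 - \<rho>\<^sup>2 / 2) + (1 - \<rho>\<^sup>2 / 2) \<le> U p"
    using cs[OF p(4)] unfolding U_expand by linarith
  moreover have "\<gamma> * (- 1) + \<gamma> * (1 - \<rho>\<^sup>2 / 2) + (1 - \<rho>\<^sup>2 / 2) = 1 - ((1 + \<gamma>) * \<rho>) * \<rho> / 2"
    by (simp add: power2_eq_square algebra_simps)
  ultimately show ?thesis using \<rho> by simp
qed

text \<open>To the right of \<open>alpha + 1 / 2\<close> the support of the bump lies where the first two second
  derivatives of \<open>U\<close> have opposite signs, so the shear produces a definite excess there.\<close>

lemma excess:
  assumes "b \<noteq> 0"
  obtains E where "0 < E"
    "\<And>p. p \<in> cell \<Longrightarrow> 0 < \<psi> p \<Longrightarrow> alpha + 1 / 2 < p $ 1 \<Longrightarrow>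
      pucci_form_le lam Lam (\<lambda>z. (A *v z) \<bullet> (HU p *v (A *v z))) (- (lam / s\<^sup>2) * U p - E)"
proof -
  \<comment> \<open>Bounds for the sizes of the two second derivatives: the first is smallest at
    distance \<open>1 / 2\<close> beyond \<open>alpha\<close>, the second is bounded below by its
    value at \<open>1\<close>, as \<open>\<rho> \<le> 1\<close>.\<close>
  define \<delta> where "\<delta> = \<gamma> * (sin (1 / (2 * sqrt w)) / sqrt w)"
  define \<delta>' where "\<delta>' = \<gamma> * cos 1"
  have ang: "0 < 1 / (2 * sqrt w)" "1 / (2 * sqrt w) \<le> 1 / 2" "1 / sqrt w \<le> 1 / 2"
    using sqrt_w w by (simp_all add: divide_simps)
  have "0 < sin (1 / (2 * sqrt w))" using ang pi_gt3 by (intro sin_gt_zero) linarith+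
  then have \<delta>: "0 < \<delta>" unfolding \<delta>_def using \<gamma>_pos sqrt_w by simp
  have "0 < cos (1::real)" using pi_gt3 by (intro cos_gt_zero_pi) linarith+
  then have \<delta>': "0 < \<delta>'" unfolding \<delta>'_def using \<gamma>_pos by simp
  show ?thesis
  proof (rule that[of "(Lam - lam) * b\<^sup>2 / s\<^sup>2 * (\<delta> * \<delta>' / (\<delta> + \<delta>'))"])
    show "0 < (Lam - lam) * b\<^sup>2 / s\<^sup>2 * (\<delta> * \<delta>' / (\<delta> + \<delta>'))"
      using \<delta> \<delta>' lam_less_Lam s(1) assms by simp
    fix p assume p: "p \<in> cell" "0 < \<psi> p" "alpha + 1 / 2 < p $ 1"
    note q = \<psi>_pos[OF p(2)]
    have "alpha \<le> p $ 1" using p(3) by linarith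
    have "\<delta> \<le> \<gamma> * prof'' w (p $ 1)"
    proof -
      have "1 / (2 * sqrt w) \<le> (p $ 1 - alpha) / sqrt w" "(p $ 1 - alpha) / sqrt w \<le> 1 / sqrt w"
        using divide_right_mono[of "1 / 2" "p $ 1 - alpha" "sqrt w"]
          divide_right_mono[of "p $ 1 - alpha" 1 "sqrt w"] p(3) q(2) sqrt_w by (simp_all add: xmax_def)
      then have "sin (1 / (2 * sqrt w)) \<le> S (p $ 1)"
        using ang pi_gt3 by (intro sin_monotone_2pi_le) linarith+
      then show ?thesis unfolding \<delta>_def prof_outer(3)[OF \<open>alpha \<le> p $ 1\<close>]
        using \<gamma>_pos sqrt_w by (intro mult_left_mono divide_right_mono) auto
    qed
    moreover have "\<delta>' \<le> - (\<gamma> * prof'' w (p $ 2))"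
    proof -
      have "\<bar>p $ 2\<bar> \<le> 1" "\<bar>p $ 2\<bar> \<le> alpha" using q(3) \<rho>(2) pi_gt3 by linarith+
      then have "cos 1 \<le> cos \<bar>p $ 2\<bar>" using pi_gt3 by (intro cos_monotone_0_pi_le) linarith+
      then show ?thesis using prof_inner(3)[OF \<open>\<bar>p $ 2\<bar> \<le> alpha\<close>, of w] \<gamma>_pos
        by (simp add: \<delta>'_def)
    qed
    ultimately show "pucci_form_le lam Lam (\<lambda>z. (A *v z) \<bullet> (HU p *v (A *v z)))
       (- (lam / s\<^sup>2) * U p - (Lam - lam) * b\<^sup>2 / s\<^sup>2 * (\<delta> * \<delta>' / (\<delta> + \<delta>')))"
      using \<delta> \<delta>' by (intro pucci_form_le_HU_mixed p(1))
  qed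
qed

text \<open>The power is at least three, so the cut-off at \<open>0\<close> is
  \<open>C\<^sup>2\<close>. For positive arguments \<open>\<omega>'' / \<omega>'\<close> equals
  \<open>(n + 2) / x\<close>, so a large \<open>n\<close> favours the squared gradient of
  \<open>\<psi>\<close> over its Hessian.\<close>

definition \<omega> :: "nat \<Rightarrow> real \<Rightarrow> real" where "\<omega> n = glue (\<lambda>x. x ^ (n + 3))"

definition \<omega>' :: "nat \<Rightarrow> real \<Rightarrow> real" where "\<omega>' n = glue (\<lambda>x. real (n + 3) * x ^ (n + 2))"

definition \<omega>'' :: "nat \<Rightarrow> real \<Rightarrow> real" where
  "\<omega>'' n = glue (\<lambda>x. real (n + 3) * real (n + 2) * x ^ (n + 1))"

lemma DERIV_\<omega>: "DERIV (\<omega> n) t :> \<omega>' n t" "DERIV (\<omega>' n) t :> \<omega>'' n t"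
  using DERIV_glue_power[of 1 "Suc n" t] DERIV_glue_power[of "real (n + 3)" n t]
  by (simp_all add: \<omega>_def \<omega>'_def \<omega>''_def eval_nat_numeral)

lemma continuous_on_\<omega>'': "continuous_on UNIV (\<omega>'' n)"
  unfolding \<omega>''_def by (intro continuous_on_glue continuous_intros) simp

lemma quadratic_form_H\<psi>: "z \<bullet> (H\<psi> p *v z) = (\<Sum>i\<in>UNIV. (if i = 1 then bump'' (p $ i) else - K * 2) * (z $ i)\<^sup>2)"
  unfolding H\<psi>_def by (rule quadratic_form_diagonal)

text \<open>The Hessian of \<open>- \<omega> n \<circ> \<psi>\<close>: for large \<open>n\<close> the rank-one term dominates wherever
  \<open>D\<psi>\<close> is bounded away from zero.\<close>

lemma barrier:
  obtains n C where "0 < C"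
    "\<And>p. pucci_form_le lam Lam (\<lambda>z. - (\<omega>'' n (\<psi> p) * (D\<psi> p \<bullet> (A *v z))\<^sup>2 + \<omega>' n (\<psi> p) * ((A *v z) \<bullet> (H\<psi> p *v (A *v z)))))
      (if 0 < \<psi> p \<and> alpha + 1 / 2 < p $ 1 then C else 0)"
proof -
  \<comment> \<open>Bound for the Hessian of \<open>- \<psi>\<close> on the tube:
    \<open>24 * bump_max\<close> from the bump, \<open>2 * K\<close> from each transverse
    square.\<close>
  define C1 where "C1 = (Lam * (24 * bump_max) + 4 * K * Lam) / s\<^sup>2"
  have C1: "0 < C1" unfolding C1_def using bump_max_pos K_pos lam s(1)
    by (intro divide_pos_pos add_pos_pos mult_pos_pos) auto
  \<comment> \<open>Left of \<open>alpha + 1 / 2\<close> the sheared squared gradient is at least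
    \<open>(2 * exp (- 4))\<^sup>2 / 2 = 2 * exp (- 8)\<close>, the \<open>1 / 2\<close> coming from
    \<open>norm_transpose_A_ge\<close>.\<close>
  obtain n :: nat where n: "C1 * bump_max / (lam * (2 * exp (- 8))) < real n"
    using reals_Archimedean2 by blast
  have n': "C1 * bump_max \<le> real (n + 2) * (lam * (2 * exp (- 8)))"
  proof -
    have "C1 * bump_max \<le> real n * (lam * (2 * exp (- 8)))"
      using n lam by (simp add: pos_divide_less_eq)
    also have "\<dots> \<le> real (n + 2) * (lam * (2 * exp (- 8)))" using lam by (intro mult_right_mono) auto
    finally show ?thesis .
  qed
  define C where "C = real (n + 3) * bump_max ^ (n + 1) * (bump_max * C1)"
  show ?thesis
  proof (rule that[of C n])
    show "0 < C" unfolding C_def using bump_max_pos C1 by simp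
    fix p
    let ?Q = "\<lambda>z. - (\<omega>'' n (\<psi> p) * (D\<psi> p \<bullet> (A *v z))\<^sup>2 + \<omega>' n (\<psi> p) * ((A *v z) \<bullet> (H\<psi> p *v (A *v z))))"
    show "pucci_form_le lam Lam ?Q (if 0 < \<psi> p \<and> alpha + 1 / 2 < p $ 1 then C else 0)"
    proof (cases "0 < \<psi> p")
      case False
      then have "\<omega>'' n (\<psi> p) = 0" "\<omega>' n (\<psi> p) = 0" by (auto simp: \<omega>'_def \<omega>''_def glue_def)
      then show ?thesis using pucci_form_le_square[of lam Lam 0 0] False
        by (simp add: pucci_weight_def)
    next
      case True
      note q = \<psi>_pos[OF True]
      define x where "x = \<psi> p"
      define D where "D = (norm (transpose A *v D\<psi> p))\<^sup>2"
      \<comment> \<open>The common factor: \<open>\<omega>'\<close> is \<open>f * x\<close> and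
        \<open>\<omega>''\<close> is \<open>f * (n + 2)\<close>, so only the sign of
        \<open>x * C1 - (n + 2) * lam * D\<close> matters.\<close>
      define f where "f = real (n + 3) * x ^ (n + 1)"
      have x: "0 < x" "x \<le> bump_max" using True q by (auto simp: x_def)
      have f: "0 < f" "f \<le> real (n + 3) * bump_max ^ (n + 1)"
        using x power_mono[of x bump_max "n + 1"] unfolding f_def by (auto intro!: mult_left_mono)
      have w1: "\<omega>' n (\<psi> p) = f * x" and w2: "\<omega>'' n (\<psi> p) = f * real (n + 2)"
        using x by (simp_all add: \<omega>'_def \<omega>''_def glue_def f_def flip: x_def)
      let ?e = "\<lambda>i::3. - (if i = 1 then bump'' (p $ i) else - K * 2)"
      have 1: "pucci_form_le lam Lam (\<lambda>z. - (f * real (n + 2)) * (D\<psi> p \<bullet> (A *v z))\<^sup>2) (- (f * real (n + 2)) * lam * D)"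
      proof -
        have "pucci_weight lam Lam (- (f * real (n + 2))) = - (f * real (n + 2)) * lam"
          using mult_pos_pos[OF f(1), of "real (n + 2)"] by (subst pucci_weight_def) simp
        then show ?thesis using pucci_form_le_gradient[of "- (f * real (n + 2))" "D\<psi> p"] by (simp add: D_def)
      qed
      have 2: "pucci_form_le lam Lam (\<lambda>z. (f * x) * (\<Sum>i\<in>UNIV. ?e i * ((A *v z) $ i)\<^sup>2)) ((f * x) * C1)"
      proof (rule pucci_form_le_scale)
        have "(\<Sum>i\<in>UNIV. pucci_weight lam Lam (?e i)) \<le> Lam * (24 * bump_max) + 4 * K * Lam"
        proof -
          have "pucci_weight lam Lam (?e 1) \<le> Lam * \<bar>bump'' (p $ 1)\<bar>"
            using pucci_weight_le[of lam Lam "- bump'' (p $ 1)"] lam by simp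
          also have "\<dots> \<le> Lam * (24 * bump_max)" using abs_bump''_le[of "p $ 1"] q lam by (intro mult_left_mono) auto
          finally have "pucci_weight lam Lam (?e 1) \<le> Lam * (24 * bump_max)" .
          moreover have "pucci_weight lam Lam (?e 2) = 2 * K * Lam" "pucci_weight lam Lam (?e 3) = 2 * K * Lam"
            using K_pos by (simp_all add: pucci_weight_def)
          ultimately show ?thesis unfolding sum_3 by linarith
        qed
        then have "(\<Sum>i\<in>UNIV. pucci_weight lam Lam (?e i)) / s\<^sup>2 \<le> C1"
          unfolding C1_def by (rule divide_right_mono) simp
        then show "pucci_form_le lam Lam (\<lambda>z. \<Sum>i\<in>UNIV. ?e i * ((A *v z) $ i)\<^sup>2) C1"
          by (rule pucci_form_le_mono[OF pucci_form_le_diagonal order_refl])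
        show "0 \<le> f * x" using f x by simp
      qed
      have Q: "?Q z \<le> - (f * real (n + 2)) * (D\<psi> p \<bullet> (A *v z))\<^sup>2 + (f * x) * (\<Sum>i\<in>UNIV. ?e i * ((A *v z) $ i)\<^sup>2)" for z
        unfolding w1 w2 quadratic_form_H\<psi> by (simp add: sum_3 algebra_simps)
      have b: "- (f * real (n + 2)) * lam * D + (f * x) * C1 = f * (x * C1 - real (n + 2) * (lam * D))"
        by (simp add: algebra_simps)
      have "f * (x * C1 - real (n + 2) * (lam * D)) \<le> (if 0 < \<psi> p \<and> alpha + 1 / 2 < p $ 1 then C else 0)"
      proof (cases "alpha + 1 / 2 < p $ 1")
        case True
        have "0 \<le> real (n + 2) * (lam * D)" using lam by (simp add: D_def)
        moreover have "x * C1 \<le> bump_max * C1" using x C1 by (intro mult_right_mono) auto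
        ultimately have "f * (x * C1 - real (n + 2) * (lam * D)) \<le> f * (bump_max * C1)"
          using f by (intro mult_left_mono) auto
        also have "\<dots> \<le> C" unfolding C_def using f bump_max_pos C1 by (intro mult_right_mono) auto
        finally show ?thesis using True \<open>0 < \<psi> p\<close> by simp
      next
        case False
        have "2 * exp (- 4) \<le> D\<psi> p $ 1" using bump'_ge[of "p $ 1"] False q by (simp add: D\<psi>_def)
        then have "(2 * exp (- 4))\<^sup>2 \<le> (D\<psi> p $ 1)\<^sup>2" by (intro power_mono) auto
        also have "\<dots> \<le> (norm (D\<psi> p))\<^sup>2"
          using component_le_norm_cart[of "D\<psi> p" 1] by (simp add: abs_le_square_iff[symmetric])
        also have "\<dots> \<le> 2 * D" using norm_transpose_A_ge[of "D\<psi> p"] by (simp add: D_def)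
        finally have "(2 * exp (- 4))\<^sup>2 \<le> 2 * D" .
        moreover have "(2 * exp (- 4 :: real))\<^sup>2 = 2 * (2 * exp (- 8))"
          by (simp add: power2_eq_square flip: exp_add)
        ultimately have "2 * exp (- 8) \<le> D" by linarith
        then have "real (n + 2) * (lam * (2 * exp (- 8))) \<le> real (n + 2) * (lam * D)"
          using lam by (intro mult_left_mono) auto
        with n' have "C1 * bump_max \<le> real (n + 2) * (lam * D)" by (rule order_trans)
        moreover have "x * C1 \<le> C1 * bump_max"
          using x C1 by (subst mult.commute) (intro mult_left_mono, auto)
        ultimately have "x * C1 - real (n + 2) * (lam * D) \<le> 0" by (simp only: diff_le_0_iff_le order_trans)
        then show ?thesis using f False by (simp add: mult_nonneg_nonpos)
      qed
      then show ?thesis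
        by (intro pucci_form_le_mono[OF pucci_form_le_add[OF 1 2] Q]) (simp only: b)
    qed
  qed
qed

end

section \<open>The strict inequality\<close>

context sheared_domain
begin

text \<open>The supersolution is \<open>U - \<kappa> * (exp (\<beta> * U) - 1) - \<epsilon> * \<omega> n \<circ> \<psi>\<close>. The second term gains wherever
  \<open>DU\<close> does not vanish, in particular near the boundary, and loses near the origin. The bump
  gains near the origin and loses only inside the region covered by lemma \<open>excess\<close>. Hence
  \<open>\<kappa>\<close> is chosen small relative to \<open>\<epsilon>\<close>.\<close>

theorem mu1_plus_sheared_gt:
  assumes b: "b \<noteq> 0"
  shows "ereal (lam / s\<^sup>2) < mu1_plus lam Lam (Omega_sheared w \<gamma> a)"
proof -
  define m where "m = lam / s\<^sup>2"
  define um where "um = U 0"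
  have m: "0 < m" using lam s(1) by (simp add: m_def)
  have um: "0 < um" using U_0 \<gamma>_pos by (simp add: um_def)
  obtain E where E: "0 < E"
    and ex: "\<And>p. p \<in> cell \<Longrightarrow> 0 < \<psi> p \<Longrightarrow> alpha + 1 / 2 < p $ 1 \<Longrightarrow>
      pucci_form_le lam Lam (\<lambda>z. (A *v z) \<bullet> (HU p *v (A *v z))) (- m * U p - E)"
    by (rule excess[OF b, folded m_def]) (rule that; blast)
  obtain c where c: "c > 0" and DU: "\<And>p. p \<in> Om \<Longrightarrow> c * (U p * (um - U p)) \<le> (norm (DU p))\<^sup>2"
    by (rule DU_bound[folded um_def]) (rule that; blast)
  obtain n C where C: "0 < C"
    and bar: "\<And>p. pucci_form_le lam Lam (\<lambda>z. - (\<omega>'' n (\<psi> p) * (D\<psi> p \<bullet> (A *v z))\<^sup>2 + \<omega>' n (\<psi> p) * ((A *v z) \<bullet> (H\<psi> p *v (A *v z)))))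
      (if 0 < \<psi> p \<and> alpha + 1 / 2 < p $ 1 then C else 0)"
    by (rule barrier) (rule that; blast)
  have "continuous_on UNIV \<psi>" using C2_on_imp_continuous_on[OF C2_\<psi>] by simp
  then have "open {p. \<psi> 0 / 2 < \<psi> p}" by (intro open_Collect_less) auto
  then obtain r where r: "0 < r" "ball 0 r \<subseteq> {p. \<psi> 0 / 2 < \<psi> p}"
    by (rule openE[of _ 0]) (use \<psi>_0 in auto)
  obtain u1 where u1: "u1 < um" "\<And>p. p \<in> cell \<Longrightarrow> u1 < U p \<Longrightarrow> norm p < r"
    by (rule U_gap[OF r(1), folded um_def]) (rule that; blast)
  define w0 where "w0 = (\<psi> 0 / 2) ^ (n + 3)"
  have w0: "0 < w0" using \<psi>_0 by (simp add: w0_def)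
  have near: "w0 \<le> \<omega> n (\<psi> p)" if "p \<in> cell" "u1 < U p" for p
  proof -
    have "p \<in> ball 0 r" using u1(2)[OF that] by simp
    then have "\<psi> 0 / 2 < \<psi> p" using r(2) by blast
    then show ?thesis using \<psi>_0 unfolding w0_def \<omega>_def glue_def by (auto intro!: power_mono)
  qed
  define Cw where "Cw = bump_max ^ (n + 3)"
  have Cw: "0 < Cw" using bump_max_pos by (simp add: Cw_def)
  have \<omega>_nonneg: "0 \<le> \<omega> n t" for t by (simp add: \<omega>_def glue_def)
  have \<omega>_le: "\<omega> n (\<psi> p) \<le> Cw" if "0 < \<psi> p" for p
    using that \<psi>_pos(5)[OF that] unfolding \<omega>_def glue_def Cw_def by (auto intro!: power_mono)
  \<comment> \<open>Where \<open>u \<le> u1\<close> the gradient gain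
    \<open>\<beta> * lam * P\<close> is then at least \<open>(m + 1) * u\<close>, which covers the
    loss \<open>m * u\<close> and leaves \<open>u\<close>.\<close>
  define \<beta> where "\<beta> = (m + 1) / (lam * (c / 2) * (um - u1))"
  have \<beta>: "0 < \<beta>" unfolding \<beta>_def using m lam c u1 by (intro divide_pos_pos mult_pos_pos) auto
  have \<beta>_eq: "\<beta> * lam * (c / 2) * (um - u1) = m + 1"
  proof -
    have "0 < lam * (c / 2) * (um - u1)" using lam c u1 by (intro mult_pos_pos) auto
    moreover have "x / Z * Z = x" if "0 < Z" for x Z :: real using that by simp
    ultimately have "\<beta> * (lam * (c / 2) * (um - u1)) = m + 1" unfolding \<beta>_def by blast
    then show ?thesis by (simp only: mult.assoc)
  qed
  \<comment> \<open>The first bound keeps the subtracted bump below \<open>U / 4\<close> on the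
    tube, where \<open>U \<ge> 1 / 2\<close>; the second keeps the loss of the barrier below
    \<open>E / 8\<close>.\<close>
  define \<epsilon> where "\<epsilon> = min (1 / (8 * Cw)) (E / (8 * C))"
  have \<epsilon>: "0 < \<epsilon>" "\<epsilon> * Cw \<le> 1 / 8" "\<epsilon> * C \<le> E / 8"
  proof -
    show "0 < \<epsilon>" using Cw E C by (simp add: \<epsilon>_def)
    have "\<epsilon> \<le> 1 / (8 * Cw)" "\<epsilon> \<le> E / (8 * C)" by (simp_all add: \<epsilon>_def)
    then show "\<epsilon> * Cw \<le> 1 / 8" "\<epsilon> * C \<le> E / 8"
      using Cw C by (simp_all add: pos_le_divide_eq mult.commute mult.left_commute)
  qed
  define G where "G = \<beta> * exp (\<beta> * um)"
  have G: "0 < G" using \<beta> by (simp add: G_def)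
  define CV where "CV = G * (m * um)"
  have CV: "0 < CV" using G m um by (simp add: CV_def)
  \<comment> \<open>\<open>1 / (2 * G)\<close> ensures \<open>h' \<ge> 1 / 2\<close>. The other
    bounds keep the loss \<open>\<kappa> * CV\<close> of the exponential term below
    \<open>E / 8\<close> and below half of the gain \<open>m * \<epsilon> * w0\<close> that the bump
    provides near the origin.\<close>
  define \<kappa> where "\<kappa> = min (1 / (2 * G)) (min (E / (8 * CV)) (m * \<epsilon> * w0 / (2 * CV)))"
  have \<kappa>: "0 < \<kappa>" "\<kappa> * G \<le> 1 / 2" "\<kappa> * CV \<le> E / 8" "\<kappa> * CV \<le> m * \<epsilon> * w0 / 2"
  proof -
    show "0 < \<kappa>" using G E CV m \<epsilon> w0 by (simp add: \<kappa>_def)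
    have "\<kappa> \<le> 1 / (2 * G)" "\<kappa> \<le> E / (8 * CV)" "\<kappa> \<le> m * \<epsilon> * w0 / (2 * CV)"
      unfolding \<kappa>_def by linarith+
    then show "\<kappa> * G \<le> 1 / 2" "\<kappa> * CV \<le> E / 8" "\<kappa> * CV \<le> m * \<epsilon> * w0 / 2"
      using G CV by (simp_all add: pos_le_divide_eq mult.commute mult.left_commute)
  qed
  \<comment> \<open>The increase of the eigenvalue is paid from what remains in each region: the
    gradient gain, the excess, and the other half of the bump gain.\<close>
  define \<eta> where "\<eta> = min (\<kappa> * \<beta>) (min (E / (8 * um)) (m * \<epsilon> * w0 / (2 * um)))"
  have \<eta>: "0 < \<eta>" "\<eta> \<le> \<kappa> * \<beta>" "\<eta> * um \<le> E / 8" "\<eta> * um \<le> m * \<epsilon> * w0 / 2"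
  proof -
    show "0 < \<eta>" "\<eta> \<le> \<kappa> * \<beta>" using \<kappa> \<beta> E um m \<epsilon> w0 by (simp_all add: \<eta>_def)
    have "\<eta> \<le> E / (8 * um)" "\<eta> \<le> m * \<epsilon> * w0 / (2 * um)" unfolding \<eta>_def by linarith+
    then show "\<eta> * um \<le> E / 8" "\<eta> * um \<le> m * \<epsilon> * w0 / 2"
      using um by (simp_all add: pos_le_divide_eq mult.commute mult.left_commute)
  qed
  define h where "h u = u - \<kappa> * (exp (\<beta> * u) - 1)" for u :: real
  define h' where "h' u = 1 - \<kappa> * (\<beta> * exp (\<beta> * u))" for u :: real
  define h'' where "h'' u = - \<kappa> * (\<beta> * (\<beta> * exp (\<beta> * u)))" for u :: real
  have h: "DERIV h u :> h' u" "DERIV h' u :> h'' u" for u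
    unfolding h_def[abs_def] h'_def[abs_def] h''_def by (auto intro!: derivative_eq_intros simp: mult_ac)
  have ch: "continuous_on UNIV h''" unfolding h''_def[abs_def] by (intro continuous_intros)
  define \<Phi> where "\<Phi> p = h (U p) + (- \<epsilon>) * \<omega> n (\<psi> p)" for p
  define H where "H p = (\<chi> i j. h'' (U p) * (DU p $ i * DU p $ j) + h' (U p) * HU p $ i $ j) +
     (- \<epsilon>) *\<^sub>R (\<chi> i j. \<omega>'' n (\<psi> p) * (D\<psi> p $ i * D\<psi> p $ j) + \<omega>' n (\<psi> p) * H\<psi> p $ i $ j)" for p
  have C2: "C2_on UNIV \<Phi> (\<lambda>p. h' (U p) *\<^sub>R DU p + (- \<epsilon>) *\<^sub>R (\<omega>' n (\<psi> p) *\<^sub>R D\<psi> p)) H"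
    unfolding \<Phi>_def[abs_def] H_def[abs_def]
    by (intro C2_on_add C2_on_cmult C2_on_compose_real[OF C2_U h ch]
        C2_on_compose_real[OF C2_\<psi> DERIV_\<omega> continuous_on_\<omega>''])
  have form: "z \<bullet> (H p *v z) = (h'' (U p) * (DU p \<bullet> z)\<^sup>2 + h' (U p) * (z \<bullet> (HU p *v z)))
      + \<epsilon> * (- (\<omega>'' n (\<psi> p) * (D\<psi> p \<bullet> z)\<^sup>2 + \<omega>' n (\<psi> p) * (z \<bullet> (H\<psi> p *v z))))" for z p
    unfolding H_def matrix_vector_mult_add_rdistrib scaleR_matrix_vector_assoc[symmetric]
      inner_add_right inner_scaleR_right quadratic_form_compose_real
    by (simp add: algebra_simps)
  have bounds: "0 < U p" "U p \<le> um" "p \<in> cell" "1 \<le> exp (\<beta> * U p)" "\<beta> * exp (\<beta> * U p) \<le> G" if "p \<in> Om" for p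
  proof -
    show p: "0 < U p" "p \<in> cell" using that by (simp_all add: Om_iff)
    then show u: "U p \<le> um" using U_le_U_0 by (simp add: um_def)
    show "1 \<le> exp (\<beta> * U p)" using p \<beta> by simp
    have "exp (\<beta> * U p) \<le> exp (\<beta> * um)" using u \<beta> by simp
    then show "\<beta> * exp (\<beta> * U p) \<le> G" unfolding G_def using \<beta> by (intro mult_left_mono) auto
  qed
  have pos: "0 < \<Phi> p" if "p \<in> Om" for p
  proof -
    note bd = bounds[OF that]
    \<comment> \<open>This gives \<open>exp y - 1 \<le> y * exp y\<close>, so the exponential
      correction is bounded by a multiple of \<open>U\<close> and cannot destroy positivity at the
      boundary.\<close>
    have "exp (\<beta> * U p) * (1 - \<beta> * U p) \<le> exp (\<beta> * U p) * exp (- (\<beta> * U p))"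
      using exp_ge_add_one_self[of "- (\<beta> * U p)"] by (intro mult_left_mono) auto
    then have "exp (\<beta> * U p) - 1 \<le> (\<beta> * exp (\<beta> * U p)) * U p"
      by (simp add: algebra_simps flip: exp_add)
    also have "\<dots> \<le> G * U p" using bd by (intro mult_right_mono) auto
    finally have "\<kappa> * (exp (\<beta> * U p) - 1) \<le> \<kappa> * (G * U p)" using \<kappa> by (intro mult_left_mono) auto
    moreover have "\<kappa> * (G * U p) \<le> 1 / 2 * U p"
      using mult_right_mono[OF \<kappa>(2), of "U p"] bd by (simp add: mult.assoc)
    ultimately have "U p / 2 \<le> h (U p)" unfolding h_def by linarith
    moreover have "\<epsilon> * \<omega> n (\<psi> p) \<le> U p / 4"
    proof (cases "0 < \<psi> p")
      case True
      have "\<epsilon> * \<omega> n (\<psi> p) \<le> \<epsilon> * Cw" using \<omega>_le[OF True] \<epsilon> by (intro mult_left_mono) auto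
      then show ?thesis using U_ge_half[OF True] \<epsilon>(2) by linarith
    next
      case False
      then have "\<omega> n (\<psi> p) = 0" by (auto simp: \<omega>_def glue_def)
      then show ?thesis using bd by simp
    qed
    ultimately show ?thesis using bd unfolding \<Phi>_def by linarith
  qed
  have le: "pucci_form_le lam Lam (\<lambda>z. (A *v z) \<bullet> (H p *v (A *v z))) (- (m + \<eta>) * \<Phi> p)" if "p \<in> Om" for p
  proof -
    note bd = bounds[OF that]
    define u where "u = U p"
    define g where "g = \<kappa> * (\<beta> * exp (\<beta> * u))"
    define P where "P = (norm (transpose A *v DU p))\<^sup>2"
    define V where "V = \<omega> n (\<psi> p)"
    define inB where "inB \<longleftrightarrow> 0 < \<psi> p \<and> alpha + 1 / 2 < p $ 1"
    define E' where "E' = (if inB then E else 0)"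
    define C' where "C' = (if inB then C else 0)"
    have u: "0 < u" "u \<le> um" "0 \<le> exp (\<beta> * u) - 1" using bd by (simp_all add: u_def)
    have V: "0 \<le> V" using \<omega>_nonneg by (simp add: V_def)
    have E': "0 \<le> E'" using E by (simp add: E'_def)
    have g: "\<kappa> * \<beta> \<le> g" "g \<le> \<kappa> * G" "g \<le> 1 / 2" "0 < g"
    proof -
      have "\<beta> * 1 \<le> \<beta> * exp (\<beta> * u)" using \<beta> u by (intro mult_left_mono) auto
      then show "\<kappa> * \<beta> \<le> g" unfolding g_def using \<kappa> by (intro mult_left_mono) auto
      then show "0 < g" using mult_pos_pos[OF \<kappa>(1) \<beta>] by linarith
      show "g \<le> \<kappa> * G" unfolding g_def using bd(5) \<kappa> by (intro mult_left_mono) (auto simp: u_def)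
      then show "g \<le> 1 / 2" using \<kappa>(2) by linarith
    qed
    have P: "c / 2 * (u * (um - u)) \<le> P" using DU[OF that] norm_transpose_A_ge[of "DU p"] by (simp add: P_def u_def)
    have h''u: "h'' u = - (g * \<beta>)" and h'u: "h' u = 1 - g" by (simp_all add: h''_def h'_def g_def)
    have "0 < g * \<beta>" using g \<beta> by simp
    then have "pucci_weight lam Lam (- (g * \<beta>)) = - (g * \<beta>) * lam" by (simp add: pucci_weight_def)
    then have 1: "pucci_form_le lam Lam (\<lambda>z. h'' u * (DU p \<bullet> (A *v z))\<^sup>2) (- (g * \<beta>) * lam * P)"
      using pucci_form_le_gradient[of "- (g * \<beta>)" "DU p"] by (simp add: h''u P_def)
    have "pucci_form_le lam Lam (\<lambda>z. (A *v z) \<bullet> (HU p *v (A *v z))) (- m * u - E')"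
      using ex[OF bd(3)] pucci_form_le_HU[OF bd(3)] by (auto simp: E'_def inB_def u_def m_def)
    from pucci_form_le_scale[OF this, of "1 - g"]
    have 2: "pucci_form_le lam Lam (\<lambda>z. h' u * ((A *v z) \<bullet> (HU p *v (A *v z)))) ((1 - g) * (- m * u - E'))"
      using g by (simp add: h'u)
    have 3: "pucci_form_le lam Lam (\<lambda>z. \<epsilon> * (- (\<omega>'' n (\<psi> p) * (D\<psi> p \<bullet> (A *v z))\<^sup>2 + \<omega>' n (\<psi> p) * ((A *v z) \<bullet> (H\<psi> p *v (A *v z)))))) (\<epsilon> * C')"
      unfolding C'_def inB_def using \<epsilon>(1) by (intro pucci_form_le_scale bar) simp
    \<comment> \<open>The balance of gains and losses. Half of \<open>E'\<close> is available
      because \<open>1 - g \<ge> 1 / 2\<close>. The term \<open>m * \<epsilon> * V\<close> is a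
      gain, since subtracting the bump lowers \<open>\<Phi>\<close> itself and relaxes the required
      bound. The cases are the excess region, the rest away from the origin, and the rest near
      it.\<close>
    have T: "g * (m * u - \<beta> * lam * P) - E' / 2 + \<epsilon> * C' \<le> m * \<epsilon> * V - \<eta> * u"
    proof -
      have "0 \<le> c / 2 * (u * (um - u))" using c u by (intro mult_nonneg_nonneg) auto
      then have "0 \<le> \<beta> * lam * P" using P \<beta> lam by (intro mult_nonneg_nonneg) auto
      moreover have "m * u \<le> m * um" using u m by (intro mult_left_mono) auto
      ultimately have "g * (m * u - \<beta> * lam * P) \<le> g * (m * um)" using g by (intro mult_left_mono) auto
      also have "\<dots> \<le> (\<kappa> * G) * (m * um)" using g m um by (intro mult_right_mono) auto
      finally have T1: "g * (m * u - \<beta> * lam * P) \<le> \<kappa> * CV" by (simp add: CV_def mult.assoc)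
      have \<eta>u: "\<eta> * u \<le> \<eta> * um" using \<eta> u by (intro mult_left_mono) auto
      have mV: "0 \<le> m * \<epsilon> * V" using m \<epsilon> V by simp
      consider "inB" | "\<not> inB" "u \<le> u1" | "\<not> inB" "u1 < u" by linarith
      then show ?thesis
      proof cases
        case 1
        then have EC: "E' = E" "C' = C" by (simp_all add: E'_def C'_def)
        show ?thesis unfolding EC using T1 \<eta>u \<eta>(3) \<kappa>(3) \<epsilon>(3) mV E by linarith
      next
        case 2
        have "(m + 1) * u = (\<beta> * lam) * (c / 2 * (u * (um - u1)))" unfolding \<beta>_eq[symmetric] by simp
        also have "\<dots> \<le> (\<beta> * lam) * (c / 2 * (u * (um - u)))"
          using 2 u c \<beta> lam by (intro mult_left_mono) auto
        also have "\<dots> \<le> (\<beta> * lam) * P" using P \<beta> lam by (intro mult_left_mono) auto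
        finally have "m * u - \<beta> * lam * P \<le> - u" by (simp add: algebra_simps)
        then have "g * (m * u - \<beta> * lam * P) \<le> g * (- u)" using g by (intro mult_left_mono) auto
        moreover have "\<eta> * u \<le> g * u" using g \<eta>(2) u by (intro mult_right_mono) auto
        ultimately show ?thesis using 2 mV by (simp add: E'_def C'_def)
      next
        case 3
        have "m * \<epsilon> * w0 \<le> m * \<epsilon> * V"
          using near[OF bd(3)] 3 m \<epsilon> unfolding V_def u_def by (intro mult_left_mono) auto
        then show ?thesis using 3 T1 \<eta>u \<eta>(4) \<kappa>(4) by (simp add: E'_def C'_def)
      qed
    qed
    have "- (g * \<beta>) * lam * P + (1 - g) * (- m * u - E') + \<epsilon> * C' \<le> - (m + \<eta>) * \<Phi> p"
    proof -
      have "- (g * \<beta>) * lam * P + (1 - g) * (- m * u - E') + \<epsilon> * C'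
         = (g * (m * u - \<beta> * lam * P) - E' / 2 + \<epsilon> * C') - m * u - (1 / 2 - g) * E'"
        by (simp add: algebra_simps)
      also have "\<dots> \<le> (m * \<epsilon> * V - \<eta> * u) - m * u"
        using T mult_nonneg_nonneg[of "1 / 2 - g" E'] g E' by linarith
      also have "\<dots> \<le> (m * \<epsilon> * V - \<eta> * u) - m * u + ((m + \<eta>) * (\<kappa> * (exp (\<beta> * u) - 1)) + \<eta> * \<epsilon> * V)"
        using m \<eta> \<kappa> \<epsilon> u V by simp
      also have "\<dots> = - (m + \<eta>) * \<Phi> p"
        by (simp add: \<Phi>_def h_def u_def V_def algebra_simps)
      finally show ?thesis .
    qed
    from pucci_form_le_mono[OF pucci_form_le_add[OF pucci_form_le_add[OF 1 2] 3] _ this]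
    show ?thesis unfolding form u_def by simp
  qed
  have "ereal (m + \<eta>) \<le> mu1_plus lam Lam (Omega_sheared w \<gamma> a)"
  proof (rule mu1_plus_ge)
    show "viscosity_supersolution (\<lambda>r X. - (pucci lam Lam X + (m + \<eta>) * r)) (Omega_sheared w \<gamma> a) (\<lambda>x. \<Phi> (A *v x))"
      by (rule sheared_supersolution[OF C2 subset_UNIV refl le])
  qed (rule pos)
  moreover have "ereal (lam / s\<^sup>2) < ereal (m + \<eta>)" using \<eta> by (simp add: m_def)
  ultimately show ?thesis by (rule less_le_trans[rotated])
qed

end

theorem theorem5p3:
  fixes lam Lam w \<gamma> a :: real
  assumes "0 < lam" "lam \<le> Lam" "w = Lam / lam" "w \<ge> 4"
    and "\<gamma> \<in> {2 / sqrt w .. sqrt w / 2}"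
    and "\<bar>a\<bar> < pi"
  shows "viscosity_supersolution (\<lambda>r X. - pucci lam Lam X - lam * pi\<^sup>2 / (pi\<^sup>2 - a\<^sup>2) * r)
           (Omega_sheared w \<gamma> a) (u_sheared w \<gamma> a) \<and>
         mu1_plus lam Lam (Omega_sheared w \<gamma> a) \<ge> ereal (lam * pi\<^sup>2 / (pi\<^sup>2 - a\<^sup>2)) \<and>
         (mu1_plus lam Lam (Omega_sheared w \<gamma> a) = ereal (lam * pi\<^sup>2 / (pi\<^sup>2 - a\<^sup>2)) \<longleftrightarrow> a = 0)"
proof -
  interpret sheared_domain lam Lam w \<gamma> a
    using assms by unfold_locales auto
  have eq: "(\<lambda>r X. - pucci lam Lam X - lam / s\<^sup>2 * r) = (\<lambda>r X. - (pucci lam Lam X + lam / s\<^sup>2 * r))"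
    by (simp add: fun_eq_iff)
  have a0: "mu1_plus lam Lam (Omega_sheared w \<gamma> a) \<le> ereal (lam / s\<^sup>2)" if "a = 0"
  proof -
    have "b = 0" unfolding b_def using that by simp
    moreover from this have "s = 1" unfolding s_def by simp
    ultimately have "A = mat 1" unfolding A_def by (simp add: vec_eq_iff forall_3 mat_def)
    then have "Omega_sheared w \<gamma> a = Om" using Omega_sheared_iff by auto
    then show ?thesis using mu1_plus_Om_le \<open>s = 1\<close> by simp
  qed
  have "a = 0" if "mu1_plus lam Lam (Omega_sheared w \<gamma> a) = ereal (lam / s\<^sup>2)"
  proof (rule ccontr)
    assume "a \<noteq> 0"
    then have "b \<noteq> 0" by (simp add: b_def)
    from mu1_plus_sheared_gt[OF this] that show False by simp
  qed
  with a0 mu1_plus_sheared_ge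
  have "mu1_plus lam Lam (Omega_sheared w \<gamma> a) = ereal (lam / s\<^sup>2) \<longleftrightarrow> a = 0"
    by (auto intro: antisym)
  then show ?thesis
    unfolding eigenvalue_eq eq using u_sheared_supersolution mu1_plus_sheared_ge by blast
qed

end
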